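(* For $(\rho;\sigma),(\mu;\nu)\in\mathcal{Q}_n$, one has $\mathbb{O}_{\rho;\sigma}\subseteq\overline{\mathbb{O}_{\mu;\nu}}$ (Zariski closure in the exotic nilpotent cone $\mathfrak{N}$) if and only if $(\rho;\sigma)\le(\mu;\nu)$.
   Context: $\mathbb{F}$ is an algebraically closed field with $\mathrm{char}\,\mathbb{F}\ne2$, $V$ an $n$-dimensional $\mathbb{F}$-vector space, $W=V\oplus V^*$ with the symplectic form $\langle(v,f),(v',f')\rangle=f'(v)-f(v')$. $\mathfrak{N}_0$ is the variety of nilpotent endomorphisms $x$ of $W$ that are self-adjoint, i.e. $\langle xw,w'\rangle=\langle w,xw'\rangle$ for all $w,w'\in W$; $\mathfrak{N}=W\times\mathfrak{N}_0$; and $K=\mathrm{Sp}(W,\langle\cdot,\cdot\rangle)$ acts on $\mathfrak{N}$ by $g\cdot(w,x)=(gw,gxg^{-1})$. Let $\mathcal{N}$ be the variety of nilpotent endomorphisms of $V$, and embed $V\times\mathcal{N}$ in $\mathfrak{N}$ via $V\subset W$ and $x\mapsto(x,x^{\mathbf t})\in\mathrm{End}(V)\oplus\mathrm{End}(V^* )\subset\mathrm{End}(W)$. $\mathcal{Q}_n$ is the set of bipartitions $(\mu;\nu)$ (ordered pairs of partitions) with $|\mu|+|\nu|=n$. $\mathcal{O}_{\mu;\nu}\subset V\times\mathcal{N}$ is the $\mathrm{GL}(V)$-orbit consisting of the $(v,x)$ for which there is a basis $\{v_{ij}\mid 1\le i\le\ell(\mu+\nu),1\le j\le\mu_i+\nu_i\}$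 of $V$ with $xv_{ij}=v_{i,j-1}$ for $j>1$, $xv_{i1}=0$, and $v=\sum_{i=1}^{\ell(\mu)}v_{i,\mu_i}$ ($\ell(\cdot)$ is the number of nonzero parts). By a theorem of Kato, the $K$-orbits in $\mathfrak{N}$ are in bijection with $\mathcal{Q}_n$, the orbit $\mathbb{O}_{\mu;\nu}$ corresponding to $(\mu;\nu)$ being the one that contains $\mathcal{O}_{\mu;\nu}$; so $\mathbb{O}_{\mu;\nu}=K\cdot\mathcal{O}_{\mu;\nu}$. Partial order on $\mathcal{Q}_n$: $(\rho;\sigma)\le(\mu;\nu)$ iff for all $k\ge0$, $\rho_1+\sigma_1+\cdots+\rho_k+\sigma_k\le\mu_1+\nu_1+\cdots+\mu_k+\nu_k$ and $\rho_1+\sigma_1+\cdots+\rho_k+\sigma_k+\rho_{k+1}\le\mu_1+\nu_1+\cdots+\mu_k+\nu_k+\mu_{k+1}$. *)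

theory Defs
  imports
    "HOL-Computational_Algebra.Polynomial"
    "HOL-Analysis.Abstract_Topology"
    "HOL-Analysis.Product_Vector"
    "HOL-Library.Function_Algebras"
begin

section \<open>Partitions and bipartitions\<close>

text \<open>
  A partition is a weakly decreasing sequence with almost all terms zero. Parts are indexed
  from 0, so that \<open>\<mu> i\<close> is the part that is usually written with index \<open>i + 1\<close>.
\<close>

definition is_partition :: "(nat \<Rightarrow> nat) \<Rightarrow> bool" where
  "is_partition \<mu> \<longleftrightarrow> antimono \<mu> \<and> finite {i. \<mu> i \<noteq> 0}"

definition part_size :: "(nat \<Rightarrow> nat) \<Rightarrow> nat" where
  "part_size \<mu> = (\<Sum>i | \<mu> i \<noteq> 0. \<mu> i)"

definition part_len :: "(nat \<Rightarrow> nat) \<Rightarrow> nat" where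
  "part_len \<mu> = card {i. \<mu> i \<noteq> 0}"

definition bipartitions :: "nat \<Rightarrow> ((nat \<Rightarrow> nat) \<times> (nat \<Rightarrow> nat)) set" where
  "bipartitions n =
     {(\<mu>, \<nu>). is_partition \<mu> \<and> is_partition \<nu> \<and> part_size \<mu> + part_size \<nu> = n}"

definition bipartition_le ::
  "(nat \<Rightarrow> nat) \<times> (nat \<Rightarrow> nat) \<Rightarrow> (nat \<Rightarrow> nat) \<times> (nat \<Rightarrow> nat) \<Rightarrow> bool" where
  "bipartition_le = (\<lambda>(\<rho>, \<sigma>) (\<mu>, \<nu>). \<forall>k.
     (\<Sum>i<k. \<rho> i + \<sigma> i) \<le> (\<Sum>i<k. \<mu> i + \<nu> i) \<and>
     (\<Sum>i<k. \<rho> i + \<sigma> i) + \<rho> k \<le> (\<Sum>i<k. \<mu> i + \<nu> i) + \<mu> k)"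


section \<open>Linear maps on a carrier subspace\<close>

text \<open>
  The dual space of a vector space cannot be a type of its own here, because it depends on the
  scalar multiplication \<open>s\<close>. It is a subspace of a function type, so the spaces built from
  it are carrier sets in an ambient type.
\<close>

definition linear_on_carrier ::
  "('a \<Rightarrow> 'b::ab_group_add \<Rightarrow> 'b) \<Rightarrow> ('a \<Rightarrow> 'c::ab_group_add \<Rightarrow> 'c) \<Rightarrow> 'b set \<Rightarrow> ('b \<Rightarrow> 'c) \<Rightarrow> bool" where
  "linear_on_carrier s t U f \<longleftrightarrow>
     (\<forall>p\<in>U. \<forall>q\<in>U. f (p + q) = f p + f q) \<and> (\<forall>c. \<forall>p\<in>U. f (s c p) = t c (f p))"

text \<open>
  An endomorphism of \<open>U\<close> is represented by the function that extends it by 0 outside \<open>U\<close>, so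
  that equality of endomorphisms is equality of functions.
\<close>

definition endos :: "('a \<Rightarrow> 'b::ab_group_add \<Rightarrow> 'b) \<Rightarrow> 'b set \<Rightarrow> ('b \<Rightarrow> 'b) set" where
  "endos s U = {x. linear_on_carrier s s U x \<and> x ` U \<subseteq> U \<and> (\<forall>w. w \<notin> U \<longrightarrow> x w = 0)}"

definition nilpotent_on :: "'b::ab_group_add set \<Rightarrow> ('b \<Rightarrow> 'b) \<Rightarrow> bool" where
  "nilpotent_on U x \<longleftrightarrow> (\<exists>k. \<forall>w\<in>U. (x ^^ k) w = 0)"

definition fun_scale :: "('a \<Rightarrow> 'c \<Rightarrow> 'c) \<Rightarrow> 'a \<Rightarrow> ('b \<Rightarrow> 'c) \<Rightarrow> 'b \<Rightarrow> 'c" where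
  "fun_scale t c f = (\<lambda>x. t c (f x))"


section \<open>The Zariski topology on a finite-dimensional vector space\<close>

text \<open>
  The polynomial functions on \<open>E\<close> are the algebra of functions generated by the linear
  functionals on \<open>E\<close>; this needs no choice of coordinates. Values outside \<open>E\<close> are irrelevant.
\<close>

inductive_set polynomial_funs ::
  "('a::field \<Rightarrow> 'b::ab_group_add \<Rightarrow> 'b) \<Rightarrow> 'b set \<Rightarrow> ('b \<Rightarrow> 'a) set"
  for s E where
  const: "(\<lambda>_. c) \<in> polynomial_funs s E"
| linear: "linear_on_carrier s (*) E f \<Longrightarrow> f \<in> polynomial_funs s E"
| add: "f \<in> polynomial_funs s E \<Longrightarrow> g \<in> polynomial_funs s E \<Longrightarrow>
    (\<lambda>p. f p + g p) \<in> polynomial_funs s E"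
| mult: "f \<in> polynomial_funs s E \<Longrightarrow> g \<in> polynomial_funs s E \<Longrightarrow>
    (\<lambda>p. f p * g p) \<in> polynomial_funs s E"

definition zariski_open ::
  "('a::field \<Rightarrow> 'b::ab_group_add \<Rightarrow> 'b) \<Rightarrow> 'b set \<Rightarrow> 'b set \<Rightarrow> bool" where
  "zariski_open s E S \<longleftrightarrow> (\<exists>A \<subseteq> polynomial_funs s E. S = E - {p \<in> E. \<forall>f\<in>A. f p = 0})"

definition zariski ::
  "('a::field \<Rightarrow> 'b::ab_group_add \<Rightarrow> 'b) \<Rightarrow> 'b set \<Rightarrow> 'b topology" where
  "zariski s E = topology (zariski_open s E)"

lemma istopology_zariski_open: "istopology (zariski_open s E)"
  unfolding istopology_def
proof (intro conjI allI impI)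
  fix S T assume "zariski_open s E S" "zariski_open s E T"
  then obtain A B where A: "A \<subseteq> polynomial_funs s E" "S = E - {p \<in> E. \<forall>f\<in>A. f p = 0}"
    and B: "B \<subseteq> polynomial_funs s E" "T = E - {p \<in> E. \<forall>f\<in>B. f p = 0}"
    unfolding zariski_open_def by blast
  let ?C = "(\<lambda>(f, g) p. f p * g p) ` (A \<times> B)"
  have "?C \<subseteq> polynomial_funs s E"
    using A(1) B(1) by (auto intro!: polynomial_funs.mult)
  moreover have "S \<inter> T = E - {p \<in> E. \<forall>f\<in>?C. f p = 0}"
    unfolding A(2) B(2) by auto
  ultimately show "zariski_open s E (S \<inter> T)"
    unfolding zariski_open_def by blast
next
  fix \<K> assume "\<forall>K\<in>\<K>. zariski_open s E K"
  then have "\<forall>K\<in>\<K>. \<exists>A. A \<subseteq> polynomial_funs s E \<and> K = E - {p \<in> E. \<forall>f\<in>A. f p = 0}"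
    unfolding zariski_open_def .
  from bchoice[OF this] obtain A
    where A: "\<forall>K\<in>\<K>. A K \<subseteq> polynomial_funs s E \<and> K = E - {p \<in> E. \<forall>f\<in>A K. f p = 0}" ..
  have "(\<Union>K\<in>\<K>. A K) \<subseteq> polynomial_funs s E"
    using A by (auto intro!: UN_least)
  moreover have "\<Union>\<K> = (\<Union>K\<in>\<K>. E - {p \<in> E. \<forall>f\<in>A K. f p = 0})"
  proof -
    have "(\<Union>K\<in>\<K>. K) = (\<Union>K\<in>\<K>. E - {p \<in> E. \<forall>f\<in>A K. f p = 0})"
      by (rule SUP_cong[OF refl]) (use A in fast)
    then show ?thesis
      by simp
  qed
  then have "\<Union>\<K> = E - {p \<in> E. \<forall>f\<in>(\<Union>K\<in>\<K>. A K). f p = 0}"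
    by auto
  ultimately show "zariski_open s E (\<Union>\<K>)"
    unfolding zariski_open_def by (intro exI conjI)
qed

lemma openin_zariski: "openin (zariski s E) S \<longleftrightarrow> zariski_open s E S"
  by (simp add: zariski_def topology_inverse' istopology_zariski_open)

lemma topspace_zariski [simp]: "topspace (zariski s E) = E"
proof -
  have "zariski_open s E E"
    unfolding zariski_open_def
    by (intro exI[of _ "{\<lambda>_. 1}"]) (auto intro: polynomial_funs.const)
  then show ?thesis
    unfolding topspace_def openin_zariski by (auto simp: zariski_open_def)
qed

lemma closedin_zariski:
  "closedin (zariski s E) S \<longleftrightarrow> (\<exists>A \<subseteq> polynomial_funs s E. S = {p \<in> E. \<forall>f\<in>A. f p = 0})"
proof -
  have *: "S = {p \<in> E. P p} \<longleftrightarrow> S \<subseteq> E \<and> E - S = E - {p \<in> E. P p}" for P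
    by auto
  show ?thesis
    unfolding closedin_def topspace_zariski openin_zariski zariski_open_def *
    by (iprover intro: iffI conjI exI elim: conjE exE)
qed


section \<open>The symplectic space and the exotic nilpotent cone\<close>

text \<open>
  Throughout, \<open>V\<close> is the whole type \<open>'v\<close> with scalar multiplication \<open>s\<close>, and \<open>W = V \<oplus> V*\<close> is
  the carrier \<open>symp_space s\<close>.
\<close>

definition dual_space :: "('a::field \<Rightarrow> 'v::ab_group_add \<Rightarrow> 'v) \<Rightarrow> ('v \<Rightarrow> 'a) set" where
  "dual_space s = {f. Vector_Spaces.linear s (*) f}"

definition symp_space :: "('a::field \<Rightarrow> 'v::ab_group_add \<Rightarrow> 'v) \<Rightarrow> ('v \<times> ('v \<Rightarrow> 'a)) set" where
  "symp_space s = UNIV \<times> dual_space s"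

definition symp_scale ::
  "('a::field \<Rightarrow> 'v::ab_group_add \<Rightarrow> 'v) \<Rightarrow> 'a \<Rightarrow> 'v \<times> ('v \<Rightarrow> 'a) \<Rightarrow> 'v \<times> ('v \<Rightarrow> 'a)" where
  "symp_scale s = module_prod.scale s (fun_scale (*))"

definition symp_form :: "'v \<times> ('v \<Rightarrow> 'a::field) \<Rightarrow> 'v \<times> ('v \<Rightarrow> 'a) \<Rightarrow> 'a" where
  "symp_form = (\<lambda>(v, f) (v', f'). f' v - f v')"

type_synonym ('a, 'v) symp_end = "'v \<times> ('v \<Rightarrow> 'a) \<Rightarrow> 'v \<times> ('v \<Rightarrow> 'a)"

definition symp_endos :: "('a::field \<Rightarrow> 'v::ab_group_add \<Rightarrow> 'v) \<Rightarrow> ('a, 'v) symp_end set" where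
  "symp_endos s = endos (symp_scale s) (symp_space s)"

definition selfadj_nilpotents ::
  "('a::field \<Rightarrow> 'v::ab_group_add \<Rightarrow> 'v) \<Rightarrow> ('a, 'v) symp_end set" where
  "selfadj_nilpotents s =
     {x \<in> symp_endos s. nilpotent_on (symp_space s) x \<and>
        (\<forall>w\<in>symp_space s. \<forall>w'\<in>symp_space s. symp_form (x w) w' = symp_form w (x w'))}"

definition exotic_cone ::
  "('a::field \<Rightarrow> 'v::ab_group_add \<Rightarrow> 'v) \<Rightarrow> (('v \<times> ('v \<Rightarrow> 'a)) \<times> ('a, 'v) symp_end) set" where
  "exotic_cone s = symp_space s \<times> selfadj_nilpotents s"

definition exotic_zariski ::
  "('a::field \<Rightarrow> 'v::ab_group_add \<Rightarrow> 'v) \<Rightarrow> (('v \<times> ('v \<Rightarrow> 'a)) \<times> ('a, 'v) symp_end) topology" where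
  "exotic_zariski s =
     subtopology
       (zariski (module_prod.scale (symp_scale s) (fun_scale (symp_scale s)))
         (symp_space s \<times> symp_endos s))
       (exotic_cone s)"

definition symplectic_group ::
  "('a::field \<Rightarrow> 'v::ab_group_add \<Rightarrow> 'v) \<Rightarrow> ('a, 'v) symp_end set" where
  "symplectic_group s =
     {g \<in> symp_endos s. bij_betw g (symp_space s) (symp_space s) \<and>
        (\<forall>w\<in>symp_space s. \<forall>w'\<in>symp_space s. symp_form (g w) (g w') = symp_form w w')}"

definition exotic_act ::
  "('a::field \<Rightarrow> 'v::ab_group_add \<Rightarrow> 'v) \<Rightarrow> ('a, 'v) symp_end \<Rightarrow>
   ('v \<times> ('v \<Rightarrow> 'a)) \<times> ('a, 'v) symp_end \<Rightarrow> ('v \<times> ('v \<Rightarrow> 'a)) \<times> ('a, 'v) symp_end" where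
  "exotic_act s g = (\<lambda>(w, x).
     (g w, \<lambda>u. if u \<in> symp_space s then g (x (inv_into (symp_space s) g u)) else 0))"


section \<open>Orbits\<close>

definition nilpotents :: "('a::field \<Rightarrow> 'v::ab_group_add \<Rightarrow> 'v) \<Rightarrow> ('v \<Rightarrow> 'v) set" where
  "nilpotents s = {x. Vector_Spaces.linear s s x \<and> nilpotent_on UNIV x}"

text \<open>The transpose of \<open>x\<close> sends a functional \<open>f\<close> to \<open>f \<circ> x\<close>.\<close>

definition exotic_embed ::
  "('a::field \<Rightarrow> 'v::ab_group_add \<Rightarrow> 'v) \<Rightarrow>
   'v \<times> ('v \<Rightarrow> 'v) \<Rightarrow> ('v \<times> ('v \<Rightarrow> 'a)) \<times> ('a, 'v) symp_end" where
  "exotic_embed s = (\<lambda>(v, x).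
     ((v, 0), \<lambda>(u, f). if (u, f) \<in> symp_space s then (x u, f \<circ> x) else 0))"

text \<open>
  The rows of the basis \<open>b\<close> are indexed from 0, as for partitions, and the positions in a row
  from 1. Thus \<open>b i (\<mu> i)\<close> is the last vector of the initial segment of length \<open>\<mu> i\<close> of row \<open>i\<close>.
\<close>

definition enhanced_orbit ::
  "('a::field \<Rightarrow> 'v::ab_group_add \<Rightarrow> 'v) \<Rightarrow> (nat \<Rightarrow> nat) \<times> (nat \<Rightarrow> nat) \<Rightarrow> ('v \<times> ('v \<Rightarrow> 'v)) set" where
  "enhanced_orbit s = (\<lambda>(\<mu>, \<nu>). {(v, x). x \<in> nilpotents s \<and>
     (\<exists>b :: nat \<Rightarrow> nat \<Rightarrow> 'v.
        let I = {(i, j). i < part_len (\<mu> + \<nu>) \<and> 1 \<le> j \<and> j \<le> \<mu> i + \<nu> i} in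
        inj_on (\<lambda>(i, j). b i j) I \<and>
        \<not> module.dependent s ((\<lambda>(i, j). b i j) ` I) \<and>
        module.span s ((\<lambda>(i, j). b i j) ` I) = UNIV \<and>
        (\<forall>(i, j)\<in>I. x (b i j) = (if j = 1 then 0 else b i (j - 1))) \<and>
        v = (\<Sum>i<part_len \<mu>. b i (\<mu> i)))})"

text \<open>The orbit of the symplectic group that contains the embedded enhanced orbit.\<close>

definition exotic_orbit ::
  "('a::field \<Rightarrow> 'v::ab_group_add \<Rightarrow> 'v) \<Rightarrow> (nat \<Rightarrow> nat) \<times> (nat \<Rightarrow> nat) \<Rightarrow>
   (('v \<times> ('v \<Rightarrow> 'a)) \<times> ('a, 'v) symp_end) set" where
  "exotic_orbit s \<mu>\<nu> =
     {exotic_act s g (exotic_embed s p) | g p. g \<in> symplectic_group s \<and> p \<in> enhanced_orbit s \<mu>\<nu>}"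

end

theory Submission
  imports Defs "Jordan_Normal_Form.Determinant"
begin

text \<open>
  Interleave a bipartition to the sequence \<open>\<mu> 0, \<nu> 0, \<mu> 1, \<nu> 1, \<dots>\<close>; the order on bipartitions
  becomes dominance of partial sums. Every strict dominance can be refined by elementary moves, and
  each move is realized by an affine line in \<open>V \<times> End V\<close> that meets the smaller enhanced orbit
  in one given point and lies in the larger one up to finitely many points. This gives the inclusion
  of closures, because the closure of an orbit of the symplectic group is stable under the group.

  Conversely, for \<open>(w, y)\<close> in the exotic cone, let \<open>m\<close> and \<open>j\<close> be fixed and consider on
  \<open>W\<close> plus an \<open>m\<close>-dimensional space the alternating form obtained from \<open>\<langle>y^j u, u'\<rangle>\<close> by
  bordering it with the vectors \<open>w, y w, \<dots>, y^(m-1) w\<close>. The rank of this form is an invariant of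
  the group, bounding it is a closed condition, and at \<open>(v, x) \<in> V \<times> N\<close> it is twice the dimension
  \<open>d\<close> of \<open>x^j V + span {v, \<dots>, x^(m-1) v}\<close>. The minimum of \<open>k j + d\<close> over \<open>j\<close> is the
  \<open>k\<close>-th partial sum of \<open>\<mu> + \<nu>\<close> for \<open>m = 0\<close>, and it is that sum plus \<open>\<mu> k\<close> for large \<open>m\<close>.
\<close>

section \<open>Bipartitions and cyclic generators\<close>

text \<open>The more obvious invariant, the dimension of y^j W + span {w, ..., y^(m-1) w}, is too
  coarse: at an embedded point the dual summand adds the image of the transpose of x^j, so this
  dimension is d plus the rank of x^j, and the sum does not control d separately. Bordering the form
  puts the powers of w into its rows and its columns, so that V and its dual contribute d each. The
  quantity k j + d comes from a count in a Jordan basis: each of the first k rows has at most j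
  vectors outside x^j V, and modulo the other rows the powers of v supply \<mu> k vectors of row k.
  The lines can be drawn in V \<times> End V because the embedding is linear on that space, and not
  only defined on its nilpotent part. An algebraically closed field is infinite, so a polynomial
  function that vanishes at all but finitely many points of a line vanishes on the whole line, in
  particular at the given point.\<close>

definition padded_bipartition :: "nat \<Rightarrow> (nat \<Rightarrow> nat) \<Rightarrow> (nat \<Rightarrow> nat) \<Rightarrow> bool" where
  "padded_bipartition n \<mu> \<nu> \<longleftrightarrow> antimono \<mu> \<and> antimono \<nu> \<and>
     (\<forall>i\<ge>n. \<mu> i = 0 \<and> \<nu> i = 0) \<and> (\<Sum>i<n. \<mu> i + \<nu> i) = n"

text \<open>Monotonicity makes the support an initial segment, so its cardinality is also the first
  index with part 0.\<close>

lemma less_part_len_iff: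
  assumes "is_partition \<mu>"
  shows "i < part_len \<mu> \<longleftrightarrow> \<mu> i \<noteq> 0"
proof -
  let ?S = "{i. \<mu> i \<noteq> 0}"
  have fin: "finite ?S" and anti: "antimono \<mu>"
    using assms by (auto simp: is_partition_def)
  have ex: "\<exists>m. \<mu> m = 0"
    using ex_new_if_finite[OF infinite_UNIV_nat fin] by simp
  define m where "m = (LEAST m. \<mu> m = 0)"
  have m: "\<mu> m = 0"
    unfolding m_def using ex by (rule LeastI_ex)
  have "i < m" if "\<mu> i \<noteq> 0" for i
    using antimonoD[OF anti, of m i] m that by (metis le_zero_eq not_le)
  moreover have "\<mu> i \<noteq> 0" if "i < m" for i
    using that not_less_Least unfolding m_def by blast
  ultimately have "?S = {..<m}"
    by auto
  then have "part_len \<mu> = m" "i \<in> ?S \<longleftrightarrow> i \<in> {..<m}"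
    by (simp_all add: part_len_def)
  then show ?thesis
    by simp
qed

lemma part_index_le_part_size:
  assumes "is_partition \<mu>" "part_size \<mu> \<le> i"
  shows "\<mu> i = 0"
proof (rule ccontr)
  assume "\<mu> i \<noteq> 0"
  then have "i < part_len \<mu>"
    using less_part_len_iff[OF assms(1)] by blast
  also have "part_len \<mu> \<le> part_size \<mu>"
    unfolding part_len_def part_size_def card_eq_sum by (rule sum_mono) simp
  finally show False
    using assms(2) by simp
qed

lemma part_size_eq_sum:
  assumes "is_partition \<mu>" "part_size \<mu> \<le> n"
  shows "part_size \<mu> = (\<Sum>i<n. \<mu> i)"
proof -
  have "{i. \<mu> i \<noteq> 0} \<subseteq> {..<n}"
  proof (intro subsetI, unfold mem_Collect_eq)
    fix i assume "\<mu> i \<noteq> 0"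
    then show "i \<in> {..<n}"
      using part_index_le_part_size[OF assms(1), of i] assms(2) by fastforce
  qed
  then show ?thesis
    unfolding part_size_def by (intro sum.mono_neutral_left) auto
qed

text \<open>Each nonzero part counts at least 1 in the size, so all nonzero parts of a bipartition
  of n have indices below n. In the padded form every sum runs over the fixed range
  \<open>{..<n}\<close>, with n the dimension, instead of over a support.\<close>

lemma bipartitions_iff: "(\<mu>, \<nu>) \<in> bipartitions n \<longleftrightarrow> padded_bipartition n \<mu> \<nu>"
proof
  assume "(\<mu>, \<nu>) \<in> bipartitions n"
  then have *: "is_partition \<mu>" "is_partition \<nu>" "part_size \<mu> + part_size \<nu> = n"
    by (simp_all add: bipartitions_def)
  then have le: "part_size \<mu> \<le> n" "part_size \<nu> \<le> n"
    by simp_all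
  have "\<mu> i = 0 \<and> \<nu> i = 0" if "n \<le> i" for i
    using part_index_le_part_size[OF *(1)] part_index_le_part_size[OF *(2)] le that
    by (meson order_trans)
  moreover have "(\<Sum>i<n. \<mu> i + \<nu> i) = n"
    using part_size_eq_sum[OF *(1) le(1)] part_size_eq_sum[OF *(2) le(2)] *(3)
    by (simp add: sum.distrib)
  ultimately show "padded_bipartition n \<mu> \<nu>"
    using * by (simp add: padded_bipartition_def is_partition_def)
next
  assume *: "padded_bipartition n \<mu> \<nu>"
  have sub: "{i. \<mu> i \<noteq> 0} \<subseteq> {..<n}" "{i. \<nu> i \<noteq> 0} \<subseteq> {..<n}"
    using * unfolding padded_bipartition_def
    by (metis (mono_tags) lessThan_iff mem_Collect_eq not_le subsetI)+
  have fin: "finite {i. \<mu> i \<noteq> 0}" "finite {i. \<nu> i \<noteq> 0}"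
    using sub finite_lessThan by (blast intro: finite_subset)+
  have "part_size \<mu> = (\<Sum>i<n. \<mu> i)" "part_size \<nu> = (\<Sum>i<n. \<nu> i)"
    unfolding part_size_def by (intro sum.mono_neutral_left sub; simp)+
  then show "(\<mu>, \<nu>) \<in> bipartitions n"
    using * fin by (simp add: bipartitions_def padded_bipartition_def is_partition_def sum.distrib)
qed


section \<open>Submodules generated under an endomorphism, and Jordan bases\<close>

locale fin_dim_space = finite_dimensional_vector_space scale Basis
  for scale :: "'a::field \<Rightarrow> 'b::ab_group_add \<Rightarrow> 'b" and Basis
begin

abbreviation lin :: "('b \<Rightarrow> 'b) \<Rightarrow> bool" where
  "lin \<equiv> Vector_Spaces.linear scale scale"

text \<open>The submodule generated by \<open>S\<close> when the space is viewed as a module over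
  the polynomials in \<open>x\<close>.\<close>

definition generated :: "('b \<Rightarrow> 'b) \<Rightarrow> 'b set \<Rightarrow> 'b set" where
  "generated x S = span {(x ^^ k) z | k z. z \<in> S}"

lemma lin_add: "lin x \<Longrightarrow> x (u + v) = x u + x v"
  by (simp add: Vector_Spaces.linear_iff)

lemma lin_scale: "lin x \<Longrightarrow> x (scale c u) = scale c (x u)"
  by (simp add: Vector_Spaces.linear_iff)

lemma lin_0: "lin x \<Longrightarrow> x 0 = 0"
  using lin_scale[of x 0 0] by simp

lemma lin_minus: "lin x \<Longrightarrow> x (- u) = - x u"
  by (rule module_hom.neg[OF Vector_Spaces.linear.axioms(3)])

lemma lin_diff: "lin x \<Longrightarrow> x (u - v) = x u - x v"
  by (rule module_hom.diff[OF Vector_Spaces.linear.axioms(3)])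

lemma lin_sum: "lin x \<Longrightarrow> x (sum f A) = (\<Sum>a\<in>A. x (f a))"
  by (rule module_hom.sum[OF Vector_Spaces.linear.axioms(3)])

lemmas lin_simps = lin_0 lin_add lin_scale lin_minus lin_diff lin_sum

lemma lin_id: "lin (\<lambda>u. u)"
  by (simp add: Vector_Spaces.linear_iff vector_space_axioms)

lemma lin_compose: "lin x \<Longrightarrow> lin y \<Longrightarrow> lin (\<lambda>u. x (y u))"
  by (simp add: Vector_Spaces.linear_iff)

lemma lin_funpow: "lin x \<Longrightarrow> lin (x ^^ k)"
proof (induction k)
  case 0
  then show ?case using lin_id by (simp add: id_def)
next
  case (Suc k)
  then show ?case using lin_compose[of x "x ^^ k"] by (simp add: comp_def)
qed

lemma lin_plus: "lin x \<Longrightarrow> lin y \<Longrightarrow> lin (\<lambda>u. x u + y u)"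
  by (simp add: Vector_Spaces.linear_iff scale_right_distrib algebra_simps)

lemma lin_smult: "lin x \<Longrightarrow> lin (\<lambda>u. scale c (x u))"
  by (simp add: Vector_Spaces.linear_iff scale_right_distrib scale_left_commute)

lemma subspace_lin_vimage:
  assumes "lin x" "subspace T"
  shows "subspace {u. x u \<in> T}"
  using assms(2) by (auto simp: subspace_def lin_simps[OF assms(1)])

lemma subspace_generated: "subspace (generated x S)"
  by (simp add: generated_def)

lemma generated_base: "z \<in> S \<Longrightarrow> z \<in> generated x S"
  unfolding generated_def by (intro span_base CollectI exI[of _ "0::nat"] exI[of _ z]) simp

lemma generated_step:
  assumes "lin x" "u \<in> generated x S"
  shows "x u \<in> generated x S"
proof -
  have "generated x S \<subseteq> {u. x u \<in> generated x S}"
    unfolding generated_def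
  proof (rule span_minimal)
    show "{(x ^^ k) z |k z. z \<in> S} \<subseteq> {u. x u \<in> span {(x ^^ k) z |k z. z \<in> S}}"
    proof clarify
      fix k z assume "z \<in> S"
      then show "x ((x ^^ k) z) \<in> span {(x ^^ k) z |k z. z \<in> S}"
        by (intro span_base CollectI exI[of _ "Suc k"] exI[of _ z]) simp
    qed
  qed (intro subspace_lin_vimage assms subspace_span)
  then show ?thesis using assms(2) by blast
qed

lemma generated_funpow: "lin x \<Longrightarrow> u \<in> generated x S \<Longrightarrow> (x ^^ k) u \<in> generated x S"
  by (induction k) (auto intro: generated_step)

lemma generated_minimal:
  assumes "subspace T" "\<And>u. u \<in> T \<Longrightarrow> x u \<in> T" "S \<subseteq> T"
  shows "generated x S \<subseteq> T"
proof -
  have "(x ^^ k) z \<in> T" if "z \<in> S" for k z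
    using that assms(3) by (induction k) (simp_all add: assms(2) subset_iff)
  then show ?thesis
    unfolding generated_def by (intro span_minimal assms) auto
qed

lemma generated_UNIV_I:
  assumes "lin x" "generated y S = UNIV"
    "\<And>u. u \<in> generated x T \<Longrightarrow> y u \<in> generated x T" "S \<subseteq> generated x T"
  shows "generated x T = UNIV"
proof -
  have "generated y S \<subseteq> generated x T"
    by (intro generated_minimal subspace_generated assms)
  then show ?thesis
    unfolding assms(2) by (rule top.extremum_uniqueI)
qed

lemma generated_trans:
  assumes "lin x" "generated x S = UNIV" "S \<subseteq> generated x T"
  shows "generated x T = UNIV"
  by (rule generated_UNIV_I[OF assms(1,2) generated_step[OF assms(1)] assms(3)])

text \<open>A spanning family with as many indices as the dimension cannot repeat a vector. Families
  are used because the bases below are indexed by row and position, and injectivity of the indexing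
  has to come out of the count.\<close>

lemma spanning_family_independent:
  assumes "finite I" "card I = card Basis" "span (f ` I) = UNIV"
  shows "inj_on f I" "independent (f ` I)"
proof -
  have le: "card (f ` I) \<le> card I"
    using assms(1) by (rule card_image_le)
  have ge: "card Basis \<le> card (f ` I)"
    using dim_le_card[of UNIV "f ` I"] assms by simp
  show "inj_on f I"
    by (rule eq_card_imp_inj_on[OF assms(1)]) (use le ge assms(2) in simp)
  show "independent (f ` I)"
    by (rule card_le_dim_spanning[of _ UNIV]) (use assms le in auto)
qed

text \<open>Injectivity of the family makes it unambiguous to prescribe values by index. The
  directions \<open>E\<close> of the lines below are defined in this way.\<close>

lemma linear_extension:
  assumes "finite I" "card I = card Basis" "span (f ` I) = UNIV"
  obtains h where "lin h" "\<And>i. i \<in> I \<Longrightarrow> h (f i) = g i"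
proof -
  interpret vector_space_pair scale scale ..
  note * = spanning_family_independent[OF assms]
  obtain h where h: "lin h" "\<forall>u\<in>f ` I. h u = g (the_inv_into I f u)"
    using linear_independent_extend[OF *(2), of "\<lambda>u. g (the_inv_into I f u)"] by blast
  have "h (f i) = g i" if "i \<in> I" for i
    using h(2) that by (simp add: the_inv_into_f_f[OF *(1) that])
  then show ?thesis
    using that h(1) by blast
qed

text \<open>
  In the next two lemmas \<open>Z i\<close> is the last vector of row \<open>i\<close> of a Jordan basis, so the vector
  in position \<open>\<mu> i\<close> of that row is \<open>(x ^^ \<nu> i) (Z i)\<close>. Since the row lengths add up to the
  dimension, it suffices that the rows span.
\<close>

lemma enhanced_orbitI:
  fixes \<mu> \<nu> :: "nat \<Rightarrow> nat" and Z :: "nat \<Rightarrow> 'b"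
  assumes bip: "padded_bipartition (card Basis) \<mu> \<nu>" and lin: "lin x"
    and zero: "\<And>i. (x ^^ (\<mu> i + \<nu> i)) (Z i) = 0"
    and gen: "generated x (range Z) = UNIV"
    and v: "v = (\<Sum>i<card Basis. (x ^^ \<nu> i) (Z i))"
  shows "(v, x) \<in> enhanced_orbit scale (\<mu>, \<nu>)"
proof -
  define n where "n = card Basis"
  \<comment> \<open>Positions count from the kernel, so position j is reached from
    \<open>Z i\<close> by \<open>\<mu> i + \<nu> i - j\<close> applications of
    \<open>x\<close>.\<close>
  define b where "b i j = (x ^^ (\<mu> i + \<nu> i - j)) (Z i)" for i j
  define I where "I = {(i, j). i < part_len (\<mu> + \<nu>) \<and> 1 \<le> j \<and> j \<le> \<mu> i + \<nu> i}"
  let ?f = "\<lambda>(i, j). b i j"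
  note bipn = bip[folded n_def, unfolded padded_bipartition_def]
  have part: "is_partition \<mu>" "is_partition \<nu>"
    using bip bipartitions_iff[of \<mu> \<nu>] by (auto simp: bipartitions_def)
  have "is_partition (\<mu> + \<nu>)"
    using part by (auto simp: is_partition_def monotone_def add_mono)
  note len = less_part_len_iff[OF this]
  have I_eq: "I = Sigma {..<n} (\<lambda>i. {1..\<mu> i + \<nu> i})"
  proof -
    have "i < n" if "(\<mu> + \<nu>) i \<noteq> 0" for i
      using that bipn by (metis add_0 not_le plus_fun_apply)
    then show ?thesis
      unfolding I_def len by auto
  qed
  have finI: "finite I" and cardI: "card I = card Basis"
    unfolding I_eq using bipn by (auto simp: n_def)
  have step: "x (b i j) = (if j = 1 then 0 else b i (j - 1))" if "(i, j) \<in> I" for i j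
  proof -
    have "Suc (\<mu> i + \<nu> i - j) = \<mu> i + \<nu> i - (j - 1)"
      using that by (auto simp: I_def)
    then have "x (b i j) = (x ^^ (\<mu> i + \<nu> i - (j - 1))) (Z i)"
      by (metis b_def comp_apply funpow.simps(2))
    then show ?thesis
      using zero[of i] by (auto simp: b_def)
  qed
  have span: "span (?f ` I) = UNIV"
  proof -
    have "generated x (range Z) \<subseteq> span (?f ` I)"
    proof (rule generated_minimal)
      fix u assume "u \<in> span (?f ` I)"
      moreover have "span (?f ` I) \<subseteq> {u. x u \<in> span (?f ` I)}"
      proof (rule span_minimal)
        show "?f ` I \<subseteq> {u. x u \<in> span (?f ` I)}"
        proof clarify
          fix i j assume ij: "(i, j) \<in> I"
          have "b i (j - 1) \<in> span (?f ` I)" if "j \<noteq> 1"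
            by (rule span_base, rule image_eqI[of _ _ "(i, j - 1)"]) (use ij that in \<open>auto simp: I_def\<close>)
          then show "x (b i j) \<in> span (?f ` I)"
            unfolding step[OF ij] by (simp add: span_zero)
        qed
      qed (intro subspace_lin_vimage lin subspace_span)
      ultimately show "x u \<in> span (?f ` I)" by blast
    next
      show "range Z \<subseteq> span (?f ` I)"
      proof clarify
        fix i
        show "Z i \<in> span (?f ` I)"
        proof (cases "\<mu> i + \<nu> i = 0")
          case True
          then show ?thesis using zero[of i] by (simp add: span_zero)
        next
          case False
          then have "(i, \<mu> i + \<nu> i) \<in> I"
            using len[of i] by (auto simp: I_def)
          then have "?f (i, \<mu> i + \<nu> i) \<in> span (?f ` I)" by (intro span_base imageI)
          then show ?thesis by (simp add: b_def)
        qed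
      qed
    qed auto
    then show ?thesis using gen by blast
  qed
  have "nilpotent_on UNIV x"
    unfolding nilpotent_on_def
  proof (intro exI ballI)
    fix u
    have "generated x (range Z) \<subseteq> {u. (x ^^ n) u = (\<lambda>_. 0) u}"
    proof (rule generated_minimal)
      show "subspace {u. (x ^^ n) u = (\<lambda>_. 0) u}"
        by (auto simp: subspace_def lin_simps[OF lin_funpow[OF lin]])
      show "x u \<in> {u. (x ^^ n) u = 0}" if "u \<in> {u. (x ^^ n) u = 0}" for u
        using that lin_0[OF lin] by (simp add: funpow_swap1[symmetric])
      show "range Z \<subseteq> {u. (x ^^ n) u = 0}"
      proof clarify
        fix i
        have "\<mu> i + \<nu> i \<le> n"
          using member_le_sum[of i "{..<n}" "\<lambda>i. \<mu> i + \<nu> i"] bipn by (cases "i < n") auto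
        then have "(x ^^ n) (Z i) = (x ^^ (n - (\<mu> i + \<nu> i))) ((x ^^ (\<mu> i + \<nu> i)) (Z i))"
          by (metis comp_apply funpow_add le_add_diff_inverse2)
        then show "(x ^^ n) (Z i) = 0"
          by (simp only: zero lin_0[OF lin_funpow[OF lin]])
      qed
    qed
    then show "(x ^^ n) u = 0" using gen by auto
  qed
  then have nil: "x \<in> nilpotents scale"
    using lin by (simp add: nilpotents_def)
  \<comment> \<open>In rows with \<open>\<mu> i = 0\<close> the summand
    \<open>(x ^^ \<nu> i) (Z i)\<close> is 0 by \<open>zero\<close>, so the sum over
    \<open>part_len \<mu>\<close> extends to all n rows.\<close>
  have "v = (\<Sum>i<part_len \<mu>. b i (\<mu> i))"
  proof -
    have "part_len \<mu> \<le> n"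
      using less_part_len_iff[OF part(1)] bipn by (meson leI less_irrefl)
    moreover have "b i (\<mu> i) = 0" if "\<not> i < part_len \<mu>" for i
      using zero[of i] that by (simp add: b_def less_part_len_iff[OF part(1)])
    ultimately have "(\<Sum>i<part_len \<mu>. b i (\<mu> i)) = (\<Sum>i<n. b i (\<mu> i))"
      by (intro sum.mono_neutral_left) auto
    then show ?thesis by (simp add: v b_def n_def)
  qed
  then have "inj_on ?f I \<and> independent (?f ` I) \<and> span (?f ` I) = UNIV \<and>
      (\<forall>(i, j)\<in>I. x (b i j) = (if j = 1 then 0 else b i (j - 1))) \<and>
      v = (\<Sum>i<part_len \<mu>. b i (\<mu> i))"
    by (intro conjI spanning_family_independent[OF finI cardI span] span) (auto simp: step)
  then have "\<exists>b. inj_on (\<lambda>(i, j). b i j) I \<and> independent ((\<lambda>(i, j). b i j) ` I) \<and>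
      span ((\<lambda>(i, j). b i j) ` I) = UNIV \<and>
      (\<forall>(i, j)\<in>I. x (b i j) = (if j = 1 then 0 else b i (j - 1))) \<and>
      v = (\<Sum>i<part_len \<mu>. b i (\<mu> i))"
    by (intro exI[of _ b])
  then show ?thesis
    using nil by (simp only: enhanced_orbit_def I_def Let_def prod.case mem_Collect_eq simp_thms)
qed

lemma enhanced_orbitE:
  assumes bip: "padded_bipartition (card Basis) \<mu> \<nu>"
    and orb: "(v, x) \<in> enhanced_orbit scale (\<mu>, \<nu>)"
  obtains Z where "lin x" "\<And>i. (x ^^ (\<mu> i + \<nu> i)) (Z i) = 0" "generated x (range Z) = UNIV"
    "v = (\<Sum>i<card Basis. (x ^^ \<nu> i) (Z i))"
proof -
  define n where "n = card Basis"
  define I where "I = {(i, j). i < part_len (\<mu> + \<nu>) \<and> 1 \<le> j \<and> j \<le> \<mu> i + \<nu> i}"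
  note bipn = bip[folded n_def, unfolded padded_bipartition_def]
  have part: "is_partition \<mu>" "is_partition \<nu>"
    using bip bipartitions_iff[of \<mu> \<nu>] by (auto simp: bipartitions_def)
  have "is_partition (\<mu> + \<nu>)"
    using part by (auto simp: is_partition_def monotone_def add_mono)
  note len = less_part_len_iff[OF this]
  obtain b where lin: "lin x" and span: "span ((\<lambda>(i, j). b i j) ` I) = UNIV"
    and step: "\<And>i j. (i, j) \<in> I \<Longrightarrow> x (b i j) = (if j = 1 then 0 else b i (j - 1))"
    and v: "v = (\<Sum>i<part_len \<mu>. b i (\<mu> i))"
    using orb unfolding enhanced_orbit_def I_def nilpotents_def Let_def by fast
  \<comment> \<open>For an empty row \<open>b\<close> is unconstrained; the value 0 makes the
    relation \<open>zero\<close> hold there too.\<close>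
  define Z where "Z i = (if \<mu> i + \<nu> i = 0 then 0 else b i (\<mu> i + \<nu> i))" for i
  have pow: "(x ^^ j) (Z i) = b i (\<mu> i + \<nu> i - j)" if "j < \<mu> i + \<nu> i" for i j
    using that
  proof (induction j)
    case 0
    then show ?case by (auto simp: Z_def)
  next
    case (Suc j)
    moreover have "(i, \<mu> i + \<nu> i - j) \<in> I"
      using Suc.prems len[of i] by (auto simp: I_def)
    ultimately show ?case by (auto simp: step)
  qed
  have zero: "(x ^^ (\<mu> i + \<nu> i)) (Z i) = 0" for i
  proof (cases "\<mu> i + \<nu> i = 0")
    case False
    then obtain m where m: "\<mu> i + \<nu> i = Suc m"
      using not0_implies_Suc by blast
    moreover have "(i, 1) \<in> I"
      using False len[of i] by (auto simp: I_def)
    ultimately show ?thesis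
      using pow[of m i] by (simp add: m step)
  qed (simp add: Z_def)
  have "span ((\<lambda>(i, j). b i j) ` I) \<subseteq> generated x (range Z)"
  proof (intro span_minimal subspace_generated, clarify)
    fix i j assume "(i, j) \<in> I"
    then have "b i j = (x ^^ (\<mu> i + \<nu> i - j)) (Z i)"
      by (subst pow) (auto simp: I_def)
    then show "b i j \<in> generated x (range Z)"
      by (simp add: generated_funpow lin generated_base)
  qed
  then have gen: "generated x (range Z) = UNIV"
    using span by blast
  have "(x ^^ \<nu> i) (Z i) = (if \<mu> i = 0 then 0 else b i (\<mu> i))" for i
    using pow[of "\<nu> i" i] zero[of i] by auto
  moreover have "part_len \<mu> \<le> n"
    using less_part_len_iff[OF part(1)] bipn by (meson leI less_irrefl)
  moreover have "\<mu> i = 0" if "i \<in> {..<n} - {..<part_len \<mu>}" for i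
    using less_part_len_iff[OF part(1), of i] that by auto
  ultimately have "v = (\<Sum>i<n. (x ^^ \<nu> i) (Z i))"
    unfolding v by (intro sum.mono_neutral_cong_left) (simp_all add: less_part_len_iff[OF part(1)])
  then show ?thesis
    using that lin zero gen n_def by blast
qed

end

section \<open>Degenerations along affine lines\<close>

text \<open>Accounts for \<open>v\<close> after a box has moved: the contributions of only two rows
  change, and the corrections cancel.\<close>

lemma sum_cong_except_two:
  assumes "finite A" "p \<in> A" "q \<in> A" "p \<noteq> q"
    "\<And>i. i \<noteq> p \<Longrightarrow> i \<noteq> q \<Longrightarrow> f i = g i" "f p + f q = g p + g q"
  shows "sum f A = sum g A"
proof -
  have split: "sum h A = (h p + h q) + sum h (A - {p} - {q})" for h
  proof -
    have "sum h A = h p + sum h (A - {p})" "sum h (A - {p}) = h q + sum h (A - {p} - {q})"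
      by (rule sum.remove; use assms(1-4) in blast)+
    then show ?thesis
      by (simp only: add.assoc)
  qed
  have "sum f (A - {p} - {q}) = sum g (A - {p} - {q})"
    by (rule sum.cong[OF refl]) (use assms(5) in blast)
  then show ?thesis
    by (simp only: split[of f] split[of g] assms(6))
qed

context fin_dim_space
begin

text \<open>The set \<open>F\<close> absorbs the base point \<open>t = 0\<close>, which lies in the
  smaller orbit, and parameters such as -1 at which a correction factor fails to be a unit.\<close>

definition degenerates_to :: "(nat \<Rightarrow> nat) \<Rightarrow> (nat \<Rightarrow> nat) \<Rightarrow> 'b \<Rightarrow> ('b \<Rightarrow> 'b) \<Rightarrow> bool" where
  "degenerates_to \<mu> \<nu> v x \<longleftrightarrow> (\<exists>v' E F. lin E \<and> finite F \<and> (\<forall>t. t \<notin> F \<longrightarrow>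
     (v + scale t v', \<lambda>u. x u + scale t (E u)) \<in> enhanced_orbit scale (\<mu>, \<nu>)))"

lemma funpow_plus: "(x ^^ (j + k)) u = (x ^^ j) ((x ^^ k) u)"
  by (simp add: funpow_add)

lemma funpow_pred: "0 < k \<Longrightarrow> (x ^^ k) u = x ((x ^^ (k - 1)) u)"
  by (cases k) simp_all

lemma funpow_eq_0_mono:
  assumes "lin x" "(x ^^ j) u = 0" "j \<le> k"
  shows "(x ^^ k) u = 0"
proof -
  have "(x ^^ k) u = (x ^^ (k - j)) ((x ^^ j) u)"
    using assms(3) by (simp flip: funpow_plus)
  then show ?thesis
    by (simp add: assms(2) lin_0[OF lin_funpow[OF assms(1)]])
qed

text \<open>
  The polynomial \<open>c + e x^d\<close> in the nilpotent \<open>x\<close> is a unit, so it can be cancelled modulo an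
  \<open>x\<close>-stable subspace.
\<close>

lemma unit_cancel:
  assumes lin: "lin x" and G: "subspace G" "\<And>u. u \<in> G \<Longrightarrow> x u \<in> G"
    and nil: "(x ^^ N) z = 0" and c: "c \<noteq> 0" "d = 0 \<Longrightarrow> c + e \<noteq> 0"
    and mem: "scale c z + scale e ((x ^^ d) z) \<in> G"
  shows "z \<in> G"
proof (cases "d = 0")
  case True
  then have "scale (c + e) z \<in> G"
    using mem by (simp add: scale_left_distrib)
  then have "scale (inverse (c + e)) (scale (c + e) z) \<in> G"
    by (rule subspace_scale[OF G(1)])
  then show ?thesis using c(2)[OF True] by simp
next
  case False
  have pow: "(x ^^ k) u \<in> G" if "u \<in> G" for k u
    using that by (induction k) (simp_all add: G(2))
  have "(x ^^ k) z \<in> G" for k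
  proof (induction "N - k" arbitrary: k rule: less_induct)
    case less
    show ?case
    proof (cases "k < N")
      case True
      have "(x ^^ (k + d)) z \<in> G"
        using True False by (intro less) auto
      moreover have "scale c ((x ^^ k) z) + scale e ((x ^^ (k + d)) z) \<in> G"
        using pow[OF mem, of k] by (simp only: funpow_plus lin_simps[OF lin_funpow[OF lin]])
      ultimately have "scale c ((x ^^ k) z) + scale e ((x ^^ (k + d)) z) - scale e ((x ^^ (k + d)) z) \<in> G"
        by (intro subspace_diff[OF G(1)] subspace_scale[OF G(1)])
      then have "scale c ((x ^^ k) z) \<in> G"
        by simp
      then have "scale (inverse c) (scale c ((x ^^ k) z)) \<in> G"
        by (rule subspace_scale[OF G(1)])
      then show ?thesis using c(1) by simp
    next
      case False
      then have "(x ^^ k) z = 0"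
        by (intro funpow_eq_0_mono[OF lin nil]) simp
      then show ?thesis by (simp add: subspace_0[OF G(1)])
    qed
  qed
  from this[of 0] show ?thesis by simp
qed

text \<open>The span of the truncated rows is stable under \<open>x\<close> as soon as it contains
  the first omitted vector of each row; it then contains the rows entirely.\<close>

lemma rows_in_span:
  assumes lin: "lin x"
    and last: "\<And>i. i \<in> A \<Longrightarrow>
      (x ^^ \<beta> i) (U i) \<in> span ((\<lambda>(i, k). (x ^^ k) (U i)) ` Sigma A (\<lambda>i. {..<\<beta> i}))"
      (is "\<And>i. _ \<Longrightarrow> _ \<in> ?S")
    and i: "i \<in> A"
  shows "(x ^^ k) (U i) \<in> span ((\<lambda>(i, k). (x ^^ k) (U i)) ` Sigma A (\<lambda>i. {..<\<beta> i}))"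
proof -
  have base: "(x ^^ k) (U i) \<in> ?S" if "i \<in> A" "k < \<beta> i" for i k
    by (rule span_base, rule image_eqI[of _ _ "(i, k)"]) (use that in auto)
  have "?S \<subseteq> {u. x u \<in> ?S}"
  proof (intro span_minimal subspace_lin_vimage[OF lin] subspace_span, clarsimp)
    fix i k assume "i \<in> A" "k < \<beta> i"
    then have "(x ^^ Suc k) (U i) \<in> ?S"
      using base[of i "Suc k"] last[of i] by (cases "Suc k = \<beta> i") (simp_all del: funpow.simps)
    then show "x ((x ^^ k) (U i)) \<in> ?S"
      by simp
  qed
  then have step: "x u \<in> ?S" if "u \<in> ?S" for u
    using that by blast
  have "U i \<in> ?S"
    using base[of i 0] last[of i] i by (cases "\<beta> i = 0") auto
  then show ?thesis
    by (induction k) (simp_all add: step)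
qed

lemma rows_span_UNIV:
  fixes n :: nat
  assumes lin: "lin x" and zero: "\<And>i. (x ^^ len i) (Z i) = 0"
    and gen: "generated x (range Z) = UNIV" and vanish: "\<And>i. n \<le> i \<Longrightarrow> len i = 0"
  shows "span ((\<lambda>(i, k). (x ^^ k) (Z i)) ` Sigma {..<n} (\<lambda>i. {..<len i})) = UNIV" (is "?S = _")
proof -
  have "(x ^^ k) (Z i) \<in> ?S" for i k
  proof (cases "i < n")
    case True
    show ?thesis
      by (rule rows_in_span[OF lin, of "{..<n}" len Z i k]) (simp_all add: True zero span_zero)
  next
    case False
    then have "len i = 0"
      by (intro vanish) simp
    then have "(x ^^ k) (Z i) = 0"
      by (intro funpow_eq_0_mono[OF lin zero]) simp
    then show ?thesis by (simp add: span_zero)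
  qed
  then have "generated x (range Z) \<subseteq> ?S"
    unfolding generated_def by (intro span_minimal subspace_span) auto
  then show ?thesis using gen by blast
qed

text \<open>The operator stays fixed; \<open>v\<close> moves in the direction of the vector that
  meets row i at position \<open>\<mu> i\<close> instead of \<open>\<mu>' i\<close>. The new
  generator of row i is \<open>t + x^(\<nu>' i - \<nu> i)\<close> applied to \<open>Z i\<close>, and
  this factor is a unit whenever t is neither 0 nor -1.\<close>

lemma degenerates_decrease_mu:
  assumes bip: "padded_bipartition (card Basis) \<mu> \<nu>" "padded_bipartition (card Basis) \<mu>' \<nu>'"
    and eq: "\<And>i. \<mu> i + \<nu> i = \<mu>' i + \<nu>' i" and le: "\<And>i. \<mu>' i \<le> \<mu> i"
    and orb: "(v, x) \<in> enhanced_orbit scale (\<mu>', \<nu>')"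
  shows "degenerates_to \<mu> \<nu> v x"
proof -
  let ?n = "card Basis"
  obtain Z where lin: "lin x" and zero: "\<And>i. (x ^^ (\<mu>' i + \<nu>' i)) (Z i) = 0"
    and gen: "generated x (range Z) = UNIV" and v: "v = (\<Sum>i<?n. (x ^^ \<nu>' i) (Z i))"
    by (rule enhanced_orbitE[OF bip(2) orb]) (rule that)
  note pw = lin_simps[OF lin_funpow[OF lin]]
  define v' where "v' = (\<Sum>i<?n. (x ^^ \<nu> i) (Z i))"
  have "(v + scale t v', x) \<in> enhanced_orbit scale (\<mu>, \<nu>)" if t: "t \<noteq> 0" "t \<noteq> -1" for t
  proof -
    define Z' where "Z' i = scale t (Z i) + scale 1 ((x ^^ (\<nu>' i - \<nu> i)) (Z i))" for i
    have "range Z \<subseteq> generated x (range Z')"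
    proof clarify
      fix i
      have "Z' i \<in> generated x (range Z')"
        by (intro generated_base) simp
      moreover have "t + 1 \<noteq> 0"
        using t(2) by (simp add: eq_neg_iff_add_eq_0)
      ultimately show "Z i \<in> generated x (range Z')"
        unfolding Z'_def
        by (intro unit_cancel[OF lin subspace_generated generated_step[OF lin] zero t(1)]) auto
    qed
    then have "generated x (range Z') = UNIV"
      by (rule generated_trans[OF lin gen])
    moreover have "(x ^^ (\<mu> i + \<nu> i)) (Z' i) = 0" for i
    proof -
      have "(x ^^ (\<mu> i + \<nu> i)) ((x ^^ (\<nu>' i - \<nu> i)) (Z i)) = 0"
        unfolding funpow_plus[symmetric] by (rule funpow_eq_0_mono[OF lin zero]) (simp add: eq)
      then show ?thesis
        unfolding Z'_def pw using zero[of i] by (simp add: eq)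
    qed
    moreover have "v + scale t v' = (\<Sum>i<?n. (x ^^ \<nu> i) (Z' i))"
    proof -
      have "\<nu> i + (\<nu>' i - \<nu> i) = \<nu>' i" for i
        using eq[of i] le[of i] by simp
      then have "(x ^^ \<nu> i) (Z' i) = scale t ((x ^^ \<nu> i) (Z i)) + (x ^^ \<nu>' i) (Z i)" for i
        unfolding Z'_def pw by (simp flip: funpow_plus)
      then show ?thesis
        by (simp add: v v'_def sum.distrib scale_sum_right add.commute)
    qed
    ultimately show ?thesis
      by (intro enhanced_orbitI[OF bip(1) lin]) auto
  qed
  then show ?thesis
    unfolding degenerates_to_def
    by (intro exI[of _ v'] exI[of _ "\<lambda>_. 0"] exI[of _ "{0, -1}"] conjI)
      (simp_all add: Vector_Spaces.linear_iff vector_space_axioms)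
qed

text \<open>
  The first vector of row \<open>p\<close>, which \<open>x\<close> kills, is sent to \<open>t\<close> times the first vector of row \<open>q\<close>:
  row \<open>p\<close> then swallows one box of row \<open>q\<close>.
\<close>

lemma degenerates_move_mu:
  assumes bip: "padded_bipartition (card Basis) \<mu> \<nu>" "padded_bipartition (card Basis) \<mu>' \<nu>"
    and move: "p < q" "\<mu> p = Suc (\<mu>' p)" "\<mu>' q = Suc (\<mu> q)" "\<And>i. i \<noteq> p \<Longrightarrow> i \<noteq> q \<Longrightarrow> \<mu>' i = \<mu> i"
    and orb: "(v, x) \<in> enhanced_orbit scale (\<mu>', \<nu>)"
  shows "degenerates_to \<mu> \<nu> v x"
proof -
  let ?n = "card Basis"
  define a where "a = \<mu>' p + \<nu> p"
  define b where "b = \<mu>' q + \<nu> q"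
  obtain Z where lin: "lin x" and zero: "\<And>i. (x ^^ (\<mu>' i + \<nu> i)) (Z i) = 0"
    and gen: "generated x (range Z) = UNIV" and v: "v = (\<Sum>i<?n. (x ^^ \<nu> i) (Z i))"
    by (rule enhanced_orbitE[OF bip(2) orb]) (rule that)
  have anti: "antimono \<mu>'" "antimono \<nu>"
    and pad: "\<And>i. ?n \<le> i \<Longrightarrow> \<mu>' i = 0 \<and> \<nu> i = 0"
    and size: "(\<Sum>i<?n. \<mu>' i + \<nu> i) = ?n"
    using bip(2) unfolding padded_bipartition_def by blast+
  have mono: "\<mu>' q \<le> \<mu>' p" "\<nu> q \<le> \<nu> p"
    using antimonoD[OF anti(1), of p q] antimonoD[OF anti(2), of p q] move(1) by auto
  have q: "q < ?n"
    using pad[of q] move(3) by (cases "q < ?n") simp_all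
  then have p: "p < ?n"
    using move(1) by simp
  have len: "\<mu>' i + \<nu> i = 0" if "?n \<le> i" for i
    using pad[OF that] by simp
  define I where "I = Sigma {..<?n} (\<lambda>i. {..<\<mu>' i + \<nu> i})"
  let ?f = "\<lambda>(i, k). (x ^^ k) (Z i)"
  have span: "span (?f ` I) = UNIV"
    unfolding I_def by (rule rows_span_UNIV[OF lin zero gen len])
  have I: "finite I" "card I = card Basis"
    using size by (simp_all add: I_def)
  obtain E where linE: "lin E"
    and E: "\<And>ik. ik \<in> I \<Longrightarrow> E (?f ik) = (if ik = (p, a - 1) then (x ^^ (b - 1)) (Z q) else 0)"
    using linear_extension[OF I span, of "\<lambda>ik. if ik = (p, a - 1) then (x ^^ (b - 1)) (Z q) else 0"]
    by blast
  have ab: "1 \<le> b" "b \<le> a" "\<nu> p < a"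
    using mono move(3) by (simp_all add: a_def b_def)
  have E0: "E ((x ^^ k) (Z i)) = 0" if "\<not> (i = p \<and> k = a - 1)" for i k
  proof (cases "(i, k) \<in> I")
    case True
    then show ?thesis using E[OF True] that by auto
  next
    case False
    then have "(x ^^ k) (Z i) = 0"
      using len[of i] by (intro funpow_eq_0_mono[OF lin zero]) (auto simp: I_def not_less)
    then show ?thesis by (simp add: lin_0[OF linE])
  qed
  have E1: "E ((x ^^ (a - 1)) (Z p)) = (x ^^ (b - 1)) (Z q)"
    using E[of "(p, a - 1)"] p ab by (simp add: I_def a_def)
  have "(v, \<lambda>u. x u + scale t (E u)) \<in> enhanced_orbit scale (\<mu>, \<nu>)" if t: "t \<noteq> 0" for t
  proof -
    define y where "y = (\<lambda>u. x u + scale t (E u))"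
    have liny: "lin y"
      unfolding y_def by (intro lin_plus lin_smult lin linE)
    note pw = lin_simps[OF lin_funpow[OF liny]]
    have y_other: "(y ^^ k) (Z i) = (x ^^ k) (Z i)" if "i \<noteq> p" for i k
    proof (induction k)
      case (Suc k)
      then show ?case using that by (simp add: y_def E0)
    qed simp
    have y_p: "(y ^^ k) (Z p) = (x ^^ k) (Z p)" if "k < a" for k
      using that
    proof (induction k)
      case (Suc k)
      then show ?case by (simp add: y_def E0)
    qed simp
    have y_a: "(y ^^ a) (Z p) = scale t ((x ^^ (b - 1)) (Z q))"
    proof -
      have "(y ^^ a) (Z p) = y ((y ^^ (a - 1)) (Z p))"
        using ab by (intro funpow_pred) simp
      also have "\<dots> = x ((x ^^ (a - 1)) (Z p)) + scale t ((x ^^ (b - 1)) (Z q))"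
        using y_p[of "a - 1"] ab E1 by (simp add: y_def)
      also have "x ((x ^^ (a - 1)) (Z p)) = (x ^^ a) (Z p)"
        using ab by (intro funpow_pred[symmetric]) simp
      finally show ?thesis
        using zero[of p] by (simp add: a_def)
    qed
    have y_a1: "(y ^^ Suc a) (Z p) = 0"
    proof -
      have "(y ^^ Suc a) (Z p) = scale t (y ((y ^^ (b - 1)) (Z q)))"
        using move(1) by (simp add: y_a lin_simps[OF liny] y_other)
      also have "y ((y ^^ (b - 1)) (Z q)) = (y ^^ b) (Z q)"
        using ab by (intro funpow_pred[symmetric]) simp
      also have "\<dots> = 0"
        using zero[of q] move(1) by (simp add: y_other b_def)
      finally show ?thesis by simp
    qed
    \<comment> \<open>Subtracting \<open>inverse t\<close> times
      \<open>(y ^^ (Suc a - b)) (Z p)\<close> from \<open>Z q\<close> makes row q end one step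
      earlier, because \<open>y_a\<close> identifies the two ends. This disturbs \<open>v\<close> by
      a multiple of \<open>(y ^^ (\<nu> p + d)) (Z p)\<close>, which the factor
      \<open>1 + inverse t y^d\<close> on \<open>Z p\<close> restores. Since
      \<open>\<mu>' q \<le> \<mu>' p\<close>, d is positive and this factor can be
      cancelled.\<close>
    define d where "d = \<mu> p - Suc (\<mu> q)"
    have d: "d \<noteq> 0" "\<nu> p + d = \<nu> q + (Suc a - b)"
      using mono move ab by (simp_all add: d_def a_def b_def)
    define Z' where "Z' = Z(p := scale 1 (Z p) + scale (inverse t) ((y ^^ d) (Z p)),
      q := Z q - scale (inverse t) ((y ^^ (Suc a - b)) (Z p)))"
    define G where "G = generated y (range Z')"
    have G: "subspace G" "\<And>u k. u \<in> G \<Longrightarrow> (y ^^ k) u \<in> G" "\<And>i. Z' i \<in> G"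
      by (simp_all add: G_def subspace_generated generated_funpow[OF liny] generated_base)
    have Zp: "Z p \<in> G"
    proof (rule unit_cancel[OF liny G(1) _ y_a1])
      show "scale 1 (Z p) + scale (inverse t) ((y ^^ d) (Z p)) \<in> G"
        using G(3)[of p] move(1) by (simp add: Z'_def)
    qed (use G(2)[of _ 1] d(1) in auto)
    have Zi: "Z i \<in> G" for i
    proof -
      consider "i = p" | "i = q" | "i \<noteq> p" "i \<noteq> q" by blast
      then show ?thesis
      proof cases
        case 2
        have "Z' q + scale (inverse t) ((y ^^ (Suc a - b)) (Z p)) \<in> G"
          by (intro subspace_add[OF G(1)] subspace_scale[OF G(1)] G Zp)
        then show ?thesis using 2 by (simp add: Z'_def)
      next
        case 3
        then show ?thesis using G(3)[of i] by (simp add: Z'_def)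
      qed (use Zp in simp)
    qed
    have "?f ` I \<subseteq> G"
    proof clarify
      fix i k assume "(i, k) \<in> I"
      then have "(x ^^ k) (Z i) = (y ^^ k) (Z i)"
        using y_other[of i k] y_p[of k] by (cases "i = p") (auto simp: I_def a_def)
      then show "(x ^^ k) (Z i) \<in> G" by (simp add: G Zi)
    qed
    then have "span (?f ` I) \<subseteq> G"
      by (rule span_minimal[OF _ G(1)])
    then have gen': "generated y (range Z') = UNIV"
      using span by (auto simp: G_def)
    have zero': "(y ^^ (\<mu> i + \<nu> i)) (Z' i) = 0" for i
    proof -
      consider "i = p" | "i = q" | "i \<noteq> p" "i \<noteq> q" by blast
      then show ?thesis
      proof cases
        case 1
        have *: "\<mu> p + \<nu> p = Suc a"
          by (simp add: a_def move(2))
        have "(y ^^ Suc a) ((y ^^ d) (Z p)) = 0"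
          unfolding funpow_plus[symmetric] by (rule funpow_eq_0_mono[OF liny y_a1]) simp
        then have "(y ^^ (\<mu> p + \<nu> p)) (scale 1 (Z p) + scale (inverse t) ((y ^^ d) (Z p))) = 0"
          unfolding * pw y_a1 by simp
        then show ?thesis
          using 1 move(1) by (simp add: Z'_def)
      next
        case 2
        have *: "\<mu> q + \<nu> q = b - 1"
          by (simp add: b_def move(3))
        have "(y ^^ (b - 1)) ((y ^^ (Suc a - b)) (Z p)) = (y ^^ a) (Z p)"
          using ab by (simp flip: funpow_plus)
        moreover have "(y ^^ (b - 1)) (Z q) = (x ^^ (b - 1)) (Z q)"
          using move(1) by (simp add: y_other)
        ultimately have "(y ^^ (\<mu> q + \<nu> q)) (Z q - scale (inverse t) ((y ^^ (Suc a - b)) (Z p))) = 0"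
          unfolding * pw using t by (simp add: y_a)
        then show ?thesis
          using 2 by (simp add: Z'_def)
      next
        case 3
        then show ?thesis
          using zero[of i] move(4)[of i] by (simp add: Z'_def y_other)
      qed
    qed
    have "v = (\<Sum>i<?n. (y ^^ \<nu> i) (Z' i))"
      unfolding v
    proof (rule sum_cong_except_two[of _ p q])
      have "(y ^^ \<nu> p) (scale 1 (Z p) + scale (inverse t) ((y ^^ d) (Z p)))
          = (x ^^ \<nu> p) (Z p) + scale (inverse t) ((y ^^ (\<nu> p + d)) (Z p))"
        unfolding pw by (simp add: y_p[OF ab(3)] flip: funpow_plus)
      moreover have "(y ^^ \<nu> q) (Z q - scale (inverse t) ((y ^^ (Suc a - b)) (Z p)))
          = (x ^^ \<nu> q) (Z q) - scale (inverse t) ((y ^^ (\<nu> p + d)) (Z p))"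
        unfolding pw d(2) using move(1) by (simp add: y_other flip: funpow_plus)
      ultimately show "(x ^^ \<nu> p) (Z p) + (x ^^ \<nu> q) (Z q) = (y ^^ \<nu> p) (Z' p) + (y ^^ \<nu> q) (Z' q)"
        using move(1) by (simp add: Z'_def)
    qed (use p q move(1) in \<open>simp_all add: Z'_def y_other\<close>)
    then show ?thesis
      unfolding y_def[symmetric] by (intro enhanced_orbitI[OF bip(1) liny zero' gen'])
  qed
  then show ?thesis
    unfolding degenerates_to_def
    by (intro exI[of _ "0 :: 'b"] exI[of _ E] exI[of _ "{0}"] conjI linE) simp_all
qed

text \<open>
  Here \<open>t\<close> times the last vector of row \<open>p\<close> is added to the image of the last vector of row \<open>q\<close>,
  and the latter becomes the last vector of the longer row.
\<close>

lemma degenerates_move_nu: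
  assumes bip: "padded_bipartition (card Basis) \<mu> \<nu>" "padded_bipartition (card Basis) \<mu> \<nu>'"
    and move: "p < q" "\<nu> p = Suc (\<nu>' p)" "\<nu>' q = Suc (\<nu> q)" "\<And>i. i \<noteq> p \<Longrightarrow> i \<noteq> q \<Longrightarrow> \<nu>' i = \<nu> i"
    and orb: "(v, x) \<in> enhanced_orbit scale (\<mu>, \<nu>')"
  shows "degenerates_to \<mu> \<nu> v x"
proof -
  let ?n = "card Basis"
  define a where "a = \<mu> p + \<nu>' p"
  define b where "b = \<mu> q + \<nu>' q"
  obtain Z where lin: "lin x" and zero: "\<And>i. (x ^^ (\<mu> i + \<nu>' i)) (Z i) = 0"
    and gen: "generated x (range Z) = UNIV" and v: "v = (\<Sum>i<?n. (x ^^ \<nu>' i) (Z i))"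
    by (rule enhanced_orbitE[OF bip(2) orb]) (rule that)
  have anti: "antimono \<mu>" "antimono \<nu>'"
    and pad: "\<And>i. ?n \<le> i \<Longrightarrow> \<mu> i = 0 \<and> \<nu>' i = 0"
    and size: "(\<Sum>i<?n. \<mu> i + \<nu>' i) = ?n"
    using bip(2) unfolding padded_bipartition_def by blast+
  have mono: "\<mu> q \<le> \<mu> p" "\<nu>' q \<le> \<nu>' p"
    using antimonoD[OF anti(1), of p q] antimonoD[OF anti(2), of p q] move(1) by auto
  have q: "q < ?n"
    using pad[of q] move(3) by (cases "q < ?n") simp_all
  then have p: "p < ?n"
    using move(1) by simp
  have len: "\<mu> i + \<nu>' i = 0" if "?n \<le> i" for i
    using pad[OF that] by simp
  define I where "I = Sigma {..<?n} (\<lambda>i. {..<\<mu> i + \<nu>' i})"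
  let ?f = "\<lambda>(i, k). (x ^^ k) (Z i)"
  have span: "span (?f ` I) = UNIV"
    unfolding I_def by (rule rows_span_UNIV[OF lin zero gen len])
  have I: "finite I" "card I = card Basis"
    using size by (simp_all add: I_def)
  obtain E where linE: "lin E"
    and E: "\<And>ik. ik \<in> I \<Longrightarrow> E (?f ik) = (if ik = (q, 0) then Z p else 0)"
    using linear_extension[OF I span, of "\<lambda>ik. if ik = (q, 0) then Z p else 0"]
    by blast
  have ab: "1 \<le> b" "b \<le> a"
    using mono move(3) by (simp_all add: a_def b_def)
  have E0: "E ((x ^^ k) (Z i)) = 0" if "\<not> (i = q \<and> k = 0)" for i k
  proof (cases "(i, k) \<in> I")
    case True
    then show ?thesis using E[OF True] that by auto
  next
    case False
    then have "(x ^^ k) (Z i) = 0"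
      using len[of i] by (intro funpow_eq_0_mono[OF lin zero]) (auto simp: I_def not_less)
    then show ?thesis by (simp add: lin_0[OF linE])
  qed
  have E1: "E (Z q) = Z p"
    using E[of "(q, 0)"] q by (simp add: I_def move(3))
  have "(v, \<lambda>u. x u + scale t (E u)) \<in> enhanced_orbit scale (\<mu>, \<nu>)" if t: "t \<noteq> 0" for t
  proof -
    define y where "y = (\<lambda>u. x u + scale t (E u))"
    have liny: "lin y"
      unfolding y_def by (intro lin_plus lin_smult lin linE)
    note pw = lin_simps[OF lin_funpow[OF liny]]
    have y_other: "(y ^^ k) (Z i) = (x ^^ k) (Z i)" if "i \<noteq> q" for i k
    proof (induction k)
      case (Suc k)
      then show ?case using that by (simp add: y_def E0)
    qed simp
    have y_x: "(y ^^ k) (x (Z q)) = (x ^^ Suc k) (Z q)" for k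
    proof (induction k)
      case (Suc k)
      then show ?case using E0[of q "Suc k"] by (simp add: y_def)
    qed simp
    have y_q: "(y ^^ Suc k) (Z q) = (x ^^ Suc k) (Z q) + scale t ((x ^^ k) (Z p))" for k
    proof -
      have "(y ^^ Suc k) (Z q) = (y ^^ k) (y (Z q))"
        by (simp add: funpow_swap1)
      also have "\<dots> = (y ^^ k) (x (Z q) + scale t (Z p))"
        by (simp add: y_def[THEN fun_cong, of "Z q"] E1)
      also have "\<dots> = (y ^^ k) (x (Z q)) + scale t ((y ^^ k) (Z p))"
        by (simp only: pw)
      finally show ?thesis
        using move(1) by (simp only: y_x) (simp add: y_other)
    qed
    \<comment> \<open>\<open>Z q\<close> now heads the longer row p. Scaling it by
      \<open>inverse t\<close> gives \<open>Z p\<close> the coefficient 1 after one application of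
      \<open>y\<close>, but leaves an excess \<open>inverse t\<close> times
      \<open>(x ^^ \<nu> p) (Z q)\<close> in \<open>v\<close>. The exponent d lets the second term
      of the new generator of row q cancel this excess; it is positive because
      \<open>\<nu>' q \<le> \<nu>' p\<close>.\<close>
    define d where "d = \<nu>' p - \<nu> q"
    have d: "d \<noteq> 0" "\<nu> q + d = \<nu>' p"
      using mono move by (simp_all add: d_def)
    have y_b: "(y ^^ (b - 1)) (x (Z q)) = 0"
    proof -
      have "Suc (b - 1) = \<mu> q + \<nu>' q"
        using ab by (simp add: b_def)
      then show ?thesis
        by (simp only: y_x zero)
    qed
    define Z' where "Z' = Z(p := scale (inverse t) (Z q),
      q := scale 1 (x (Z q)) + scale (- inverse t) ((y ^^ d) (x (Z q))))"
    define G where "G = generated y (range Z')"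
    have G: "subspace G" "\<And>u k. u \<in> G \<Longrightarrow> (y ^^ k) u \<in> G" "\<And>i. Z' i \<in> G"
      by (simp_all add: G_def subspace_generated generated_funpow[OF liny] generated_base)
    have Zq: "Z q \<in> G"
      using subspace_scale[OF G(1) G(3)[of p], of t] t move(1) by (simp add: Z'_def)
    have xZq: "x (Z q) \<in> G"
    proof (rule unit_cancel[OF liny G(1) _ y_b])
      show "scale 1 (x (Z q)) + scale (- inverse t) ((y ^^ d) (x (Z q))) \<in> G"
        using G(3)[of q] by (simp add: Z'_def)
    qed (use G(2)[of _ 1] d(1) in auto)
    have "scale (inverse t) (y (Z q) - x (Z q)) \<in> G"
      using subspace_scale[OF G(1) subspace_diff[OF G(1) G(2)[OF Zq, of 1] xZq]] by simp
    then have Zp: "Z p \<in> G"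
      using t by (simp add: y_def E1)
    have Zi: "Z i \<in> G" for i
      using Zp Zq G(3)[of i] by (cases "i = p \<or> i = q") (auto simp: Z'_def)
    have "?f ` I \<subseteq> G"
    proof clarify
      fix i k assume "(i, k) \<in> I"
      show "(x ^^ k) (Z i) \<in> G"
      proof (cases "i = q")
        case True
        then show ?thesis
          using Zq G(2)[OF xZq, of "k - 1"] unfolding y_x by (cases k) auto
      next
        case False
        then show ?thesis using G(2)[OF Zi[of i], of k] by (simp add: y_other)
      qed
    qed
    then have "span (?f ` I) \<subseteq> G"
      by (rule span_minimal[OF _ G(1)])
    then have gen': "generated y (range Z') = UNIV"
      using span by (auto simp: G_def)
    have zero': "(y ^^ (\<mu> i + \<nu> i)) (Z' i) = 0" for i
    proof -
      consider "i = p" | "i = q" | "i \<noteq> p" "i \<noteq> q" by blast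
      then show ?thesis
      proof cases
        case 1
        have *: "\<mu> p + \<nu> p = Suc a"
          by (simp add: a_def move(2))
        have "(x ^^ Suc a) (Z q) = 0" "(x ^^ a) (Z p) = 0"
          using funpow_eq_0_mono[OF lin zero[of q], of "Suc a"] zero[of p] ab
          by (simp_all add: a_def b_def del: funpow.simps)
        then have "(y ^^ (\<mu> p + \<nu> p)) (scale (inverse t) (Z q)) = 0"
          unfolding * pw y_q by simp
        then show ?thesis
          using 1 move(1) by (simp add: Z'_def)
      next
        case 2
        have *: "\<mu> q + \<nu> q = b - 1"
          by (simp add: b_def move(3))
        have "(y ^^ (b - 1)) ((y ^^ d) (x (Z q))) = 0"
          unfolding funpow_plus[symmetric] by (rule funpow_eq_0_mono[OF liny y_b]) simp
        then have "(y ^^ (\<mu> q + \<nu> q)) (scale 1 (x (Z q)) + scale (- inverse t) ((y ^^ d) (x (Z q)))) = 0"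
          unfolding * pw y_b by simp
        then show ?thesis
          using 2 by (simp add: Z'_def)
      next
        case 3
        then show ?thesis
          using zero[of i] move(4)[of i] by (simp add: Z'_def y_other)
      qed
    qed
    have yp: "(y ^^ \<nu> p) (Z' p) = scale (inverse t) ((x ^^ \<nu> p) (Z q)) + (x ^^ \<nu>' p) (Z p)"
    proof -
      have "Z' p = scale (inverse t) (Z q)"
        using move(1) by (simp add: Z'_def)
      then show ?thesis
        by (simp only: pw move(2) y_q scale_right_distrib scale_scale left_inverse[OF t] scale_one)
    qed
    have yq: "(y ^^ \<nu> q) (Z' q) = (x ^^ \<nu>' q) (Z q) - scale (inverse t) ((x ^^ \<nu> p) (Z q))"
    proof -
      have "Z' q = x (Z q) - scale (inverse t) ((y ^^ d) (x (Z q)))"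
        by (simp add: Z'_def)
      moreover have "(y ^^ \<nu> q) ((y ^^ d) (x (Z q))) = (x ^^ \<nu> p) (Z q)"
        unfolding funpow_plus[symmetric] d(2) move(2) by (rule y_x)
      ultimately show ?thesis
        by (simp only: pw y_x[of "\<nu> q"] move(3))
    qed
    have "v = (\<Sum>i<?n. (y ^^ \<nu> i) (Z' i))"
      unfolding v
    proof (rule sum_cong_except_two[of _ p q])
      show "(x ^^ \<nu>' p) (Z p) + (x ^^ \<nu>' q) (Z q) = (y ^^ \<nu> p) (Z' p) + (y ^^ \<nu> q) (Z' q)"
        unfolding yp yq by simp
      show "(x ^^ \<nu>' i) (Z i) = (y ^^ \<nu> i) (Z' i)" if "i \<noteq> p" "i \<noteq> q" for i
        using that move(4)[of i] by (simp add: Z'_def y_other)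
    qed (use p q move(1) in simp_all)
    then show ?thesis
      unfolding y_def[symmetric] by (intro enhanced_orbitI[OF bip(1) liny zero' gen'])
  qed
  then show ?thesis
    unfolding degenerates_to_def
    by (intro exI[of _ "0 :: 'b"] exI[of _ E] exI[of _ "{0}"] conjI linE) simp_all
qed

text \<open>
  The quotient of \<open>V\<close> by the cyclic submodule of \<open>v\<close> has Jordan type \<open>\<nu> i + \<mu> (i + 1)\<close>, and so
  does not change. The module \<open>V\<close> is generated by \<open>v\<close> and lifts \<open>Y i\<close> with the relations
  \<open>x^(\<nu> i + \<mu> (i + 1)) Y i = x^(\<mu> (i + 1)) v\<close>; the line deforms the right-hand sides of these
  relations, that is, the extension class.
\<close>

lemma degenerates_increase_mu:
  assumes bip: "padded_bipartition (card Basis) \<mu> \<nu>" "padded_bipartition (card Basis) \<mu>' \<nu>'"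
    and mu0: "\<mu>' 0 = \<mu> 0" and eq: "\<And>i. \<nu>' i + \<mu>' (Suc i) = \<nu> i + \<mu> (Suc i)"
    and le: "\<And>i. \<mu> i \<le> \<mu>' i"
    and orb: "(v, x) \<in> enhanced_orbit scale (\<mu>', \<nu>')"
  shows "degenerates_to \<mu> \<nu> v x"
proof -
  define n where "n = card Basis"
  define \<alpha> where "\<alpha> i = \<nu> i + \<mu> (Suc i)" for i
  have \<alpha>': "\<alpha> i = \<mu>' (Suc i) + \<nu>' i" for i
    using eq[of i] by (simp add: \<alpha>_def)
  obtain Z where lin: "lin x" and zero: "\<And>i. (x ^^ (\<mu>' i + \<nu>' i)) (Z i) = 0"
    and gen: "generated x (range Z) = UNIV" and v: "v = (\<Sum>i<n. (x ^^ \<nu>' i) (Z i))"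
    by (rule enhanced_orbitE[OF bip(2) orb, folded n_def]) (rule that)
  have anti': "antimono \<mu>'" "antimono \<nu>'"
    and pad': "\<And>i. n \<le> i \<Longrightarrow> \<mu>' i = 0 \<and> \<nu>' i = 0"
    using bip(2) unfolding padded_bipartition_def n_def by blast+
  have anti: "antimono \<mu>" "antimono \<nu>"
    and pad: "\<And>i. n \<le> i \<Longrightarrow> \<mu> i = 0 \<and> \<nu> i = 0"
    and size: "(\<Sum>i<n. \<mu> i + \<nu> i) = n"
    using bip(1) unfolding padded_bipartition_def n_def by blast+
  note px = lin_simps[OF lin_funpow[OF lin]]

  \<comment> \<open>The lift is chosen so that \<open>(x ^^ \<nu>' i) (Y i)\<close> is the partial
    sum of \<open>v\<close> over the rows up to i. The later rows of \<open>v\<close> are killed by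
    \<open>x ^^ \<mu>' (Suc i)\<close>, which yields the relation \<open>Y_rel\<close>.\<close>
  define Y where "Y i = (\<Sum>k\<le>i. (x ^^ (\<nu>' k - \<nu>' i)) (Z k))" for i
  have Y_nu: "(x ^^ \<nu>' i) (Y i) = (\<Sum>k\<le>i. (x ^^ \<nu>' k) (Z k))" for i
  proof -
    have "(x ^^ \<nu>' i) ((x ^^ (\<nu>' k - \<nu>' i)) (Z k)) = (x ^^ \<nu>' k) (Z k)" if "k \<le> i" for k
      using antimonoD[OF anti'(2) that] by (simp flip: funpow_plus)
    then show ?thesis
      by (simp add: Y_def px)
  qed
  have kill: "(x ^^ m) ((x ^^ \<nu>' k) (Z k)) = 0" if "\<mu>' k \<le> m" for k m
    unfolding funpow_plus[symmetric] by (rule funpow_eq_0_mono[OF lin zero]) (use that in simp)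
  have Y_rel: "(x ^^ \<alpha> i) (Y i) = (x ^^ \<mu>' (Suc i)) v" if "i < n" for i
  proof -
    have split: "{..<n} = {..i} \<union> {i<..<n}" "{..i} \<inter> {i<..<n} = {}"
      using that by auto
    have "v = (\<Sum>k\<le>i. (x ^^ \<nu>' k) (Z k)) + (\<Sum>k\<in>{i<..<n}. (x ^^ \<nu>' k) (Z k))"
      unfolding v split(1) by (rule sum.union_disjoint[OF finite_atMost finite_greaterThanLessThan split(2)])
    moreover have "(x ^^ \<mu>' (Suc i)) (\<Sum>k\<in>{i<..<n}. (x ^^ \<nu>' k) (Z k)) = 0"
      unfolding px by (rule sum.neutral) (auto intro!: kill antimonoD[OF anti'(1)])
    ultimately show ?thesis
      unfolding \<alpha>' funpow_plus Y_nu by (simp only: px add_0_right)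
  qed
  have v0: "(x ^^ \<mu> 0) v = 0"
    unfolding v px mu0[symmetric] by (rule sum.neutral) (auto intro!: kill antimonoD[OF anti'(1)])
  have vk: "(x ^^ k) v = 0" if "\<mu> 0 \<le> k" for k
    by (rule funpow_eq_0_mono[OF lin v0 that])

  \<comment> \<open>Index 0 stands for the cyclic submodule of \<open>v\<close>, of dimension
    \<open>\<mu> 0\<close>, and index i + 1 for the lift \<open>Y i\<close> of row i of the
    quotient; hence the shift, and the index range up to n inclusive.\<close>
  define U where "U j = (case j of 0 \<Rightarrow> v | Suc i \<Rightarrow> Y i)" for j
  define \<beta> where "\<beta> j = (case j of 0 \<Rightarrow> \<mu> 0 | Suc i \<Rightarrow> \<alpha> i)" for j
  define I where "I = Sigma {..n} (\<lambda>j. {..<\<beta> j})"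
  let ?f = "\<lambda>(j, k). (x ^^ k) (U j)"
  have size_\<alpha>: "\<mu> 0 + (\<Sum>i<n. \<alpha> i) = n"
  proof -
    have "(\<Sum>i<Suc n. \<mu> i) = \<mu> 0 + (\<Sum>i<n. \<mu> (Suc i))"
      by (rule sum.lessThan_Suc_shift)
    then have "(\<Sum>i<n. \<mu> i) = \<mu> 0 + (\<Sum>i<n. \<mu> (Suc i))"
      using pad[of n] by simp
    then show ?thesis
      using size by (simp add: \<alpha>_def sum.distrib)
  qed
  have "card I = (\<Sum>j<Suc n. \<beta> j)"
    by (simp add: I_def lessThan_Suc_atMost)
  also have "\<dots> = n"
    unfolding sum.lessThan_Suc_shift using size_\<alpha> by (simp add: \<beta>_def)
  finally have I: "finite I" "card I = card Basis"
    by (simp_all add: I_def n_def)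
  have span: "span (?f ` I) = UNIV"
  proof -
    have v_mem: "(x ^^ k) v \<in> span (?f ` I)" for k
    proof (cases "k < \<mu> 0")
      case True
      then have "?f (0, k) \<in> span (?f ` I)"
        by (intro span_base imageI) (simp add: I_def \<beta>_def)
      then show ?thesis by (simp add: U_def)
    qed (simp add: vk span_zero)
    have U_mem: "(x ^^ k) (U j) \<in> span (?f ` I)" if "j \<le> n" for j k
      unfolding I_def
    proof (rule rows_in_span[OF lin])
      fix j assume "j \<in> {..n}"
      then have "(x ^^ \<beta> j) (U j) = (if j = 0 then 0 else (x ^^ \<mu>' j) v)"
        by (cases j) (auto simp: \<beta>_def U_def v0 Y_rel)
      then show "(x ^^ \<beta> j) (U j) \<in> span (?f ` Sigma {..n} (\<lambda>j. {..<\<beta> j}))"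
        using v_mem by (simp add: I_def span_zero)
    qed (use that in simp)
    have Y_mem: "(x ^^ k) (Y i) \<in> span (?f ` I)" if "i < n" for i k
      using U_mem[of "Suc i" k] that by (simp add: U_def)
    have "(x ^^ k) (Z i) \<in> span (?f ` I)" for i k
    proof (cases "i < n")
      case True
      show ?thesis
      proof (cases i)
        case 0
        then show ?thesis using Y_mem[OF True, of k] by (simp add: Y_def)
      next
        case (Suc m)
        have "(x ^^ (\<nu>' m - \<nu>' i)) ((x ^^ (\<nu>' k - \<nu>' m)) (Z k)) = (x ^^ (\<nu>' k - \<nu>' i)) (Z k)"
          if "k \<le> m" for k
        proof -
          have "\<nu>' m - \<nu>' i + (\<nu>' k - \<nu>' m) = \<nu>' k - \<nu>' i"
            using antimonoD[OF anti'(2) that] antimonoD[OF anti'(2), of m i] Suc by simp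
          then show ?thesis by (simp flip: funpow_plus)
        qed
        then have "(x ^^ (\<nu>' m - \<nu>' i)) (Y m) = (\<Sum>k\<le>m. (x ^^ (\<nu>' k - \<nu>' i)) (Z k))"
          by (simp add: Y_def px)
        then have "Z i = Y i - (x ^^ (\<nu>' m - \<nu>' i)) (Y m)"
          by (simp add: Y_def Suc)
        then have "(x ^^ k) (Z i) = (x ^^ k) (Y i) - (x ^^ (k + (\<nu>' m - \<nu>' i))) (Y m)"
          by (simp add: px funpow_plus)
        then show ?thesis
          using Y_mem[of i k] Y_mem[of m "k + (\<nu>' m - \<nu>' i)"] True Suc by (simp add: span_diff)
      qed
    next
      case False
      then have "(x ^^ k) (Z i) = 0"
        using pad'[of i] by (intro funpow_eq_0_mono[OF lin zero]) simp
      then show ?thesis by (simp add: span_zero)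
    qed
    then have "generated x (range Z) \<subseteq> span (?f ` I)"
      unfolding generated_def by (intro span_minimal subspace_span) auto
    then show ?thesis using gen by blast
  qed

  \<comment> \<open>Only the last vector of each row \<open>Y i\<close> gets a nonzero image, so
    \<open>y\<close> agrees with \<open>x\<close> along the row and changes just the relation that
    closes it. A row with \<open>\<alpha> i = 0\<close> has no last vector, and its relation stays
    as it is.\<close>
  obtain E where linE: "lin E" and E: "\<And>jk. jk \<in> I \<Longrightarrow>
      E (?f jk) = (if fst jk \<noteq> 0 \<and> Suc (snd jk) = \<beta> (fst jk) then (x ^^ \<mu> (fst jk)) v else 0)"
    using linear_extension[OF I span, of "\<lambda>jk. if fst jk \<noteq> 0 \<and> Suc (snd jk) = \<beta> (fst jk)
      then (x ^^ \<mu> (fst jk)) v else 0"] by blast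
  have Ev: "E ((x ^^ k) v) = 0" for k
  proof (cases "k < \<mu> 0")
    case True
    then show ?thesis using E[of "(0, k)"] by (simp add: I_def \<beta>_def U_def)
  qed (simp add: vk lin_0[OF linE])
  have EY: "E ((x ^^ k) (Y i)) = (if Suc k = \<alpha> i then (x ^^ \<mu> (Suc i)) v else 0)"
    if "i < n" "k < \<alpha> i" for i k
    using E[of "(Suc i, k)"] that by (simp add: I_def \<beta>_def U_def)

  have "(v, \<lambda>u. x u + scale t (E u)) \<in> enhanced_orbit scale (\<mu>, \<nu>)" if t: "t \<noteq> 0" "t \<noteq> -1" for t
  proof -
    define y where "y = (\<lambda>u. x u + scale t (E u))"
    have y: "y u = x u + scale t (E u)" for u
      by (simp add: y_def)
    have liny: "lin y"
      unfolding y_def by (intro lin_plus lin_smult lin linE)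
    note py = lin_simps[OF lin_funpow[OF liny]]
    have y_v: "(y ^^ k) v = (x ^^ k) v" for k
      by (induction k) (simp_all add: y Ev)
    have y_Y: "(y ^^ k) (Y i) = (x ^^ k) (Y i)" if "i < n" "k < \<alpha> i" for i k
      using that(2)
    proof (induction k)
      case (Suc k)
      then show ?case using EY[OF that(1), of k] by (simp add: y)
    qed simp
    have y_rel: "(y ^^ \<alpha> i) (Y i) = (y ^^ \<mu>' (Suc i)) v + scale t ((y ^^ \<mu> (Suc i)) v)"
      if i: "i < n" and nz: "\<alpha> i \<noteq> 0" for i
    proof -
      obtain m where m: "\<alpha> i = Suc m"
        using nz not0_implies_Suc by blast
      have "(y ^^ \<alpha> i) (Y i) = y ((x ^^ m) (Y i))"
        using y_Y[OF i, of m] m by simp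
      also have "\<dots> = (x ^^ \<alpha> i) (Y i) + scale t ((x ^^ \<mu> (Suc i)) v)"
        using EY[OF i, of m] m by (simp add: y)
      finally show ?thesis
        by (simp only: y_v Y_rel[OF i])
    qed
    have y_v0: "(y ^^ \<mu> 0) ((y ^^ k) v) = 0" for k
    proof -
      have "(y ^^ (\<mu> 0 + k)) v = 0"
        unfolding y_v by (rule vk) simp
      then show ?thesis by (simp only: funpow_plus)
    qed
    have nil: "(y ^^ n) u = 0" for u
    proof -
      have "?f ` I \<subseteq> {u. (y ^^ n) u \<in> {0}}"
      proof clarify
        fix j k assume jk: "(j, k) \<in> I"
        have "(y ^^ n) (U j) = 0 \<and> (x ^^ k) (U j) = (y ^^ k) (U j)"
        proof (cases j)
          case 0
          have "\<mu> 0 \<le> n" using size_\<alpha> by simp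
          then show ?thesis by (simp add: 0 U_def y_v vk)
        next
          case (Suc i)
          then have i: "i < n" "k < \<alpha> i"
            using jk by (auto simp: I_def \<beta>_def)
          then have "\<alpha> i \<noteq> 0" by simp
          have "(y ^^ (\<mu> 0 + \<alpha> i)) (Y i) = 0"
            unfolding funpow_plus y_rel[OF i(1) \<open>\<alpha> i \<noteq> 0\<close>] py y_v0 by simp
          moreover have "\<mu> 0 + \<alpha> i \<le> n"
            using member_le_sum[of i "{..<n}" \<alpha>] i(1) size_\<alpha> by simp
          ultimately have "(y ^^ n) (Y i) = 0"
            by (rule funpow_eq_0_mono[OF liny])
          then show ?thesis using y_Y[OF i] by (simp add: Suc U_def)
        qed
        moreover have "(y ^^ n) ((y ^^ k) (U j)) = (y ^^ k) ((y ^^ n) (U j))"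
          by (simp only: funpow_plus[symmetric] add.commute[of n k])
        ultimately show "(y ^^ n) ((x ^^ k) (U j)) = 0"
          by (simp add: py)
      qed
      then have "span (?f ` I) \<subseteq> {u. (y ^^ n) u \<in> {0}}"
        by (rule span_minimal) (rule subspace_lin_vimage[OF lin_funpow[OF liny] subspace_single_0])
      then show ?thesis using span by auto
    qed
    have t1: "t + 1 \<noteq> 0"
      using t(2) by (simp add: eq_neg_iff_add_eq_0)
    \<comment> \<open>The deformed right-hand side is \<open>t + y^d\<close> applied to
      \<open>(y ^^ \<mu> (Suc i)) v\<close>, where
      \<open>d = \<mu>' (Suc i) - \<mu> (Suc i)\<close>. Dividing \<open>Y i\<close> by this unit
      gives a lift with the relation that \<open>\<mu>\<close> requires. If
      \<open>\<alpha> i = 0\<close>, the relation just says \<open>Y i = v\<close>, and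
      \<open>v\<close> itself serves.\<close>
    have "\<exists>w. (y ^^ \<alpha> i) w = (y ^^ \<mu> (Suc i)) v \<and>
        (Y i = w \<or> (\<exists>d. Y i = scale t w + (y ^^ d) w))" if i: "i < n" for i
    proof (cases "\<alpha> i = 0")
      case True
      then have "Y i = v" "\<mu> (Suc i) = 0"
        using Y_rel[OF i] \<alpha>'[of i] by (simp_all add: \<alpha>_def)
      then show ?thesis
        using True by (intro exI[of _ v]) simp
    next
      case False
      define d where "d = \<mu>' (Suc i) - \<mu> (Suc i)"
      define T where "T u = scale t u + (y ^^ d) u" for u
      have linT: "lin T"
        unfolding T_def by (intro lin_plus lin_smult lin_id lin_funpow liny)
      have inj0: "u = 0" if "T u = 0" for u
      proof -
        have "u \<in> {0}"
        proof (rule unit_cancel[OF liny _ _ nil t(1)])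
          show "scale t u + scale 1 ((y ^^ d) u) \<in> {0}"
            using that by (simp add: T_def)
        qed (use t1 in \<open>simp_all add: lin_0[OF liny]\<close>)
        then show ?thesis by simp
      qed
      then have "inj T"
        using lin_diff[OF linT] by (metis injI right_minus_eq)
      then have "surj T"
        by (rule linear_inj_imp_surj[OF linT])
      then obtain w where w: "Y i = T w"
        by (rule surjE)
      have "T ((y ^^ \<alpha> i) w) = (y ^^ \<alpha> i) (Y i)"
        by (simp add: w T_def py add.commute flip: funpow_plus)
      also have "\<dots> = T ((y ^^ \<mu> (Suc i)) v)"
        using le[of "Suc i"] by (simp add: y_rel[OF i False] T_def d_def add.commute flip: funpow_plus)
      finally have "T ((y ^^ \<alpha> i) w - (y ^^ \<mu> (Suc i)) v) = 0"
        by (simp add: lin_diff[OF linT])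
      then have "(y ^^ \<alpha> i) w = (y ^^ \<mu> (Suc i)) v"
        using inj0 by fastforce
      then show ?thesis
        using w unfolding T_def by blast
    qed
    then obtain W where W: "\<And>i. i < n \<Longrightarrow> (y ^^ \<alpha> i) (W i) = (y ^^ \<mu> (Suc i)) v"
      "\<And>i. i < n \<Longrightarrow> Y i = W i \<or> (\<exists>d. Y i = scale t (W i) + (y ^^ d) (W i))"
      by metis
    \<comment> \<open>This inverts the passage from row generators to lifts: the vectors
      \<open>(y ^^ \<nu> i) (Z' i)\<close> telescope to \<open>(y ^^ \<nu> m) (W m)\<close>. For the
      last row m, \<open>\<mu> (Suc m) = 0\<close> gives \<open>\<nu> m = \<alpha> m\<close>, so the
      total is \<open>v\<close>.\<close>
    define Z' where "Z' i = (if i < n then case i of 0 \<Rightarrow> W 0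
      | Suc m \<Rightarrow> W (Suc m) - (y ^^ (\<nu> m - \<nu> (Suc m))) (W m) else 0)" for i
    have zero': "(y ^^ (\<mu> i + \<nu> i)) (Z' i) = 0" for i
    proof (cases "i < n")
      case True
      have W_mu: "(y ^^ (\<mu> i + \<nu> i)) (W i) = (y ^^ \<mu> i) v"
      proof -
        have "\<mu> i + \<nu> i = (\<mu> i - \<mu> (Suc i)) + \<alpha> i"
          using antimonoD[OF anti(1), of i "Suc i"] by (simp add: \<alpha>_def)
        then have "(y ^^ (\<mu> i + \<nu> i)) (W i) = (y ^^ (\<mu> i - \<mu> (Suc i) + \<mu> (Suc i))) v"
          by (simp only: funpow_plus W(1)[OF True])
        then show ?thesis
          using antimonoD[OF anti(1), of i "Suc i"] by simp
      qed
      show ?thesis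
      proof (cases i)
        case 0
        then show ?thesis
          using W_mu True by (simp add: Z'_def y_v v0)
      next
        case (Suc m)
        have "\<mu> i + \<nu> i + (\<nu> m - \<nu> i) = \<alpha> m"
          using antimonoD[OF anti(2), of m i] Suc by (simp add: \<alpha>_def)
        then have "(y ^^ (\<mu> i + \<nu> i)) ((y ^^ (\<nu> m - \<nu> i)) (W m)) = (y ^^ \<mu> i) v"
          using W(1)[of m] True Suc by (simp flip: funpow_plus)
        then show ?thesis
          using W_mu True Suc by (simp add: Z'_def py)
      qed
    qed (simp add: Z'_def py)
    have partial_sum: "(\<Sum>i\<le>m. (y ^^ \<nu> i) (Z' i)) = (y ^^ \<nu> m) (W m)" if "m < n" for m
      using that
    proof (induction m)
      case (Suc m)
      have "\<nu> (Suc m) + (\<nu> m - \<nu> (Suc m)) = \<nu> m"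
        using antimonoD[OF anti(2), of m "Suc m"] by simp
      then have "(y ^^ \<nu> (Suc m)) (Z' (Suc m)) = (y ^^ \<nu> (Suc m)) (W (Suc m)) - (y ^^ \<nu> m) (W m)"
        using Suc.prems by (simp add: Z'_def py flip: funpow_plus)
      then show ?case
        using Suc by simp
    qed (simp add: Z'_def)
    have v': "v = (\<Sum>i<n. (y ^^ \<nu> i) (Z' i))"
    proof (cases n)
      case 0
      then show ?thesis by (simp add: v)
    next
      case (Suc m)
      have "\<nu> m = \<alpha> m" "\<mu> (Suc m) = 0"
        using pad[of n] Suc by (simp_all add: \<alpha>_def)
      then have "(\<Sum>i\<le>m. (y ^^ \<nu> i) (Z' i)) = v"
        using partial_sum[of m] W(1)[of m] Suc by simp
      then show ?thesis
        by (simp add: Suc lessThan_Suc_atMost)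
    qed
    define G where "G = generated y (range Z')"
    have G: "subspace G" "\<And>u k. u \<in> G \<Longrightarrow> (y ^^ k) u \<in> G" "\<And>i. Z' i \<in> G"
      by (simp_all add: G_def subspace_generated generated_funpow[OF liny] generated_base)
    have W_mem: "W i \<in> G" if "i < n" for i
      using that
    proof (induction i)
      case 0
      then show ?case using G(3)[of 0] by (simp add: Z'_def)
    next
      case (Suc m)
      have "Z' (Suc m) + (y ^^ (\<nu> m - \<nu> (Suc m))) (W m) \<in> G"
        using Suc by (intro subspace_add[OF G(1)] G) simp
      then show ?case using Suc.prems by (simp add: Z'_def)
    qed
    have Y_mem: "Y i \<in> G" if "i < n" for i
      using W(2)[OF that] W_mem[OF that] by (auto intro!: subspace_add[OF G(1)] subspace_scale[OF G(1)] G(2))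
    have v_mem: "v \<in> G"
      unfolding v' by (intro subspace_sum[OF G(1)] G)
    have "?f ` I \<subseteq> G"
    proof clarify
      fix j k assume jk: "(j, k) \<in> I"
      show "(x ^^ k) (U j) \<in> G"
      proof (cases j)
        case 0
        then show ?thesis using G(2)[OF v_mem, of k] by (simp add: U_def y_v)
      next
        case (Suc i)
        then have i: "i < n" "k < \<alpha> i"
          using jk by (auto simp: I_def \<beta>_def)
        then show ?thesis using G(2)[OF Y_mem, of i k] y_Y[OF i] by (simp add: Suc U_def)
      qed
    qed
    then have "span (?f ` I) \<subseteq> G"
      by (rule span_minimal[OF _ G(1)])
    then have gen': "generated y (range Z') = UNIV"
      using span by (auto simp: G_def)
    show ?thesis
      unfolding y_def[symmetric]
      by (rule enhanced_orbitI[OF bip(1) liny zero' gen']) (use v' in \<open>simp add: n_def\<close>)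
  qed
  then show ?thesis
    unfolding degenerates_to_def
    by (intro exI[of _ "0 :: 'b"] exI[of _ E] exI[of _ "{0, -1}"] conjI linE) simp_all
qed

end

section \<open>Refining the order on bipartitions\<close>

text \<open>Two partitions woven into one sequence: the terms of each parity decrease, and
  neighbouring terms are unrelated.\<close>

definition interlaced :: "nat \<Rightarrow> (nat \<Rightarrow> nat) \<Rightarrow> bool" where
  "interlaced N a \<longleftrightarrow> (\<forall>i. a (Suc (Suc i)) \<le> a i) \<and> (\<forall>i\<ge>N. a i = 0)"

definition dominates :: "(nat \<Rightarrow> nat) \<Rightarrow> (nat \<Rightarrow> nat) \<Rightarrow> bool" where
  "dominates a b \<longleftrightarrow> (\<forall>m. (\<Sum>i<m. b i) \<le> (\<Sum>i<m. a i))"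

text \<open>
  For \<open>e = 0\<close> the sums \<open>\<mu> i + \<nu> i\<close> of an interlaced pair stay fixed, for \<open>e = 1\<close> the sums
  \<open>\<nu> i + \<mu> (i + 1)\<close> and \<open>\<mu> 0\<close>. These two kinds of moves do not suffice: from
  \<open>5, 1, 3, 1, 1, 1\<close> to \<open>5, 1, 2, 1, 2, 1\<close> there is no intermediate sequence.
\<close>

definition pair_shift :: "(nat \<Rightarrow> nat) \<Rightarrow> (nat \<Rightarrow> nat) \<Rightarrow> bool" where
  "pair_shift a c \<longleftrightarrow> (\<exists>e\<in>{0, 1}. (e = 1 \<longrightarrow> c 0 = a 0) \<and>
     (\<forall>k. c (2 * k + e) \<le> a (2 * k + e) \<and>
       c (2 * k + e) + c (Suc (2 * k + e)) = a (2 * k + e) + a (Suc (2 * k + e))))"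

text \<open>Equal parity of p and q means that the box stays within one of the two partitions and
  the other one is unchanged. The example above is a step of this kind.\<close>

definition box_move :: "(nat \<Rightarrow> nat) \<Rightarrow> (nat \<Rightarrow> nat) \<Rightarrow> bool" where
  "box_move a c \<longleftrightarrow> (\<exists>p q. p < q \<and> even (q - p) \<and> a p = Suc (c p) \<and> c q = Suc (a q) \<and>
     (\<forall>i. i \<noteq> p \<longrightarrow> i \<noteq> q \<longrightarrow> c i = a i))"

lemma interlaced_antimono:
  assumes "interlaced N a"
  shows "a (m + 2 * k) \<le> a m"
proof (induction k)
  case (Suc k)
  have "a (m + 2 * Suc k) \<le> a (m + 2 * k)"
    using assms by (simp add: interlaced_def)
  then show ?case using Suc by simp
qed simp

text \<open>The terms at i, i + 2, ..., j lose 1 and their right neighbours gain 1, so exactly the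
  partial sums of lengths i + 1, i + 3, ..., j + 1 drop by 1; \<open>pos\<close> provides the slack
  there. Within the block the order of each parity is kept; \<open>drop\<close> protects it behind
  the last lowered term and \<open>gap\<close> in front of the first raised one.\<close>

lemma block_lowering:
  assumes a: "interlaced N a" and j: "j = i + 2 * d"
    and drop: "a (Suc (Suc j)) < a j" and gap: "i = 0 \<or> a (Suc i) < a (i - 1)"
    and dom: "dominates a b" and sums: "\<And>m. N \<le> m \<Longrightarrow> (\<Sum>k<m. b k) = (\<Sum>k<m. a k)"
    and pos: "\<And>k. k \<le> d \<Longrightarrow> (\<Sum>r<Suc (i + 2 * k). b r) < (\<Sum>r<Suc (i + 2 * k). a r)"
  shows "\<exists>c. interlaced N c \<and> dominates a c \<and> dominates c b \<and> c \<noteq> a \<and> pair_shift a c"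
proof -
  define inb where "inb m \<longleftrightarrow> i \<le> m \<and> m \<le> Suc j" for m
  define c where "c m = (if inb m then if even (m - i) then a m - 1 else Suc (a m) else a m)" for m
  have a_pos: "0 < a m" if "inb m" "even (m - i)" for m
  proof -
    from that obtain k where k: "m = i + 2 * k"
      by (metis evenE le_add_diff_inverse inb_def)
    have "m \<noteq> Suc j"
      using k j by presburger
    then have "m \<le> j"
      using that by (simp add: inb_def)
    then have "j = m + 2 * (d - k)"
      using k j by simp
    then have "a j \<le> a m"
      using interlaced_antimono[OF a, of m "d - k"] by simp
    then show ?thesis using drop by simp
  qed
  have c_sum: "(\<Sum>r<m. c r) + (if i < m \<and> m \<le> Suc j \<and> odd (m - i) then 1 else 0) = (\<Sum>r<m. a r)" for m
  proof (induction m)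
    case (Suc m)
    have "c m + (if i < Suc m \<and> Suc m \<le> Suc j \<and> odd (Suc m - i) then 1 else 0)
        = a m + (if i < m \<and> m \<le> Suc j \<and> odd (m - i) then 1 else 0)"
    proof (cases "inb m")
      case True
      then have im: "i \<le> m" "m \<le> Suc j" by (auto simp: inb_def)
      have S: "Suc m - i = Suc (m - i)"
        using im by simp
      show ?thesis
      proof (cases "even (m - i)")
        case True
        have "m \<noteq> Suc j"
          using True j by auto
        then show ?thesis
          using a_pos[OF \<open>inb m\<close> True] True im \<open>inb m\<close> S by (simp add: c_def)
      next
        case False
        then have "i \<noteq> m" by auto
        then show ?thesis
          using False im \<open>inb m\<close> S by (simp add: c_def)
      qed
    next
      case False
      have "odd (Suc m - i) \<Longrightarrow> i < Suc m \<Longrightarrow> m \<le> j \<Longrightarrow> inb m"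
        by (auto simp: inb_def)
      then show ?thesis
        using False by (auto simp: c_def inb_def)
    qed
    then show ?case using Suc by simp
  qed simp
  have R: "(\<Sum>r<m. b r) < (\<Sum>r<m. a r)" if m: "i < m" "m \<le> Suc j" "odd (m - i)" for m
  proof -
    from m(3) obtain k where k: "m - i = 2 * k + 1"
      by (rule oddE)
    then have "m = Suc (i + 2 * k)" "k \<le> d"
      using m j by simp_all
    then show ?thesis using pos by simp
  qed
  have domc: "(\<Sum>r<m. b r) \<le> (\<Sum>r<m. c r)" for m
  proof (cases "i < m \<and> m \<le> Suc j \<and> odd (m - i)")
    case True
    then show ?thesis using R[of m] c_sum[of m] by simp
  next
    case False
    have "(\<Sum>r<m. c r) = (\<Sum>r<m. a r)"
      using c_sum[of m] unfolding if_not_P[OF False] by simp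
    then show ?thesis using dom by (simp add: dominates_def)
  qed
  have jN: "Suc j < N"
  proof (rule ccontr)
    assume "\<not> Suc j < N"
    then show False
      using R[of "Suc j"] sums[of "Suc j"] j by simp
  qed
  have a2: "a (Suc (Suc m)) \<le> a m" for m
    using a by (simp add: interlaced_def)
  have "c (Suc (Suc m)) \<le> c m" for m
  proof (cases "inb m")
    case True
    then have im: "i \<le> m" "m \<le> Suc j" by (auto simp: inb_def)
    have S: "Suc (Suc m) - i = Suc (Suc (m - i))"
      using im by simp
    show ?thesis
    proof (cases "inb (Suc (Suc m))")
      case T2: True
      show ?thesis
        using True T2 a2[of m] S by (auto simp: c_def)
    next
      case F2: False
      then have m: "m = j \<or> m = Suc j"
        using im by (auto simp: inb_def)
      show ?thesis
        using m True F2 drop a2[of m] j by (auto simp: c_def)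
    qed
  next
    case False
    show ?thesis
    proof (cases "inb (Suc (Suc m))")
      case T2: True
      then have "Suc (Suc m) = i \<or> Suc m = i"
        using False by (auto simp: inb_def)
      then show ?thesis
      proof
        assume "Suc (Suc m) = i"
        then show ?thesis using False T2 a2[of m] by (simp add: c_def)
      next
        assume i: "Suc m = i"
        then have "a (Suc (Suc m)) < a m"
          using gap by auto
        moreover have "odd (Suc (Suc m) - i)"
          using i by simp
        ultimately show ?thesis using False T2 by (simp add: c_def)
      qed
    next
      case F2: False
      then show ?thesis using False a2[of m] by (simp add: c_def)
    qed
  qed
  moreover have "c m = 0" if "N \<le> m" for m
    using that jN a by (simp add: c_def inb_def interlaced_def)
  ultimately have "interlaced N c"
    by (simp add: interlaced_def)
  moreover have "dominates a c"
    unfolding dominates_def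
  proof
    fix m show "(\<Sum>r<m. c r) \<le> (\<Sum>r<m. a r)"
      unfolding c_sum[of m, symmetric] by (rule le_add1)
  qed
  moreover have "dominates c b"
    using domc by (simp add: dominates_def)
  moreover have "c \<noteq> a"
  proof
    assume "c = a"
    then have "c i = a i" by simp
    then show False using a_pos[of i] j by (simp add: c_def inb_def)
  qed
  moreover have "pair_shift a c"
    unfolding pair_shift_def
  \<comment> \<open>The pairs start at indices of the parity of i, so each pair of a lowered and a
    raised term is one of the pairs of fixed sum.\<close>
  proof (intro bexI[of _ "i mod 2"] conjI impI allI)
    assume "i mod 2 = 1"
    then have "\<not> inb 0" by (auto simp: inb_def)
    then show "c 0 = a 0" by (simp add: c_def)
  next
    fix k
    define m where "m = 2 * k + i mod 2"
    have m_i: "even m \<longleftrightarrow> even i"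
      by (simp add: m_def)
    then have par: "even (m - i)" if "i \<le> m"
      using that by simp
    have inb_iff: "inb (Suc m) \<longleftrightarrow> inb m"
    proof -
      have "Suc m \<noteq> i" "m \<noteq> Suc j"
        using m_i j by auto
      then show ?thesis by (auto simp: inb_def)
    qed
    have "c m \<le> a m \<and> c m + c (Suc m) = a m + a (Suc m)"
    proof (cases "inb m")
      case True
      then have "even (m - i)" "odd (Suc m - i)"
        using par by (simp_all add: inb_def Suc_diff_le)
      then show ?thesis
        using True inb_iff a_pos[of m] by (simp add: c_def)
    qed (simp add: c_def inb_iff)
    then show "c (2 * k + i mod 2) \<le> a (2 * k + i mod 2)"
      "c (2 * k + i mod 2) + c (Suc (2 * k + i mod 2)) = a (2 * k + i mod 2) + a (Suc (2 * k + i mod 2))"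
      unfolding m_def by simp_all
  qed auto
  ultimately show ?thesis by blast
qed

text \<open>All partial sums of lengths in (p, q] drop by 1, which is why \<open>pos\<close> covers
  this whole range. If q = p + 2, giver and receiver are neighbours in their partition and must
  differ by 2; otherwise a strict drop at each end suffices.\<close>

lemma box_lowering:
  assumes a: "interlaced N a" and pq: "p < q" "even (q - p)"
    and drop: "q = p + 2 \<Longrightarrow> a q + 2 \<le> a p"
      "q \<noteq> p + 2 \<Longrightarrow> a (p + 2) < a p \<and> a q < a (q - 2)"
    and dom: "dominates a b" and sums: "\<And>m. N \<le> m \<Longrightarrow> (\<Sum>k<m. b k) = (\<Sum>k<m. a k)"
    and pos: "\<And>m. p < m \<Longrightarrow> m \<le> q \<Longrightarrow> (\<Sum>r<m. b r) < (\<Sum>r<m. a r)"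
  shows "\<exists>c. interlaced N c \<and> dominates a c \<and> dominates c b \<and> c \<noteq> a \<and> box_move a c"
proof -
  define c where "c = a(p := a p - 1, q := Suc (a q))"
  have ap: "0 < a p"
    using drop by (cases "q = p + 2") auto
  have c_eq: "c m = (if m = p then a p - 1 else if m = q then Suc (a q) else a m)" for m
    using pq(1) by (auto simp: c_def)
  have c_sum: "(\<Sum>r<m. c r) + (if p < m \<and> m \<le> q then 1 else 0) = (\<Sum>r<m. a r)" for m
  proof (induction m)
    case (Suc m)
    have "c m + (if p < Suc m \<and> Suc m \<le> q then 1 else 0) = a m + (if p < m \<and> m \<le> q then 1 else 0)"
      using ap pq(1) by (auto simp: c_eq)
    then show ?case using Suc by simp
  qed simp
  have domc: "(\<Sum>r<m. b r) \<le> (\<Sum>r<m. c r)" for m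
  proof (cases "p < m \<and> m \<le> q")
    case True
    then show ?thesis using pos[of m] c_sum[of m] by simp
  next
    case False
    have "(\<Sum>r<m. c r) = (\<Sum>r<m. a r)"
      using c_sum[of m] unfolding if_not_P[OF False] by simp
    then show ?thesis using dom by (simp add: dominates_def)
  qed
  have qN: "q < N"
  proof (rule ccontr)
    assume "\<not> q < N"
    then show False
      using pos[of q] sums[of q] pq(1) by simp
  qed
  have a2: "a (Suc (Suc m)) \<le> a m" for m
    using a by (simp add: interlaced_def)
  have c2: "c (Suc (Suc m)) \<le> c m" for m
  proof -
    consider "m = p" "Suc (Suc m) = q" | "m = p" "Suc (Suc m) \<noteq> q" | "m \<noteq> p" "Suc (Suc m) = q"
      | "m \<noteq> p" "Suc (Suc m) \<noteq> q" by blast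
    then show ?thesis
    proof cases
      case 1
      then show ?thesis using drop(1) by (simp add: c_eq)
    next
      case 2
      then have "a (p + 2) < a p" using drop(2) by auto
      then show ?thesis using 2 by (simp add: c_eq)
    next
      case 3
      then have "a q < a (q - 2)" using drop(2) by auto
      moreover have "q - 2 = m" using 3 by simp
      ultimately show ?thesis using 3 pq(1) by (simp add: c_eq)
    next
      case 4
      then show ?thesis using a2[of m] by (auto simp: c_eq)
    qed
  qed
  have "c m = 0" if "N \<le> m" for m
    using that qN pq(1) a by (simp add: c_eq interlaced_def)
  with c2 have "interlaced N c"
    by (simp add: interlaced_def)
  moreover have "dominates a c"
    unfolding dominates_def
  proof
    fix m show "(\<Sum>r<m. c r) \<le> (\<Sum>r<m. a r)"
      unfolding c_sum[of m, symmetric] by (rule le_add1)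
  qed
  moreover have "dominates c b"
    using domc by (simp add: dominates_def)
  moreover have "c p \<noteq> a p"
    using ap by (simp add: c_eq)
  then have "c \<noteq> a" by auto
  moreover have "box_move a c"
    unfolding box_move_def using pq ap by (intro exI[of _ p] exI[of _ q]) (simp add: c_eq)
  ultimately show ?thesis by blast
qed

lemma obtain_least:
  fixes P :: "nat \<Rightarrow> bool"
  assumes "\<exists>n. P n"
  obtains n where "P n" "\<And>m. m < n \<Longrightarrow> \<not> P m"
  using assms unfolding exists_least_iff[of P] by blast

lemma even_odd_offset:
  fixes i l :: nat
  assumes "l \<le> i"
  obtains k where "i = l + 2 * k" | k where "i = Suc (l + 2 * k)"
proof (cases "even (i - l)")
  case True
  then obtain k where "i - l = 2 * k" by (rule evenE)
  then have "i = l + 2 * k"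
    using assms by linarith
  then show ?thesis by (rule that(1))
next
  case False
  then obtain k where "i - l = 2 * k + 1" by (rule oddE)
  then have "i = Suc (l + 2 * k)"
    using assms by linarith
  then show ?thesis by (rule that(2))
qed

text \<open>
  Look at the first index \<open>l\<close> where the sequences differ. From there on the terms of each parity
  stay constant for a while, and the partial sums of \<open>a\<close> remain strictly larger. The move is
  determined by the parity that drops first.
\<close>

lemma elementary_step_exists:
  assumes a: "interlaced N a" and b: "interlaced N b" and dom: "dominates a b"
    and total: "(\<Sum>i<N. b i) = (\<Sum>i<N. a i)" and neq: "a \<noteq> b"
  shows "\<exists>c. interlaced N c \<and> dominates a c \<and> dominates c b \<and> c \<noteq> a \<and> (pair_shift a c \<or> box_move a c)"
proof -
  have sums: "(\<Sum>i<m. b i) = (\<Sum>i<m. a i)" if "N \<le> m" for m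
    using that
  proof (induction m rule: dec_induct)
    case (step m)
    then have "a m = 0" "b m = 0"
      using a b by (simp_all add: interlaced_def)
    then show ?case using step by simp
  qed (rule total)
  define l where "l = (LEAST i. a i \<noteq> b i)"
  have "\<exists>i. a i \<noteq> b i"
    using neq by auto
  then have l: "a l \<noteq> b l"
    unfolding l_def by (rule LeastI_ex)
  have below: "a i = b i" if "i < l" for i
    using not_less_Least that unfolding l_def by blast
  define D where "D m = int (\<Sum>i<m. a i) - int (\<Sum>i<m. b i)" for m
  have D_Suc: "D (Suc m) = D m + int (a m) - int (b m)" for m
    by (simp add: D_def)
  have D_nonneg: "0 \<le> D m" for m
    using dom[unfolded dominates_def, THEN spec, of m] unfolding D_def by linarith
  have D_pos: "(\<Sum>i<m. b i) < (\<Sum>i<m. a i)" if "1 \<le> D m" for m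
    using that unfolding D_def by linarith
  have Dl: "D l = 0"
    using sum.cong[of "{..<l}" "{..<l}" a b] below by (simp add: D_def)
  define X where "X = a l"
  have bl: "b l < X"
    using D_nonneg[of "Suc l"] Dl l by (simp add: D_Suc X_def)
  have bX: "b (l + 2 * k) < X" for k
    using interlaced_antimono[OF b, of l k] bl by simp
  have D_mono: "1 \<le> D m" if "l < m" "\<And>i. l \<le> i \<Longrightarrow> i < m \<Longrightarrow> b i \<le> a i" for m
  proof -
    have "Suc l \<le> m"
      using that(1) by simp
    then show ?thesis
      using that(2)
    proof (induction m rule: dec_induct)
      case base
      then show ?case using bl by (simp add: D_Suc Dl X_def)
    next
      case (step m)
      have "b m \<le> a m" "1 \<le> D m"
        using step by simp_all
      then show ?case by (simp add: D_Suc)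
    qed
  qed
  \<comment> \<open>The terms at even distance from l form a plateau of height X that ends with
    offset u. It ends because \<open>a\<close> vanishes from N on and X exceeds
    \<open>b l\<close>.\<close>
  have "a (l + 2 * Suc N) < X"
    using a bl by (simp add: interlaced_def)
  then have "\<exists>u. a (l + 2 * Suc u) < X" ..
  then obtain u where u: "a (l + 2 * Suc u) < X" "\<And>k. k < u \<Longrightarrow> \<not> a (l + 2 * Suc k) < X"
    by (rule obtain_least) (rule that)
  have aX: "a (l + 2 * k) = X" if "k \<le> u" for k
  proof (cases k)
    case (Suc m)
    then have "\<not> a (l + 2 * k) < X"
      using u(2)[of m] that by simp
    then show ?thesis
      using interlaced_antimono[OF a, of l k] by (simp add: X_def)
  qed (simp add: X_def)
  have dropX: "a (Suc (Suc (l + 2 * u))) < a (l + 2 * u)"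
    using u(1) aX[of u] by simp
  \<comment> \<open>A block that starts at l raises \<open>a (Suc l)\<close>, which must not
    overtake \<open>a (l - 1)\<close>. If it is blocked, the terms at odd distance start with a
    plateau too, of height \<open>Y = a l0\<close>.\<close>
  consider "l = 0 \<or> a (Suc l) < a (l - 1)" | l0 where "l = Suc l0" "a (Suc l) = a l0"
  proof -
    assume *: "l = 0 \<or> a (Suc l) < a (l - 1) \<Longrightarrow> thesis"
      "\<And>l0. l = Suc l0 \<Longrightarrow> a (Suc l) = a l0 \<Longrightarrow> thesis"
    have "a (Suc (Suc m)) \<le> a m" for m
      using a by (simp add: interlaced_def)
    then show thesis
      using * by (cases l) (auto simp: order_le_less)
  qed
  then show ?thesis
  proof cases
    case 1
    have pos: "1 \<le> D (Suc (l + 2 * k))" if "k \<le> u" for k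
      using aX[OF that] bX[of k] D_nonneg[of "l + 2 * k"] by (simp add: D_Suc)
    have "\<exists>c. interlaced N c \<and> dominates a c \<and> dominates c b \<and> c \<noteq> a \<and> pair_shift a c"
      by (rule block_lowering[OF a refl dropX 1 dom sums D_pos[OF pos]])
    then show ?thesis by blast
  next
    case (2 l0)
    define Y where "Y = a l0"
    have bY: "b (Suc (l + 2 * k)) \<le> Y" for k
      using interlaced_antimono[OF b, of l0 "Suc k"] below[of l0] 2(1) by (simp add: Y_def)
    have aY_le: "a (Suc (l + 2 * k)) \<le> Y" for k
      using interlaced_antimono[OF a, of "Suc l" k] 2(2) by (simp add: Y_def)
    have aY_Suc: "a (Suc (l + 2 * k)) = Y" if "\<And>m. m < k \<Longrightarrow> \<not> a (Suc (l + 2 * Suc m)) < Y" for k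
    proof (cases k)
      case 0
      then show ?thesis using 2(2) by (simp add: Y_def)
    next
      case (Suc m)
      then show ?thesis using that[of m] aY_le[of k] by simp
    qed
    show ?thesis
    \<comment> \<open>Decides which plateau ends first: the one at even distances, after offset u,
      or the one at odd distances, after some offset w < u.\<close>
    proof (cases "\<forall>k\<le>u. a (Suc (l + 2 * k)) = Y")
      case Y: True
      \<comment> \<open>A box from the end of the plateau can go to a later place of the same parity
        only if the value there is at most X - 2. For the least such place the terms strictly
        between are X - 1, still at least the terms of \<open>b\<close>, so the partial sums of
        \<open>a\<close> remain strictly larger.\<close>
      define Q where "Q k \<longleftrightarrow> u < k \<and> a (l + 2 * k) + 2 \<le> X \<and> (\<forall>k'<k. a (Suc (l + 2 * k')) = Y)" for k
      have even_le: "b (l + 2 * k) \<le> a (l + 2 * k)"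
        if "\<not> Q k" "\<And>k'. k' < k \<Longrightarrow> a (Suc (l + 2 * k')) = Y" for k
      proof (cases "k \<le> u")
        case True
        then show ?thesis using aX bX[of k] by simp
      next
        case False
        then have "X < a (l + 2 * k) + 2"
          using that by (simp add: Q_def not_le)
        then show ?thesis using bX[of k] by simp
      qed
      show ?thesis
      proof (cases "\<exists>r. Q r")
        case True
        then obtain r where r: "Q r" "\<And>k. k < r \<Longrightarrow> \<not> Q k"
          by (rule obtain_least) (rule that)
        have ru: "u < r" and rX: "a (l + 2 * r) + 2 \<le> X"
          and rY: "\<And>k. k < r \<Longrightarrow> a (Suc (l + 2 * k)) = Y"
          using r(1) by (auto simp: Q_def)
        have pos: "1 \<le> D m" if "l + 2 * u < m" "m \<le> l + 2 * r" for m
        proof (rule D_mono)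
          show "l < m" using that by simp
          fix i assume i: "l \<le> i" "i < m"
          show "b i \<le> a i"
          proof (rule even_odd_offset[OF i(1)])
            fix k assume k: "i = l + 2 * k"
            then have "k < r" using i that by simp
            then show ?thesis using even_le[of k] r(2)[of k] rY k by simp
          next
            fix k assume k: "i = Suc (l + 2 * k)"
            then have "k < r" using i that by simp
            then show ?thesis using rY[of k] bY[of k] k by simp
          qed
        qed
        have "\<exists>c. interlaced N c \<and> dominates a c \<and> dominates c b \<and> c \<noteq> a \<and> box_move a c"
        proof (rule box_lowering[OF a _ _ _ _ dom sums D_pos[OF pos]])
          show "l + 2 * u < l + 2 * r" "even (l + 2 * r - (l + 2 * u))"
            using ru by simp_all
          show "a (l + 2 * r) + 2 \<le> a (l + 2 * u)"
            using rX aX[of u] by simp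
          assume "l + 2 * r \<noteq> l + 2 * u + 2"
          then have r1: "u < r - 1" using ru by simp
          have "\<not> Q (r - 1)" using r(2)[of "r - 1"] ru by simp
          then have "X < a (l + 2 * (r - 1)) + 2"
            using r1 rY by (simp add: Q_def not_le)
          moreover have "l + 2 * r - 2 = l + 2 * (r - 1)" using ru by simp
          ultimately show "a (l + 2 * u + 2) < a (l + 2 * u) \<and> a (l + 2 * r) < a (l + 2 * r - 2)"
            using rX dropX by simp
        qed
        then show ?thesis by blast
      next
        case noQ: False
        show ?thesis
        proof (cases "\<exists>w. a (Suc (l + 2 * Suc w)) < Y")
          case True
          then obtain w where w: "a (Suc (l + 2 * Suc w)) < Y"
            "\<And>k. k < w \<Longrightarrow> \<not> a (Suc (l + 2 * Suc k)) < Y"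
            by (rule obtain_least) (rule that)
          have wY: "a (Suc (l + 2 * k)) = Y" if "k \<le> w" for k
            by (rule aY_Suc) (use w(2) that in auto)
          have uw: "u \<le> w"
          proof (rule ccontr)
            assume "\<not> u \<le> w"
            then show False using Y w(1) by (auto dest: spec[of _ "Suc w"])
          qed
          have pos: "1 \<le> D (Suc (Suc (l + 2 * u) + 2 * k))" if k: "k \<le> w - u" for k
          proof (rule D_mono)
            fix i assume i: "l \<le> i" "i < Suc (Suc (l + 2 * u) + 2 * k)"
            show "b i \<le> a i"
            proof (rule even_odd_offset[OF i(1)])
              fix j assume j: "i = l + 2 * j"
              then have "j \<le> w" using i k uw by simp
              then show ?thesis using even_le[of j] noQ wY j by simp
            next
              fix j assume j: "i = Suc (l + 2 * j)"
              then have "j \<le> w" using i k uw by simp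
              then show ?thesis using wY[of j] bY[of j] j by simp
            qed
          qed simp
          \<comment> \<open>The block starts at the odd distance right after u: its first raised
            term is the one behind the even plateau, where the drop leaves room.\<close>
          have "\<exists>c. interlaced N c \<and> dominates a c \<and> dominates c b \<and> c \<noteq> a \<and> pair_shift a c"
          proof (rule block_lowering[OF a _ _ _ dom sums D_pos[OF pos]])
            show "Suc (l + 2 * w) = Suc (l + 2 * u) + 2 * (w - u)"
              using uw by simp
            show "a (Suc (Suc (Suc (l + 2 * w)))) < a (Suc (l + 2 * w))"
              using w(1) wY[of w] by simp
            show "Suc (l + 2 * u) = 0 \<or> a (Suc (Suc (l + 2 * u))) < a (Suc (l + 2 * u) - 1)"
              using dropX by simp
          qed
          then show ?thesis by blast
        next
          \<comment> \<open>With no place to receive a box and no end of the odd plateau,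
            \<open>a\<close> is termwise at least \<open>b\<close> from l on and strictly larger at
            l, against the equality of totals.\<close>
          case noW: False
          then have allY: "a (Suc (l + 2 * k)) = Y" for k
            by (intro aY_Suc) auto
          have "b i \<le> a i" if "l \<le> i" for i
          proof (rule even_odd_offset[OF that])
            fix k assume "i = l + 2 * k"
            then show ?thesis using even_le[of k] noQ allY by simp
          next
            fix k assume "i = Suc (l + 2 * k)"
            then show ?thesis using allY[of k] bY[of k] by simp
          qed
          then have "1 \<le> D (max N (Suc l))"
            by (intro D_mono) auto
          then show ?thesis
            using sums[of "max N (Suc l)"] by (simp add: D_def)
        qed
      qed
    next
      case False
      then have "\<exists>w. a (Suc (l + 2 * Suc w)) < Y"
        using aY_Suc by blast
      then obtain w where w: "a (Suc (l + 2 * Suc w)) < Y"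
        "\<And>k. k < w \<Longrightarrow> \<not> a (Suc (l + 2 * Suc k)) < Y"
        by (rule obtain_least) (rule that)
      have wY: "a (Suc (l + 2 * k)) = Y" if "k \<le> w" for k
        by (rule aY_Suc) (use w(2) that in auto)
      have wu: "w < u"
        using False wY by (meson leI le_trans)
      define Q where "Q k \<longleftrightarrow> w < k \<and> a (Suc (l + 2 * k)) + 2 \<le> Y" for k
      \<comment> \<open>In each pair of terms \<open>D\<close> gains at least 1 at the even
        distance, where \<open>b\<close> is below X, and loses at most 1 at the odd distance, where
        \<open>a\<close> is at least Y - 1 and \<open>b\<close> at most Y.\<close>
      have D_even: "1 \<le> D (l + 2 * K)" if "Suc w \<le> K" "K \<le> Suc u" "\<And>k. k < K \<Longrightarrow> \<not> Q k" for K
        using that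
      proof (induction K rule: dec_induct)
        case base
        show ?case
        proof (rule D_mono)
          fix i assume i: "l \<le> i" "i < l + 2 * Suc w"
          show "b i \<le> a i"
          proof (rule even_odd_offset[OF i(1)])
            fix k assume k: "i = l + 2 * k"
            then have "k \<le> u" using i wu by simp
            then show ?thesis using aX[of k] bX[of k] k by simp
          next
            fix k assume k: "i = Suc (l + 2 * k)"
            then have "k \<le> w" using i by simp
            then show ?thesis using wY[of k] bY[of k] k by simp
          qed
        qed simp
      next
        case (step K)
        have "1 \<le> D (l + 2 * K)"
          using step by simp
        moreover have "a (l + 2 * K) = X"
          using step.prems by (intro aX) simp
        moreover have "Y < a (Suc (l + 2 * K)) + 2"
          using step.hyps step.prems(2)[of K] by (simp add: Q_def)
        ultimately show ?case
          using bX[of K] bY[of K] by (simp add: D_Suc)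
      qed
      have D_odd: "1 \<le> D (Suc (l + 2 * K))" if "Suc w \<le> K" "K \<le> u" "\<And>k. k < K \<Longrightarrow> \<not> Q k" for K
        using D_even[OF that(1) _ that(3)] that(2) aX[OF that(2)] bX[of K] by (simp add: D_Suc)
      show ?thesis
      proof (cases "\<exists>r\<le>u. Q r")
        case True
        then obtain r' where r': "Q r'" "r' \<le> u" by blast
        then have "\<exists>r. Q r" by blast
        then obtain r where r1: "Q r" and r3: "\<And>k. k < r \<Longrightarrow> \<not> Q k"
          by (rule obtain_least) (rule that)
        have "r \<le> u"
          using r3[of r'] r' by (cases "r' < r") simp_all
        note r = r1 this r3
        have wr: "w < r" and rY: "a (Suc (l + 2 * r)) + 2 \<le> Y"
          using r(1) by (auto simp: Q_def)
        have pos: "1 \<le> D m" if m: "Suc (l + 2 * w) < m" "m \<le> Suc (l + 2 * r)" for m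
        proof (rule even_odd_offset[of l m])
          show "l \<le> m" using m by simp
        next
          fix k assume k: "m = l + 2 * k"
          then show ?thesis using m r by (simp only: k) (intro D_even; force)
        next
          fix k assume k: "m = Suc (l + 2 * k)"
          then show ?thesis using m r by (simp only: k) (intro D_odd; force)
        qed
        have "\<exists>c. interlaced N c \<and> dominates a c \<and> dominates c b \<and> c \<noteq> a \<and> box_move a c"
        proof (rule box_lowering[OF a _ _ _ _ dom sums D_pos[OF pos]])
          show "Suc (l + 2 * w) < Suc (l + 2 * r)" "even (Suc (l + 2 * r) - Suc (l + 2 * w))"
            using wr by simp_all
          show "a (Suc (l + 2 * r)) + 2 \<le> a (Suc (l + 2 * w))"
            using rY wY[of w] by simp
          assume "Suc (l + 2 * r) \<noteq> Suc (l + 2 * w) + 2"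
          then have r1: "w < r - 1" using wr by simp
          have "\<not> Q (r - 1)" using r(3)[of "r - 1"] wr by simp
          then have "Y < a (Suc (l + 2 * (r - 1))) + 2"
            using r1 by (simp add: Q_def not_le)
          moreover have "Suc (l + 2 * r) - 2 = Suc (l + 2 * (r - 1))" using wr by simp
          ultimately show "a (Suc (l + 2 * w) + 2) < a (Suc (l + 2 * w)) \<and>
              a (Suc (l + 2 * r)) < a (Suc (l + 2 * r) - 2)"
            using rY w(1) wY[of w] by simp
        qed
        then show ?thesis by blast
      next
        case noQ: False
        have pos: "1 \<le> D (Suc (l + 2 * Suc w + 2 * k))" if "k \<le> u - Suc w" for k
          using D_odd[of "Suc w + k"] that wu noQ by (simp add: algebra_simps)
        have "\<exists>c. interlaced N c \<and> dominates a c \<and> dominates c b \<and> c \<noteq> a \<and> pair_shift a c"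
        proof (rule block_lowering[OF a _ dropX _ dom sums D_pos[OF pos]])
          show "l + 2 * u = l + 2 * Suc w + 2 * (u - Suc w)"
            using wu by simp
          show "l + 2 * Suc w = 0 \<or> a (Suc (l + 2 * Suc w)) < a (l + 2 * Suc w - 1)"
            using w(1) wY[of w] by simp
        qed
        then show ?thesis by blast
      qed
    qed
  qed
qed

text \<open>The sum of all partial sums up to length N is a decreasing measure: a step raises no
  partial sum and lowers one, because \<open>c\<close> differs from \<open>a\<close>. Thus
  \<open>P\<close> climbs from \<open>b\<close> to every sequence of the same total that dominates
  it.\<close>

lemma dominance_induct:
  assumes refl: "P b" and step: "\<And>a c. interlaced N a \<Longrightarrow> interlaced N c \<Longrightarrow>
      (\<Sum>i<N. c i) = (\<Sum>i<N. a i) \<Longrightarrow> pair_shift a c \<or> box_move a c \<Longrightarrow> P c \<Longrightarrow> P a"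
    and b: "interlaced N b" and a: "interlaced N a" "dominates a b" "(\<Sum>i<N. b i) = (\<Sum>i<N. a i)"
  shows "P a"
  using a
proof (induction "\<Sum>m\<le>N. \<Sum>i<m. a i" arbitrary: a rule: less_induct)
  case less
  show ?case
  proof (cases "a = b")
    case False
    then obtain c where c: "interlaced N c" "dominates a c" "dominates c b" "c \<noteq> a"
      "pair_shift a c \<or> box_move a c"
      using elementary_step_exists[OF less.prems(1) b less.prems(2,3)] by blast
    have le: "(\<Sum>i<m. c i) \<le> (\<Sum>i<m. a i)" for m
      using c(2) by (simp add: dominates_def)
    have total: "(\<Sum>i<N. c i) = (\<Sum>i<N. a i)"
      using c(3) le[of N] less.prems(3) by (metis dominates_def le_antisym)
    have "\<exists>m\<le>N. (\<Sum>i<m. c i) < (\<Sum>i<m. a i)"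
    proof (rule ccontr)
      assume "\<not> ?thesis"
      then have eq: "(\<Sum>i<m. c i) = (\<Sum>i<m. a i)" if "m \<le> N" for m
        using le[of m] that by (meson le_antisym not_le)
      have "c m = a m" for m
      proof (cases "m < N")
        case True
        then show ?thesis using eq[of m] eq[of "Suc m"] by simp
      next
        case False
        then show ?thesis using c(1) less.prems(1) by (simp add: interlaced_def)
      qed
      then show False using c(4) by auto
    qed
    then have "(\<Sum>m\<le>N. \<Sum>i<m. c i) < (\<Sum>m\<le>N. \<Sum>i<m. a i)"
      using le by (intro sum_strict_mono_ex1) auto
    then have "P c"
      by (rule less.hyps) (use c total less.prems(3) in auto)
    then show ?thesis
      using step[OF less.prems(1) c(1) total c(5)] by blast
  qed (simp add: refl)
qed

section \<open>Vanishing on the closure of an orbit\<close>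

lemma module_self: "Modules.module ((*) :: 'a::field \<Rightarrow> 'a \<Rightarrow> 'a)"
  by (simp add: Modules.module_def algebra_simps)

lemma module_fun_scale:
  assumes "Modules.module t"
  shows "Modules.module (fun_scale t)"
proof -
  interpret Modules.module t by fact
  show ?thesis
    by unfold_locales (simp_all add: fun_scale_def fun_eq_iff scale_right_distrib scale_left_distrib)
qed

lemma module_prod_scale_eq:
  assumes "Modules.module r" "Modules.module t"
  shows "module_prod.scale r t = (\<lambda>c w. (r c (fst w), t c (snd w)))"
proof -
  interpret module_prod r t
    using assms by (simp add: module_prod_def module_pair_def)
  show ?thesis
    by (simp add: fun_eq_iff scale_def)
qed

lemma module_module_prod_scale:
  assumes "Modules.module r" "Modules.module t"
  shows "Modules.module (module_prod.scale r t)"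
proof -
  interpret r: Modules.module r by fact
  interpret t: Modules.module t by fact
  show ?thesis
    unfolding module_prod_scale_eq[OF assms]
    by unfold_locales (simp_all add: r.scale_right_distrib r.scale_left_distrib
        t.scale_right_distrib t.scale_left_distrib)
qed

lemma polynomial_funs_linear_compose:
  assumes "f \<in> polynomial_funs s E" "linear_on_carrier s s E h" "h ` E \<subseteq> E"
  shows "(\<lambda>p. f (h p)) \<in> polynomial_funs s E"
  using assms(1)
proof induction
  case (linear f)
  then show ?case
    using assms(2,3) by (intro polynomial_funs.linear) (simp add: linear_on_carrier_def image_subset_iff)
next
  case (const c)
  show ?case by (rule polynomial_funs.const)
next
  case (add f g)
  show ?case by (rule polynomial_funs.add[OF add.IH])
next
  case (mult f g)
  show ?case by (rule polynomial_funs.mult[OF mult.IH])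
qed

lemma polynomial_funs_on_line:
  assumes f: "f \<in> polynomial_funs s E" and p: "p \<in> E" "q \<in> E" "\<And>t. s t q \<in> E"
  shows "\<exists>P. \<forall>t. f (p + s t q) = poly P t"
  using f
proof induction
  case (const c)
  show ?case by (rule exI[of _ "[:c:]"]) simp
next
  case (linear f)
  then have "f (p + s t q) = poly [:f p, f q:] t" for t
    using p by (simp add: linear_on_carrier_def)
  then show ?case by blast
next
  case (add f g)
  then obtain P Q where "\<forall>t. f (p + s t q) = poly P t" "\<forall>t. g (p + s t q) = poly Q t"
    by blast
  then show ?case by (intro exI[of _ "P + Q"]) simp
next
  case (mult f g)
  then obtain P Q where "\<forall>t. f (p + s t q) = poly P t" "\<forall>t. g (p + s t q) = poly Q t"
    by blast
  then show ?case by (intro exI[of _ "P * Q"]) simp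
qed

text \<open>On the line, \<open>f\<close> is a univariate polynomial with infinitely many zeros,
  hence identically zero; \<open>t = 0\<close> then gives the base point even if 0 lies in
  \<open>F\<close>.\<close>

lemma polynomial_funs_vanish_line:
  assumes "infinite (UNIV :: 'a::field set)" "finite F"
    and f: "f \<in> polynomial_funs (s :: 'a \<Rightarrow> _) E" and p: "p \<in> E" "q \<in> E" "\<And>t. s t q \<in> E"
    and vanish: "\<And>t. t \<notin> F \<Longrightarrow> f (p + s t q) = 0" and zero: "s 0 q = 0"
  shows "f p = 0"
proof -
  obtain P where P: "\<And>t. f (p + s t q) = poly P t"
    using polynomial_funs_on_line[OF f p] by blast
  have "- F \<subseteq> {t. poly P t = 0}"
    using vanish P by auto
  moreover have "infinite (- F)"
    using assms(1,2) by (simp add: Compl_eq_Diff_UNIV)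
  ultimately have "infinite {t. poly P t = 0}"
    using infinite_super by blast
  then have "P = 0"
    using poly_roots_finite by blast
  then show ?thesis
    using P[of 0] zero by simp
qed

section \<open>The ambient vector space of the exotic cone, closures and the embedding\<close>

context fin_dim_space
begin

definition W :: "('b \<times> ('b \<Rightarrow> 'a)) set" where
  "W = symp_space scale"

definition wscale :: "'a \<Rightarrow> 'b \<times> ('b \<Rightarrow> 'a) \<Rightarrow> 'b \<times> ('b \<Rightarrow> 'a)" where
  "wscale = symp_scale scale"

definition escale where
  "escale = module_prod.scale wscale (fun_scale wscale)"

definition ambient :: "(('b \<times> ('b \<Rightarrow> 'a)) \<times> ('a, 'b) symp_end) set" where
  "ambient = W \<times> symp_endos scale"

lemma module_wscale: "Modules.module wscale"
  unfolding wscale_def symp_scale_def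
  by (intro module_module_prod_scale module_fun_scale module_self module_axioms)

lemma wscale_eq: "wscale c w = (scale c (fst w), \<lambda>u. c * snd w u)"
  unfolding wscale_def symp_scale_def
    module_prod_scale_eq[OF module_axioms module_fun_scale[OF module_self]]
  by (simp add: fun_scale_def)

lemma escale_eq: "escale c p = (wscale c (fst p), \<lambda>w. wscale c (snd p w))"
  unfolding escale_def module_prod_scale_eq[OF module_wscale module_fun_scale[OF module_wscale]]
  by (simp add: fun_scale_def)

lemma mem_W_iff: "w \<in> W \<longleftrightarrow> Vector_Spaces.linear scale (*) (snd w)"
  by (cases w) (simp add: W_def symp_space_def dual_space_def)

lemma functional_iff:
  "Vector_Spaces.linear scale (*) f \<longleftrightarrow> (\<forall>u v. f (u + v) = f u + f v) \<and> (\<forall>c u. f (scale c u) = c * f u)"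
  by (simp add: Vector_Spaces.linear_iff vector_space_axioms vector_space_def algebra_simps)

lemma functional_0: "Vector_Spaces.linear scale (*) f \<Longrightarrow> f 0 = (0 :: 'a)"
  by (rule module_hom.zero[OF Vector_Spaces.linear.axioms(3)])

lemma W_zero: "0 \<in> W"
  and W_add: "w \<in> W \<Longrightarrow> w' \<in> W \<Longrightarrow> w + w' \<in> W"
  and W_scale: "w \<in> W \<Longrightarrow> wscale c w \<in> W"
  by (auto simp: mem_W_iff functional_iff wscale_eq algebra_simps)

lemma wscale_zero: "wscale c 0 = 0" "wscale 0 w = 0"
  using Modules.module.scale_zero_left[OF module_wscale] Modules.module.scale_zero_right[OF module_wscale] by auto

lemma wscale_add: "wscale c (w + w') = wscale c w + wscale c w'"
  using Modules.module.scale_right_distrib[OF module_wscale] .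

lemma wscale_wscale: "wscale c (wscale d w) = wscale (c * d) w"
  using Modules.module.scale_scale[OF module_wscale] .

lemma symp_endos_iff: "x \<in> symp_endos scale \<longleftrightarrow>
    (\<forall>w\<in>W. \<forall>w'\<in>W. x (w + w') = x w + x w') \<and> (\<forall>c. \<forall>w\<in>W. x (wscale c w) = wscale c (x w)) \<and>
    (\<forall>w\<in>W. x w \<in> W) \<and> (\<forall>w. w \<notin> W \<longrightarrow> x w = 0)"
  by (auto simp: symp_endos_def endos_def linear_on_carrier_def W_def wscale_def)

lemma exotic_cone_iff: "(w, x) \<in> exotic_cone scale \<longleftrightarrow> w \<in> W \<and> x \<in> symp_endos scale \<and>
    (\<exists>k. \<forall>w\<in>W. (x ^^ k) w = 0) \<and> (\<forall>w\<in>W. \<forall>w'\<in>W. symp_form (x w) w' = symp_form w (x w'))"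
  by (auto simp: exotic_cone_def selfadj_nilpotents_def nilpotent_on_def W_def)

lemma exotic_cone_subset_ambient: "exotic_cone scale \<subseteq> ambient"
  by (auto simp: exotic_cone_iff ambient_def)

lemma ambient_scale:
  assumes "p \<in> ambient"
  shows "escale c p \<in> ambient"
proof -
  have x: "snd p \<in> symp_endos scale" "fst p \<in> W"
    using assms by (auto simp: ambient_def)
  have "(\<lambda>w. wscale c (snd p w)) \<in> symp_endos scale"
    unfolding symp_endos_iff
  proof (intro conjI ballI allI impI)
    show "wscale c (snd p (w + w')) = wscale c (snd p w) + wscale c (snd p w')" if "w \<in> W" "w' \<in> W" for w w'
      using x(1) that by (simp add: symp_endos_iff wscale_add)
    show "wscale c (snd p (wscale d w)) = wscale d (wscale c (snd p w))" if "w \<in> W" for d w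
      using x(1) that by (simp add: symp_endos_iff wscale_wscale mult.commute)
    show "wscale c (snd p w) \<in> W" if "w \<in> W" for w
      using x(1) that by (simp add: symp_endos_iff W_scale)
    show "wscale c (snd p w) = 0" if "w \<notin> W" for w
    proof -
      have "snd p w = 0"
        using x(1) that unfolding symp_endos_iff by blast
      then show ?thesis by (simp only: wscale_zero)
    qed
  qed
  then show ?thesis
    using W_scale[OF x(2)] by (simp add: ambient_def escale_eq)
qed

text \<open>Closed sets are zero loci, so a point outside the closure is separated from
  \<open>S\<close> by a single polynomial function. The relative topology only adds membership in
  the cone.\<close>

lemma in_closure_iff:
  assumes "S \<subseteq> exotic_cone scale"
  shows "p \<in> exotic_zariski scale closure_of S \<longleftrightarrow> p \<in> exotic_cone scale \<and>
    (\<forall>f\<in>polynomial_funs escale ambient. (\<forall>q\<in>S. f q = 0) \<longrightarrow> f p = 0)"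
proof -
  have top: "exotic_zariski scale = subtopology (zariski escale ambient) (exotic_cone scale)"
    by (simp add: exotic_zariski_def escale_def wscale_def ambient_def W_def)
  have "S \<subseteq> ambient"
    using assms exotic_cone_subset_ambient by blast
  have eq: "p \<in> exotic_zariski scale closure_of S \<longleftrightarrow>
      p \<in> exotic_cone scale \<and> p \<in> zariski escale ambient closure_of S"
    unfolding top closure_of_subtopology using assms by (simp add: Int_absorb1)
  have "p \<in> zariski escale ambient closure_of S \<longleftrightarrow>
      (\<forall>f\<in>polynomial_funs escale ambient. (\<forall>q\<in>S. f q = 0) \<longrightarrow> f p = 0)"
    if p: "p \<in> ambient"
  proof
    assume cl: "p \<in> zariski escale ambient closure_of S"
    show "\<forall>f\<in>polynomial_funs escale ambient. (\<forall>q\<in>S. f q = 0) \<longrightarrow> f p = 0"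
    proof (intro ballI impI, rule ccontr)
      fix f assume f: "f \<in> polynomial_funs escale ambient" "\<forall>q\<in>S. f q = 0" "f p \<noteq> 0"
      let ?T = "ambient - {p \<in> ambient. \<forall>f\<in>{f}. f p = 0}"
      have "openin (zariski escale ambient) ?T"
        unfolding openin_zariski zariski_open_def
        by (rule exI[of _ "{f}"]) (use f(1) in simp)
      moreover have "p \<in> ?T"
        using p f(3) by simp
      moreover have "p \<in> ?T \<and> openin (zariski escale ambient) ?T \<longrightarrow> (\<exists>y. y \<in> S \<and> y \<in> ?T)"
        by (rule spec[OF conjunct2[OF cl[unfolded in_closure_of]]])
      ultimately obtain y where "y \<in> S" "y \<in> ?T"
        by blast
      then show False using f(2) by simp
    qed
  next
    assume *: "\<forall>f\<in>polynomial_funs escale ambient. (\<forall>q\<in>S. f q = 0) \<longrightarrow> f p = 0"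
    show "p \<in> zariski escale ambient closure_of S"
      unfolding in_closure_of
    proof (intro conjI allI impI)
      show "p \<in> topspace (zariski escale ambient)" using p by simp
      fix T assume T: "p \<in> T \<and> openin (zariski escale ambient) T"
      then obtain A where A: "A \<subseteq> polynomial_funs escale ambient"
        "T = ambient - {p \<in> ambient. \<forall>f\<in>A. f p = 0}"
        unfolding openin_zariski zariski_open_def by (elim conjE exE) (rule that)
      have "\<not> (\<forall>f\<in>A. f p = 0)"
        using T p unfolding A(2) by simp
      then obtain f where f: "f \<in> A" "f p \<noteq> 0"
        by auto
      then have "\<not> (\<forall>q\<in>S. f q = 0)"
        using bspec[OF * subsetD[OF A(1) f(1)]] by simp
      then obtain q where q: "q \<in> S" "f q \<noteq> 0"
        by auto
      have "q \<in> T"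
        unfolding A(2) using q f(1) \<open>S \<subseteq> ambient\<close> by auto
      then show "\<exists>y. y \<in> S \<and> y \<in> T"
        using q(1) by (intro exI[of _ q] conjI)
    qed
  qed
  then show ?thesis
    unfolding eq using subsetD[OF exotic_cone_subset_ambient, of p] by (intro conj_cong) simp_all
qed

definition embed_end :: "('b \<Rightarrow> 'b) \<Rightarrow> ('a, 'b) symp_end" where
  "embed_end x = (\<lambda>w. if w \<in> W then (x (fst w), snd w \<circ> x) else 0)"

lemma exotic_embed_eq: "exotic_embed scale (v, x) = ((v, 0), embed_end x)"
  by (auto simp: exotic_embed_def embed_end_def W_def fun_eq_iff)

lemma embed_end_mem: "lin x \<Longrightarrow> embed_end x \<in> symp_endos scale"
  unfolding symp_endos_iff
proof (intro conjI ballI allI impI)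
  assume x: "lin x"
  show "embed_end x (w + w') = embed_end x w + embed_end x w'" if "w \<in> W" "w' \<in> W" for w w'
    using that W_add[OF that] by (simp add: embed_end_def lin_add[OF x] fun_eq_iff)
  show "embed_end x (wscale c w) = wscale c (embed_end x w)" if "w \<in> W" for c w
    using that W_scale[OF that] by (simp add: embed_end_def wscale_eq lin_scale[OF x] fun_eq_iff)
  show "embed_end x w \<in> W" if "w \<in> W" for w
    using that by (simp add: embed_end_def mem_W_iff functional_iff lin_add[OF x] lin_scale[OF x])
qed (simp add: embed_end_def)

lemma embed_end_funpow:
  assumes x: "lin x" and w: "w \<in> W"
  shows "(embed_end x ^^ k) w = ((x ^^ k) (fst w), snd w \<circ> (x ^^ k))"
proof (induction k)
  case (Suc k)
  let ?z = "((x ^^ k) (fst w), snd w \<circ> (x ^^ k))"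
  have z: "?z \<in> W"
    using w by (simp add: mem_W_iff functional_iff lin_add[OF lin_funpow[OF x]] lin_scale[OF lin_funpow[OF x]])
  have "(embed_end x ^^ Suc k) w = embed_end x ((embed_end x ^^ k) w)"
    by simp
  also have "\<dots> = embed_end x ?z"
    by (simp only: Suc)
  also have "\<dots> = (x (fst ?z), snd ?z \<circ> x)"
    unfolding embed_end_def by (rule if_P[OF z])
  finally show ?case
    by (simp add: fun_eq_iff funpow_swap1)
qed (simp add: comp_def)

lemma exotic_embed_mem:
  assumes "x \<in> nilpotents scale"
  shows "exotic_embed scale (v, x) \<in> exotic_cone scale"
proof -
  obtain k where x: "lin x" and k: "\<And>u. (x ^^ k) u = 0"
    using assms by (auto simp: nilpotents_def nilpotent_on_def)
  have "(embed_end x ^^ k) w = 0" if "w \<in> W" for w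
  proof -
    have "snd w 0 = 0"
      using that functional_0 by (simp add: mem_W_iff)
    then show ?thesis
      by (simp add: embed_end_funpow[OF x that] k zero_prod_def zero_fun_def comp_def)
  qed
  moreover have "(v, 0) \<in> W"
    by (simp add: mem_W_iff functional_iff)
  moreover have "symp_form (embed_end x w) w' = symp_form w (embed_end x w')" if "w \<in> W" "w' \<in> W" for w w'
    using that by (simp add: symp_form_def embed_end_def case_prod_beta)
  ultimately show ?thesis
    unfolding exotic_embed_eq exotic_cone_iff using embed_end_mem[OF x] by blast
qed

section \<open>The action of the symplectic group\<close>

definition conjugate :: "('a, 'b) symp_end \<Rightarrow> ('a, 'b) symp_end \<Rightarrow> ('a, 'b) symp_end" where
  "conjugate g x = (\<lambda>u. if u \<in> W then g (x (inv_into W g u)) else 0)"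

lemma exotic_act_eq: "exotic_act scale g p = (g (fst p), conjugate g (snd p))"
  unfolding exotic_act_def conjugate_def W_def case_prod_beta by (rule refl)

lemma symplectic_group_iff: "g \<in> symplectic_group scale \<longleftrightarrow> g \<in> symp_endos scale \<and> bij_betw g W W \<and>
    (\<forall>w\<in>W. \<forall>w'\<in>W. symp_form (g w) (g w') = symp_form w w')"
  by (simp add: symplectic_group_def W_def)

lemma symp_endosD:
  assumes "x \<in> symp_endos scale"
  shows "w \<in> W \<Longrightarrow> w' \<in> W \<Longrightarrow> x (w + w') = x w + x w'"
    and "w \<in> W \<Longrightarrow> x (wscale c w) = wscale c (x w)"
    and "w \<in> W \<Longrightarrow> x w \<in> W"
    and "w \<notin> W \<Longrightarrow> x w = 0"
  using assms unfolding symp_endos_iff by blast+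

lemma symp_endos_funpow_mem:
  assumes "x \<in> symp_endos scale" "w \<in> W"
  shows "(x ^^ k) w \<in> W"
  by (induction k) (simp_all add: assms symp_endosD(3)[OF assms(1)])

lemma symplectic_groupD:
  assumes g: "g \<in> symplectic_group scale"
  shows "g \<in> symp_endos scale" and "w \<in> W \<Longrightarrow> inv_into W g w \<in> W"
    and "w \<in> W \<Longrightarrow> g (inv_into W g w) = w" and "w \<in> W \<Longrightarrow> inv_into W g (g w) = w"
    and "w \<in> W \<Longrightarrow> w' \<in> W \<Longrightarrow> symp_form (g w) (g w') = symp_form w w'"
proof -
  have *: "g \<in> symp_endos scale" "bij_betw g W W"
    "\<And>w w'. w \<in> W \<Longrightarrow> w' \<in> W \<Longrightarrow> symp_form (g w) (g w') = symp_form w w'"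
    using g unfolding symplectic_group_iff by blast+
  show "g \<in> symp_endos scale" by (rule *)
  have inj: "inj_on g W" and im: "g ` W = W"
    using *(2) by (auto simp: bij_betw_def)
  show "inv_into W g w \<in> W" if "w \<in> W"
    using inv_into_into[of w g W] that im by simp
  show "g (inv_into W g w) = w" if "w \<in> W"
    using f_inv_into_f[of w g W] that im by simp
  show "inv_into W g (g w) = w" if "w \<in> W"
    using inv_into_f_f[OF inj that] .
  show "symp_form (g w) (g w') = symp_form w w'" if "w \<in> W" "w' \<in> W"
    by (rule *(3)[OF that])
qed

lemma inv_symplectic:
  assumes g: "g \<in> symplectic_group scale"
  shows "w \<in> W \<Longrightarrow> w' \<in> W \<Longrightarrow> inv_into W g (w + w') = inv_into W g w + inv_into W g w'"
    and "w \<in> W \<Longrightarrow> inv_into W g (wscale c w) = wscale c (inv_into W g w)"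
proof -
  note gD = symplectic_groupD[OF g]
  note eD = symp_endosD[OF gD(1)]
  show "inv_into W g (w + w') = inv_into W g w + inv_into W g w'" if "w \<in> W" "w' \<in> W"
    using gD(4)[of "inv_into W g w + inv_into W g w'"] that by (simp add: W_add gD eD)
  show "inv_into W g (wscale c w) = wscale c (inv_into W g w)" if "w \<in> W"
    using gD(4)[of "wscale c (inv_into W g w)"] that by (simp add: W_scale gD eD)
qed

lemma conjugate_funpow:
  assumes g: "g \<in> symplectic_group scale" and x: "x \<in> symp_endos scale" and u: "u \<in> W"
  shows "(conjugate g x ^^ k) u = g ((x ^^ k) (inv_into W g u))"
proof (induction k)
  case (Suc k)
  let ?w = "(x ^^ k) (inv_into W g u)"
  have w: "?w \<in> W"
    by (intro symp_endos_funpow_mem x symplectic_groupD(2)[OF g] u)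
  have "(conjugate g x ^^ Suc k) u = conjugate g x (g ?w)"
    by (simp add: Suc)
  also have "\<dots> = g (x ?w)"
    using symp_endosD(3)[OF symplectic_groupD(1)[OF g] w]
    by (simp add: conjugate_def symplectic_groupD(4)[OF g w])
  finally show ?case by simp
qed (simp add: symplectic_groupD(3)[OF g u])

lemma conjugate_mem:
  assumes g: "g \<in> symplectic_group scale" and x: "x \<in> symp_endos scale"
  shows "conjugate g x \<in> symp_endos scale"
proof -
  note gD = symplectic_groupD[OF g]
  note eD = symp_endosD[OF gD(1)]
  note xD = symp_endosD[OF x]
  note iD = inv_symplectic[OF g]
  show ?thesis
    unfolding symp_endos_iff
  proof (intro conjI ballI allI impI)
    show "conjugate g x (w + w') = conjugate g x w + conjugate g x w'" if "w \<in> W" "w' \<in> W" for w w'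
      using that by (simp add: conjugate_def W_add iD gD(2) xD eD)
    show "conjugate g x (wscale c w) = wscale c (conjugate g x w)" if "w \<in> W" for c w
      using that by (simp add: conjugate_def W_scale iD gD(2) xD eD)
    show "conjugate g x w \<in> W" if "w \<in> W" for w
      using that by (simp add: conjugate_def gD(2) xD eD)
    show "conjugate g x w = 0" if "w \<notin> W" for w
      using that by (simp only: conjugate_def if_False)
  qed
qed

lemma exotic_act_mem_ambient:
  assumes g: "g \<in> symplectic_group scale" and p: "p \<in> ambient"
  shows "exotic_act scale g p \<in> ambient"
  using p conjugate_mem[OF g, of "snd p"] symp_endosD(3)[OF symplectic_groupD(1)[OF g], of "fst p"]
  by (simp add: exotic_act_eq ambient_def mem_Times_iff)

lemma exotic_act_linear:
  assumes g: "g \<in> symplectic_group scale"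
  shows "linear_on_carrier escale escale ambient (exotic_act scale g)"
proof -
  note gD = symplectic_groupD[OF g]
  note eD = symp_endosD[OF gD(1)]
  have mem: "fst p \<in> W" "\<And>w. w \<in> W \<Longrightarrow> snd p w \<in> W" if "p \<in> ambient" for p
    using that symp_endosD(3) by (auto simp: ambient_def)
  have "exotic_act scale g (p + q) = exotic_act scale g p + exotic_act scale g q"
    if "p \<in> ambient" "q \<in> ambient" for p q
  proof -
    have "conjugate g (snd (p + q)) = conjugate g (snd p) + conjugate g (snd q)"
      using mem(2)[OF that(1)] mem(2)[OF that(2)]
      by (intro ext) (simp add: conjugate_def gD(2) eD(1))
    then show ?thesis
      using mem(1)[OF that(1)] mem(1)[OF that(2)] by (simp add: exotic_act_eq eD(1))
  qed
  moreover have "exotic_act scale g (escale c p) = escale c (exotic_act scale g p)"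
    if "p \<in> ambient" for c p
  proof -
    have "conjugate g (\<lambda>w. wscale c (snd p w)) = (\<lambda>w. wscale c (conjugate g (snd p) w))"
      using mem(2)[OF that] by (intro ext) (simp add: conjugate_def gD(2) eD(2) wscale_zero)
    then show ?thesis
      using mem(1)[OF that] by (simp add: exotic_act_eq escale_eq eD(2))
  qed
  ultimately show ?thesis
    by (simp add: linear_on_carrier_def)
qed

lemma exotic_act_mem_cone:
  assumes g: "g \<in> symplectic_group scale" and p: "p \<in> exotic_cone scale"
  shows "exotic_act scale g p \<in> exotic_cone scale"
proof -
  obtain w x where wx: "p = (w, x)" by (cases p)
  obtain k where w: "w \<in> W" and x: "x \<in> symp_endos scale" and k: "\<And>w. w \<in> W \<Longrightarrow> (x ^^ k) w = 0"
    and adj: "\<And>w w'. w \<in> W \<Longrightarrow> w' \<in> W \<Longrightarrow> symp_form (x w) w' = symp_form w (x w')"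
    using p unfolding wx exotic_cone_iff by blast
  note gD = symplectic_groupD[OF g]
  note eD = symp_endosD[OF gD(1)]
  note xD = symp_endosD[OF x]
  have g0: "g 0 = 0"
    using eD(2)[OF W_zero, of 0] by (simp add: wscale_zero)
  have "(conjugate g x ^^ k) u = 0" if "u \<in> W" for u
    using that by (simp add: conjugate_funpow[OF g x that] k gD(2) g0)
  moreover have "symp_form (conjugate g x u) u' = symp_form u (conjugate g x u')"
    if "u \<in> W" "u' \<in> W" for u u'
  proof -
    let ?i = "inv_into W g"
    have i: "?i u \<in> W" "?i u' \<in> W"
      using that by (simp_all add: gD(2))
    have "symp_form (conjugate g x u) u' = symp_form (g (x (?i u))) (g (?i u'))"
      using that by (simp add: conjugate_def gD(3))
    also have "\<dots> = symp_form (?i u) (x (?i u'))"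
      using i by (simp add: gD(5) xD(3) adj)
    also have "\<dots> = symp_form (g (?i u)) (g (x (?i u')))"
      using i by (simp add: gD(5) xD(3))
    also have "\<dots> = symp_form u (conjugate g x u')"
      using that by (simp add: conjugate_def gD(3))
    finally show ?thesis .
  qed
  ultimately show ?thesis
    unfolding wx exotic_act_eq fst_conv snd_conv exotic_cone_iff
    using eD(3)[OF w] conjugate_mem[OF g x] by (intro conjI exI[of _ k]) simp_all
qed

lemma exotic_act_compose:
  assumes g: "g \<in> symplectic_group scale" and h: "h \<in> symplectic_group scale" and p: "p \<in> ambient"
  obtains k where "k \<in> symplectic_group scale"
    "exotic_act scale g (exotic_act scale h p) = exotic_act scale k p"
proof -
  define k where "k w = (if w \<in> W then g (h w) else 0)" for w
  note gD = symplectic_groupD[OF g]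
  note hD = symplectic_groupD[OF h]
  note egD = symp_endosD[OF gD(1)]
  note ehD = symp_endosD[OF hD(1)]
  have k_end: "k \<in> symp_endos scale"
    unfolding symp_endos_iff
  proof (intro conjI ballI allI impI)
    show "k (w + w') = k w + k w'" if "w \<in> W" "w' \<in> W" for w w'
      using that by (simp add: k_def W_add ehD egD)
    show "k (wscale c w) = wscale c (k w)" if "w \<in> W" for c w
      using that by (simp add: k_def W_scale ehD egD)
    show "k w \<in> W" if "w \<in> W" for w
      using that by (simp add: k_def ehD egD)
    show "k w = 0" if "w \<notin> W" for w
      using that by (simp only: k_def if_False)
  qed
  have inj: "inj_on k W"
  proof (rule inj_on_inverseI)
    show "inv_into W h (inv_into W g (k w)) = w" if "w \<in> W" for w
      using that by (simp add: k_def gD(4) hD(4) ehD(3))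
  qed
  have inv: "inv_into W k u = inv_into W h (inv_into W g u)" if "u \<in> W" for u
  proof (rule inv_into_f_eq[OF inj])
    show "inv_into W h (inv_into W g u) \<in> W"
      using that by (simp add: gD(2) hD(2))
    then show "k (inv_into W h (inv_into W g u)) = u"
      using that by (simp add: k_def gD hD)
  qed
  have "bij_betw k W W"
  proof (rule bij_betw_imageI[OF inj])
    show "k ` W = W"
    proof
      show "k ` W \<subseteq> W" using symp_endosD(3)[OF k_end] by auto
      show "W \<subseteq> k ` W"
      proof
        fix u assume u: "u \<in> W"
        have "k (inv_into W h (inv_into W g u)) = u"
          using u by (simp add: k_def gD hD)
        then show "u \<in> k ` W"
          using u gD(2) hD(2) by (metis image_eqI)
      qed
    qed
  qed
  then have k: "k \<in> symplectic_group scale"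
    unfolding symplectic_group_iff using k_end by (simp add: k_def gD(5) hD(5) ehD(3))
  have x: "snd p \<in> symp_endos scale" "fst p \<in> W"
    using p by (auto simp: ambient_def)
  have "conjugate g (conjugate h (snd p)) = conjugate k (snd p)"
  proof
    fix u
    show "conjugate g (conjugate h (snd p)) u = conjugate k (snd p) u"
    proof (cases "u \<in> W")
      case True
      have "snd p (inv_into W h (inv_into W g u)) \<in> W"
        using True by (simp add: symp_endosD(3)[OF x(1)] gD(2) hD(2))
      then show ?thesis
        using True by (simp add: conjugate_def inv gD(2) k_def)
    qed (simp add: conjugate_def)
  qed
  then have "exotic_act scale g (exotic_act scale h p) = exotic_act scale k p"
    using x(2) by (simp add: exotic_act_eq k_def)
  then show ?thesis using that k by blast
qed

lemma exotic_act_identity: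
  assumes "p \<in> ambient"
  obtains g where "g \<in> symplectic_group scale" "exotic_act scale g p = p"
proof -
  \<comment> \<open>The neutral element is the identity cut off outside \<open>W\<close>, because
    members of \<open>symp_endos\<close> vanish there.\<close>
  define g :: "('a, 'b) symp_end" where "g w = (if w \<in> W then w else 0)" for w
  have "g \<in> symp_endos scale"
    unfolding symp_endos_iff by (simp add: g_def W_add W_scale)
  moreover have inj: "inj_on g W" "g ` W = W"
    by (auto simp: inj_on_def g_def)
  ultimately have g: "g \<in> symplectic_group scale"
    unfolding symplectic_group_iff by (simp add: bij_betw_def g_def)
  have inv: "inv_into W g w = w" if "w \<in> W" for w
    using inv_into_f_f[OF inj(1) that] that by (simp add: g_def)
  have x: "snd p \<in> symp_endos scale" "fst p \<in> W"
    using assms by (auto simp: ambient_def)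
  have "conjugate g (snd p) = snd p"
  proof
    fix u show "conjugate g (snd p) u = snd p u"
      using symp_endosD(3,4)[OF x(1), of u] by (simp add: conjugate_def inv g_def)
  qed
  then have "exotic_act scale g p = p"
    using x(2) by (simp add: exotic_act_eq g_def)
  then show ?thesis using that g by blast
qed

lemma exotic_orbitI:
  assumes "p \<in> enhanced_orbit scale \<mu>\<nu>" "g \<in> symplectic_group scale"
  shows "exotic_act scale g (exotic_embed scale p) \<in> exotic_orbit scale \<mu>\<nu>"
  using assms unfolding exotic_orbit_def by blast

lemma enhanced_orbit_nilpotent: "(v, x) \<in> enhanced_orbit scale \<mu>\<nu> \<Longrightarrow> x \<in> nilpotents scale"
  by (cases \<mu>\<nu>) (simp add: enhanced_orbit_def)

lemma enhanced_orbit_embed_mem_cone: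
  "p \<in> enhanced_orbit scale \<mu>\<nu> \<Longrightarrow> exotic_embed scale p \<in> exotic_cone scale"
  by (cases p) (simp add: exotic_embed_mem enhanced_orbit_nilpotent)

lemma enhanced_orbit_embed_mem_orbit:
  assumes "p \<in> enhanced_orbit scale \<mu>\<nu>"
  shows "exotic_embed scale p \<in> exotic_orbit scale \<mu>\<nu>"
proof -
  have "exotic_embed scale p \<in> ambient"
    using enhanced_orbit_embed_mem_cone[OF assms] exotic_cone_subset_ambient by blast
  then obtain g where "g \<in> symplectic_group scale" "exotic_act scale g (exotic_embed scale p) = exotic_embed scale p"
    by (rule exotic_act_identity)
  then show ?thesis
    using exotic_orbitI[OF assms, of g] by simp
qed

lemma exotic_orbit_subset_cone: "exotic_orbit scale \<mu>\<nu> \<subseteq> exotic_cone scale"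
  unfolding exotic_orbit_def using exotic_act_mem_cone enhanced_orbit_embed_mem_cone by blast

lemma exotic_orbit_act:
  assumes g: "g \<in> symplectic_group scale" and q: "q \<in> exotic_orbit scale \<mu>\<nu>"
  shows "exotic_act scale g q \<in> exotic_orbit scale \<mu>\<nu>"
proof -
  obtain h p where h: "h \<in> symplectic_group scale" and p: "p \<in> enhanced_orbit scale \<mu>\<nu>"
    and q: "q = exotic_act scale h (exotic_embed scale p)"
    using q unfolding exotic_orbit_def by blast
  have "exotic_embed scale p \<in> ambient"
    using enhanced_orbit_embed_mem_cone[OF p] exotic_cone_subset_ambient by blast
  then obtain k where "k \<in> symplectic_group scale" "exotic_act scale g q = exotic_act scale k (exotic_embed scale p)"
    unfolding q by (rule exotic_act_compose[OF g h])
  then show ?thesis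
    using exotic_orbitI[OF p, of k] by simp
qed

text \<open>If \<open>f\<close> vanishes on the larger orbit, so does its composite with the action
  of \<open>g\<close>, which is again polynomial because \<open>g\<close> acts linearly on the
  ambient space. Hence embedded points decide the inclusion.\<close>

lemma exotic_orbit_subset_closureI:
  assumes "\<And>p. p \<in> enhanced_orbit scale \<rho>\<sigma> \<Longrightarrow>
    exotic_embed scale p \<in> exotic_zariski scale closure_of exotic_orbit scale \<mu>\<nu>"
  shows "exotic_orbit scale \<rho>\<sigma> \<subseteq> exotic_zariski scale closure_of exotic_orbit scale \<mu>\<nu>"
proof
  fix q assume "q \<in> exotic_orbit scale \<rho>\<sigma>"
  then obtain g p where g: "g \<in> symplectic_group scale" and p: "p \<in> enhanced_orbit scale \<rho>\<sigma>"
    and q: "q = exotic_act scale g (exotic_embed scale p)"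
    unfolding exotic_orbit_def by blast
  let ?e = "exotic_embed scale p"
  have e: "?e \<in> exotic_cone scale" "\<And>f. f \<in> polynomial_funs escale ambient \<Longrightarrow>
      \<forall>q\<in>exotic_orbit scale \<mu>\<nu>. f q = 0 \<Longrightarrow> f ?e = 0"
    using assms[OF p] unfolding in_closure_iff[OF exotic_orbit_subset_cone] by blast+
  have "f q = 0" if f: "f \<in> polynomial_funs escale ambient" "\<forall>q\<in>exotic_orbit scale \<mu>\<nu>. f q = 0" for f
    unfolding q
  proof (rule e(2)[of "\<lambda>p. f (exotic_act scale g p)"])
    show "(\<lambda>p. f (exotic_act scale g p)) \<in> polynomial_funs escale ambient"
      by (rule polynomial_funs_linear_compose[OF f(1) exotic_act_linear[OF g]])
        (use exotic_act_mem_ambient[OF g] in blast)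
    show "\<forall>q\<in>exotic_orbit scale \<mu>\<nu>. f (exotic_act scale g q) = 0"
      using f(2) exotic_orbit_act[OF g] by blast
  qed
  then show "q \<in> exotic_zariski scale closure_of exotic_orbit scale \<mu>\<nu>"
    unfolding in_closure_iff[OF exotic_orbit_subset_cone]
    using exotic_act_mem_cone[OF g e(1)] q by blast
qed

text \<open>Transposition is linear in the operator, so affine lines in V \<times> End V stay affine
  lines after embedding.\<close>

lemma exotic_embed_line:
  assumes x: "lin x" and E: "lin E"
  shows "exotic_embed scale (v + scale t v', \<lambda>u. x u + scale t (E u))
    = exotic_embed scale (v, x) + escale t (exotic_embed scale (v', E))"
proof -
  have "embed_end (\<lambda>u. x u + scale t (E u)) w = embed_end x w + wscale t (embed_end E w)" for w
  proof (cases "w \<in> W")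
    case True
    then show ?thesis
      by (simp add: embed_end_def wscale_eq fun_eq_iff mem_W_iff functional_iff)
  next
    case False
    then have "embed_end y w = 0" for y
      by (simp only: embed_end_def if_False)
    then show ?thesis by (simp only: wscale_zero add_0)
  qed
  then show ?thesis
    by (simp add: exotic_embed_eq escale_eq wscale_eq fun_eq_iff)
qed

lemma degenerates_to_in_closure:
  assumes inf: "infinite (UNIV :: 'a set)" and deg: "degenerates_to \<mu> \<nu> v x" and x: "x \<in> nilpotents scale"
  shows "exotic_embed scale (v, x) \<in> exotic_zariski scale closure_of exotic_orbit scale (\<mu>, \<nu>)"
proof -
  obtain v' E F where E: "lin E" and F: "finite F" and orb: "\<And>t. t \<notin> F \<Longrightarrow>
      (v + scale t v', \<lambda>u. x u + scale t (E u)) \<in> enhanced_orbit scale (\<mu>, \<nu>)"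
    using deg unfolding degenerates_to_def by blast
  have linx: "lin x"
    using x by (simp add: nilpotents_def)
  let ?p = "exotic_embed scale (v, x)" and ?q = "exotic_embed scale (v', E)"
  have p: "?p \<in> exotic_cone scale"
    by (rule exotic_embed_mem[OF x])
  have q: "?q \<in> ambient"
    using embed_end_mem[OF E] by (simp add: exotic_embed_eq ambient_def mem_W_iff functional_iff)
  have "f ?p = 0" if f: "f \<in> polynomial_funs escale ambient" "\<forall>q\<in>exotic_orbit scale (\<mu>, \<nu>). f q = 0" for f
  proof (rule polynomial_funs_vanish_line[OF inf F f(1) _ q])
    show "?p \<in> ambient" using p exotic_cone_subset_ambient by blast
    show "escale t ?q \<in> ambient" for t by (rule ambient_scale[OF q])
    show "f (?p + escale t ?q) = 0" if "t \<notin> F" for t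
      using f(2) enhanced_orbit_embed_mem_orbit[OF orb[OF that]]
      unfolding exotic_embed_line[OF linx E] by blast
    show "escale 0 ?q = 0"
      by (simp add: escale_eq wscale_zero zero_prod_def zero_fun_def)
  qed
  then show ?thesis
    unfolding in_closure_iff[OF exotic_orbit_subset_cone] using p by blast
qed

lemma exotic_closure_trans:
  assumes "exotic_orbit scale a \<subseteq> exotic_zariski scale closure_of exotic_orbit scale b"
    "exotic_orbit scale b \<subseteq> exotic_zariski scale closure_of exotic_orbit scale c"
  shows "exotic_orbit scale a \<subseteq> exotic_zariski scale closure_of exotic_orbit scale c"
  by (rule order_trans[OF assms(1) closure_of_minimal[OF assms(2) closedin_closure_of]])

end

section \<open>Interleaved bipartitions, and dominance implies inclusion of closures\<close>

definition weave :: "(nat \<Rightarrow> nat) \<Rightarrow> (nat \<Rightarrow> nat) \<Rightarrow> nat \<Rightarrow> nat" where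
  "weave \<mu> \<nu> i = (if even i then \<mu> (i div 2) else \<nu> (i div 2))"

lemma weave_even: "weave \<mu> \<nu> (2 * k) = \<mu> k"
  and weave_odd: "weave \<mu> \<nu> (Suc (2 * k)) = \<nu> k"
  by (simp_all add: weave_def)

lemma sum_even_length: "(\<Sum>i<2 * k. a i) = (\<Sum>i<k. a (2 * i) + a (Suc (2 * i)))"
  for a :: "nat \<Rightarrow> nat"
  by (induction k) simp_all

text \<open>The first family of inequalities consists of the partial sums of even length, the second
  of those of odd length.\<close>

lemma bipartition_le_iff_dominates:
  "bipartition_le (\<rho>, \<sigma>) (\<mu>, \<nu>) \<longleftrightarrow> dominates (weave \<mu> \<nu>) (weave \<rho> \<sigma>)"
proof
  assume le: "bipartition_le (\<rho>, \<sigma>) (\<mu>, \<nu>)"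
  show "dominates (weave \<mu> \<nu>) (weave \<rho> \<sigma>)"
    unfolding dominates_def
  proof
    fix m
    show "(\<Sum>i<m. weave \<rho> \<sigma> i) \<le> (\<Sum>i<m. weave \<mu> \<nu> i)"
    proof (cases "even m")
      case True
      then obtain k where "m = 2 * k" by (rule evenE)
      then show ?thesis
        using le by (simp add: sum_even_length weave_even weave_odd bipartition_le_def)
    next
      case False
      then obtain k where "m = Suc (2 * k)"
        by (metis Suc_eq_plus1 oddE)
      then show ?thesis
        using le by (simp add: sum_even_length weave_even weave_odd bipartition_le_def)
    qed
  qed
next
  assume dom: "dominates (weave \<mu> \<nu>) (weave \<rho> \<sigma>)"
  have "(\<Sum>i<2 * k. weave \<rho> \<sigma> i) \<le> (\<Sum>i<2 * k. weave \<mu> \<nu> i)"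
    "(\<Sum>i<Suc (2 * k). weave \<rho> \<sigma> i) \<le> (\<Sum>i<Suc (2 * k). weave \<mu> \<nu> i)" for k
    using dom unfolding dominates_def by blast+
  then show "bipartition_le (\<rho>, \<sigma>) (\<mu>, \<nu>)"
    by (simp add: sum_even_length weave_even weave_odd bipartition_le_def)
qed

lemma interlaced_weave:
  assumes "padded_bipartition n \<mu> \<nu>"
  shows "interlaced (2 * n) (weave \<mu> \<nu>)" "(\<Sum>i<2 * n. weave \<mu> \<nu> i) = n"
proof -
  have anti: "antimono \<mu>" "antimono \<nu>" and pad: "\<And>i. n \<le> i \<Longrightarrow> \<mu> i = 0 \<and> \<nu> i = 0"
    and size: "(\<Sum>i<n. \<mu> i + \<nu> i) = n"
    using assms unfolding padded_bipartition_def by blast+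
  show "interlaced (2 * n) (weave \<mu> \<nu>)"
    unfolding interlaced_def
  proof (intro conjI allI impI)
    fix i
    show "weave \<mu> \<nu> (Suc (Suc i)) \<le> weave \<mu> \<nu> i"
      using antimonoD[OF anti(1), of "i div 2" "Suc (i div 2)"] antimonoD[OF anti(2), of "i div 2" "Suc (i div 2)"]
      by (simp add: weave_def)
    assume "2 * n \<le> i"
    then have "n \<le> i div 2" by linarith
    then show "weave \<mu> \<nu> i = 0"
      using pad by (simp add: weave_def)
  qed
  show "(\<Sum>i<2 * n. weave \<mu> \<nu> i) = n"
    using size by (simp add: sum_even_length weave_even weave_odd)
qed

lemma padded_bipartition_unweave:
  assumes a: "interlaced (2 * n) a" and total: "(\<Sum>i<2 * n. a i) = n"
  shows "padded_bipartition n (\<lambda>i. a (2 * i)) (\<lambda>i. a (Suc (2 * i)))"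
proof -
  have step: "a (Suc (Suc i)) \<le> a i" and zero: "2 * n \<le> i \<Longrightarrow> a i = 0" for i
    using a by (simp_all add: interlaced_def)
  have "antimono (\<lambda>i. a (2 * i))" "antimono (\<lambda>i. a (Suc (2 * i)))"
    unfolding antimono_iff_le_Suc using step by simp_all
  then show ?thesis
    using zero total by (simp add: padded_bipartition_def sum_even_length)
qed

context fin_dim_space
begin

text \<open>Pairs at even indices are the row lengths of \<open>x\<close>, so such a shift moves
  only \<open>v\<close>; pairs at odd indices are the row lengths of the quotient by the cyclic
  submodule of \<open>v\<close>. For a box move, the parity of p tells which of the two partitions
  changes.\<close>

lemma elementary_step_closure:
  assumes inf: "infinite (UNIV :: 'a set)"
    and a: "interlaced (2 * card Basis) a" "(\<Sum>i<2 * card Basis. a i) = card Basis"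
    and c: "interlaced (2 * card Basis) c" "(\<Sum>i<2 * card Basis. c i) = card Basis"
    and step: "pair_shift a c \<or> box_move a c"
  shows "exotic_orbit scale (\<lambda>i. c (2 * i), \<lambda>i. c (Suc (2 * i)))
    \<subseteq> exotic_zariski scale closure_of exotic_orbit scale (\<lambda>i. a (2 * i), \<lambda>i. a (Suc (2 * i)))"
proof (rule exotic_orbit_subset_closureI)
  note bip = padded_bipartition_unweave[OF a] padded_bipartition_unweave[OF c]
  fix p assume p: "p \<in> enhanced_orbit scale (\<lambda>i. c (2 * i), \<lambda>i. c (Suc (2 * i)))"
  obtain v x where vx: "p = (v, x)" by (cases p)
  note orb = p[unfolded vx]
  have "degenerates_to (\<lambda>i. a (2 * i)) (\<lambda>i. a (Suc (2 * i))) v x"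
    using step
  proof
    assume "pair_shift a c"
    then obtain e where e: "e = 0 \<or> e = 1" "e = 1 \<Longrightarrow> c 0 = a 0" and
      le: "\<And>k. c (2 * k + e) \<le> a (2 * k + e)" and
      eq: "\<And>k. c (2 * k + e) + c (Suc (2 * k + e)) = a (2 * k + e) + a (Suc (2 * k + e))"
      unfolding pair_shift_def by blast
    from e(1) show ?thesis
    proof
      assume e0: "e = 0"
      show ?thesis
        by (rule degenerates_decrease_mu[OF bip _ _ orb])
          (use le eq in \<open>simp_all add: e0\<close>)
    next
      assume e1: "e = 1"
      have eq': "c (Suc (2 * k)) + c (Suc (Suc (2 * k))) = a (Suc (2 * k)) + a (Suc (Suc (2 * k)))"
        and le': "c (Suc (2 * k)) \<le> a (Suc (2 * k))" for k
        using eq[of k] le[of k] by (simp_all add: e1)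
      show ?thesis
      proof (rule degenerates_increase_mu[OF bip _ _ _ orb])
        show "c (2 * 0) = a (2 * 0)" using e(2) e1 by simp
        show "c (Suc (2 * i)) + c (2 * Suc i) = a (Suc (2 * i)) + a (2 * Suc i)" for i
          using eq'[of i] by simp
        show "a (2 * i) \<le> c (2 * i)" for i
        proof (cases i)
          case 0
          then show ?thesis using e(2) e1 by simp
        next
          case (Suc k)
          then show ?thesis using eq'[of k] le'[of k] by simp
        qed
      qed
    qed
  next
    assume "box_move a c"
    then obtain p q where pq: "p < q" "even (q - p)" "a p = Suc (c p)" "c q = Suc (a q)"
      "\<And>i. i \<noteq> p \<Longrightarrow> i \<noteq> q \<Longrightarrow> c i = a i"
      unfolding box_move_def by blast
    have parity: "even p \<longleftrightarrow> even q"
      using pq(1,2) by simp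
    show ?thesis
    proof (cases "even p")
      case True
      obtain p' where p': "p = 2 * p'" using True by (rule evenE)
      obtain q' where q': "q = 2 * q'" using True parity by (auto elim: evenE)
      have "(\<lambda>i. c (Suc (2 * i))) = (\<lambda>i. a (Suc (2 * i)))"
      proof
        fix i show "c (Suc (2 * i)) = a (Suc (2 * i))"
        proof (rule pq(5))
          show "Suc (2 * i) \<noteq> p" "Suc (2 * i) \<noteq> q" unfolding p' q' by presburger+
        qed
      qed
      note bip' = bip[unfolded this] and orb' = orb[unfolded this]
      show ?thesis
      proof (rule degenerates_move_mu[OF bip' _ _ _ _ orb'])
        show "p' < q'" using pq(1) p' q' by simp
      qed (use pq(3-5) p' q' in simp_all)
    next
      case False
      obtain p' where p': "p = Suc (2 * p')" using False by (metis Suc_eq_plus1 oddE)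
      obtain q' where q': "q = Suc (2 * q')" using False parity by (metis Suc_eq_plus1 oddE)
      have "(\<lambda>i. c (2 * i)) = (\<lambda>i. a (2 * i))"
      proof
        fix i show "c (2 * i) = a (2 * i)"
        proof (rule pq(5))
          show "2 * i \<noteq> p" "2 * i \<noteq> q" unfolding p' q' by presburger+
        qed
      qed
      note bip' = bip[unfolded this] and orb' = orb[unfolded this]
      show ?thesis
      proof (rule degenerates_move_nu[OF bip' _ _ _ _ orb'])
        show "p' < q'" using pq(1) p' q' by simp
      qed (use pq(3-5) p' q' in simp_all)
    qed
  qed
  then show "exotic_embed scale p \<in> exotic_zariski scale closure_of
      exotic_orbit scale (\<lambda>i. a (2 * i), \<lambda>i. a (Suc (2 * i)))"
    unfolding vx by (rule degenerates_to_in_closure[OF inf _ enhanced_orbit_nilpotent[OF orb]])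
qed

lemma exotic_orbit_subset_closure:
  assumes inf: "infinite (UNIV :: 'a set)"
    and bip: "padded_bipartition (card Basis) \<rho> \<sigma>" "padded_bipartition (card Basis) \<mu> \<nu>"
    and le: "bipartition_le (\<rho>, \<sigma>) (\<mu>, \<nu>)"
  shows "exotic_orbit scale (\<rho>, \<sigma>) \<subseteq> exotic_zariski scale closure_of exotic_orbit scale (\<mu>, \<nu>)"
proof -
  let ?N = "2 * card Basis"
  \<comment> \<open>The induction only compares totals of successive sequences. Carrying the value
    of the total inside \<open>P\<close> makes every intermediate sequence unweave to a bipartition
    of the dimension.\<close>
  define P where "P a \<longleftrightarrow> ((\<Sum>i<?N. a i) = card Basis \<longrightarrow> exotic_orbit scale (\<rho>, \<sigma>) \<subseteq>
    exotic_zariski scale closure_of exotic_orbit scale (\<lambda>i. a (2 * i), \<lambda>i. a (Suc (2 * i))))" for a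
  have "P (weave \<mu> \<nu>)"
  proof (rule dominance_induct[of P "weave \<rho> \<sigma>" ?N])
    have "topspace (exotic_zariski scale) = exotic_cone scale"
      using exotic_cone_subset_ambient
      by (auto simp: exotic_zariski_def ambient_def W_def)
    then show "P (weave \<rho> \<sigma>)"
      unfolding P_def weave_even weave_odd
      by (intro impI closure_of_subset) (simp add: exotic_orbit_subset_cone)
  next
    fix a c
    assume *: "interlaced ?N a" "interlaced ?N c" "(\<Sum>i<?N. c i) = (\<Sum>i<?N. a i)"
      "pair_shift a c \<or> box_move a c" "P c"
    show "P a"
      unfolding P_def
    proof
      assume total: "(\<Sum>i<?N. a i) = card Basis"
      then have "exotic_orbit scale (\<rho>, \<sigma>) \<subseteq> exotic_zariski scale closure_of
          exotic_orbit scale (\<lambda>i. c (2 * i), \<lambda>i. c (Suc (2 * i)))"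
        using *(3,5) by (simp add: P_def)
      then show "exotic_orbit scale (\<rho>, \<sigma>) \<subseteq> exotic_zariski scale closure_of
          exotic_orbit scale (\<lambda>i. a (2 * i), \<lambda>i. a (Suc (2 * i)))"
        by (rule exotic_closure_trans)
          (use elementary_step_closure[OF inf *(1) total *(2) _ *(4)] *(3) total in simp)
    qed
  qed (use interlaced_weave[OF bip(1)] interlaced_weave[OF bip(2)] le in
      \<open>simp_all add: bipartition_le_iff_dominates\<close>)
  then show ?thesis
    using interlaced_weave(2)[OF bip(2)] by (simp add: P_def weave_even weave_odd)
qed

end

section \<open>Closed rank conditions\<close>

text \<open>A matrix that factors through dimension K < r is singular. Both factors are padded to
  squares; column K of the first is then 0, so it kills the unit vector K.\<close>

lemma det_eq_0_if_factors:
  fixes P Q :: "nat \<Rightarrow> nat \<Rightarrow> 'a::field"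
  assumes "K < r"
  shows "det (mat r r (\<lambda>(i, j). \<Sum>k<K. P i k * Q k j)) = 0"
proof -
  define P' where "P' = mat r r (\<lambda>(i, k). if k < K then P i k else 0)"
  define Q' where "Q' = mat r r (\<lambda>(k, j). Q k j)"
  have carrier: "P' \<in> carrier_mat r r" "Q' \<in> carrier_mat r r"
    by (simp_all add: P'_def Q'_def)
  have "mat r r (\<lambda>(i, j). \<Sum>k<K. P i k * Q k j) = P' * Q'"
  proof (rule eq_matI)
    fix i j assume "i < dim_row (P' * Q')" "j < dim_col (P' * Q')"
    then have ij: "i < r" "j < r"
      by (simp_all add: P'_def Q'_def)
    have "(P' * Q') $$ (i, j) = (\<Sum>k = 0..<r. (if k < K then P i k else 0) * Q k j)"
      using ij by (simp add: P'_def Q'_def scalar_prod_def)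
    also have "\<dots> = (\<Sum>k<K. P i k * Q k j)"
      using assms by (intro sum.mono_neutral_cong_right) auto
    finally show "mat r r (\<lambda>(i, j). \<Sum>k<K. P i k * Q k j) $$ (i, j) = (P' * Q') $$ (i, j)"
      using ij by simp
  qed (simp_all add: P'_def Q'_def)
  moreover have "det P' = 0"
  proof -
    have "P' *\<^sub>v unit_vec r K = 0\<^sub>v r"
    proof (rule eq_vecI)
      fix i assume "i < dim_vec (0\<^sub>v r :: 'a vec)"
      then have i: "i < r" by simp
      then have "(P' *\<^sub>v unit_vec r K) $ i = row P' i \<bullet> unit_vec r K"
        by (simp add: P'_def)
      also have "\<dots> = row P' i $ K"
        using assms i by (intro scalar_prod_right_unit) (simp_all add: P'_def)
      finally show "(P' *\<^sub>v unit_vec r K) $ i = 0\<^sub>v r $ i"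
        using assms i by (simp add: P'_def)
    qed (simp add: P'_def)
    moreover have "unit_vec r K \<noteq> (0\<^sub>v r :: 'a vec)"
    proof
      assume "unit_vec r K = (0\<^sub>v r :: 'a vec)"
      then have "unit_vec r K $ K = (0\<^sub>v r :: 'a vec) $ K" by simp
      then show False using assms by simp
    qed
    ultimately show ?thesis
      unfolding det_0_iff_vec_prod_zero_field[OF carrier(1)] using unit_vec_carrier by blast
  qed
  ultimately show ?thesis
    by (simp add: det_mult[OF carrier])
qed

lemma sum_lessThan_double: "(\<Sum>k<d + e. f k) = (\<Sum>k<d. f k) + (\<Sum>k<e. f (d + k))"
  for f :: "nat \<Rightarrow> 'a::comm_monoid_add"
  by (induction e) (simp_all add: add.assoc)

context fin_dim_space
begin

text \<open>
  A member of \<open>polynomial_funs\<close> is only meaningful on the ambient space, but it is a function on the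
  whole type.
\<close>

definition poly_on :: "((('b \<times> ('b \<Rightarrow> 'a)) \<times> ('a, 'b) symp_end) \<Rightarrow> 'a) \<Rightarrow> bool" where
  "poly_on g \<longleftrightarrow> (\<exists>f\<in>polynomial_funs escale ambient. \<forall>p\<in>ambient. f p = g p)"

lemma poly_on_const: "poly_on (\<lambda>_. c)"
  unfolding poly_on_def by (intro bexI[of _ "\<lambda>_. c"] polynomial_funs.const) simp

lemma poly_on_linear: "linear_on_carrier escale (*) ambient f \<Longrightarrow> poly_on f"
  unfolding poly_on_def by (intro bexI[of _ f] polynomial_funs.linear) simp_all

lemma poly_on_add:
  assumes "poly_on f" "poly_on g"
  shows "poly_on (\<lambda>p. f p + g p)"
proof -
  obtain f' g' where "f' \<in> polynomial_funs escale ambient" "\<forall>p\<in>ambient. f' p = f p"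
    "g' \<in> polynomial_funs escale ambient" "\<forall>p\<in>ambient. g' p = g p"
    using assms unfolding poly_on_def by blast
  then show ?thesis
    unfolding poly_on_def by (intro bexI[of _ "\<lambda>p. f' p + g' p"] polynomial_funs.add) simp_all
qed

lemma poly_on_mult:
  assumes "poly_on f" "poly_on g"
  shows "poly_on (\<lambda>p. f p * g p)"
proof -
  obtain f' g' where "f' \<in> polynomial_funs escale ambient" "\<forall>p\<in>ambient. f' p = f p"
    "g' \<in> polynomial_funs escale ambient" "\<forall>p\<in>ambient. g' p = g p"
    using assms unfolding poly_on_def by blast
  then show ?thesis
    unfolding poly_on_def by (intro bexI[of _ "\<lambda>p. f' p * g' p"] polynomial_funs.mult) simp_all
qed

lemma poly_on_diff:
  assumes "poly_on f" "poly_on g"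
  shows "poly_on (\<lambda>p. f p - g p)"
proof -
  have "poly_on (\<lambda>p. f p + - 1 * g p)"
    by (intro poly_on_add poly_on_mult poly_on_const assms)
  then show ?thesis by simp
qed

lemma poly_on_sum: "(\<And>i. i \<in> A \<Longrightarrow> poly_on (f i)) \<Longrightarrow> poly_on (\<lambda>p. \<Sum>i\<in>A. f i p)"
  by (induction A rule: infinite_finite_induct) (simp_all add: poly_on_const poly_on_add)

lemma poly_on_prod: "(\<And>i. i \<in> A \<Longrightarrow> poly_on (f i)) \<Longrightarrow> poly_on (\<lambda>p. \<Prod>i\<in>A. f i p)"
  by (induction A rule: infinite_finite_induct) (simp_all add: poly_on_const poly_on_mult)

lemma poly_on_cong: "poly_on f \<Longrightarrow> (\<And>p. p \<in> ambient \<Longrightarrow> f p = g p) \<Longrightarrow> poly_on g"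
  unfolding poly_on_def by simp

text \<open>The Leibniz formula expresses the determinant as a polynomial in the entries.\<close>

lemma poly_on_det:
  assumes "\<And>i j. i < r \<Longrightarrow> j < r \<Longrightarrow> poly_on (f i j)"
  shows "poly_on (\<lambda>p. det (mat r r (\<lambda>(i, j). f i j p)))"
proof -
  have "det (mat r r (\<lambda>(i, j). f i j p)) =
      (\<Sum>\<pi> | \<pi> permutes {0..<r}. signof \<pi> * (\<Prod>i = 0..<r. f i (\<pi> i) p))" for p
  proof -
    have "(\<Prod>i = 0..<r. mat r r (\<lambda>(i, j). f i j p) $$ (i, \<pi> i)) = (\<Prod>i = 0..<r. f i (\<pi> i) p)"
      if "\<pi> permutes {0..<r}" for \<pi>
      by (intro prod.cong refl) (use permutes_in_image[OF that] in auto)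
    then show ?thesis
      by (subst det_def'[of _ r]) (auto intro: sum.cong)
  qed
  moreover have "poly_on (\<lambda>p. \<Sum>\<pi> | \<pi> permutes {0..<r}. signof \<pi> * (\<Prod>i = 0..<r. f i (\<pi> i) p))"
  proof (intro poly_on_sum poly_on_mult poly_on_const poly_on_prod)
    fix \<pi> i assume "\<pi> \<in> {\<pi>. \<pi> permutes {0..<r}}" "i \<in> {0..<r}"
    then have "i < r" "\<pi> i < r"
      using permutes_in_image[of \<pi> "{0..<r}" i] by auto
    then show "poly_on (f i (\<pi> i))" by (rule assms)
  qed
  ultimately show ?thesis by simp
qed

lemma functional_sum:
  assumes l: "linear_on_carrier wscale (*) W l" and A: "\<And>i. i \<in> A \<Longrightarrow> f i \<in> W"
  shows "sum f A \<in> W \<and> l (sum f A) = (\<Sum>i\<in>A. l (f i))"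
proof -
  have l0: "l 0 = 0"
  proof -
    have "l (wscale 0 0) = 0 * l 0"
      using l W_zero by (simp only: linear_on_carrier_def)
    then show ?thesis by (simp add: wscale_zero)
  qed
  show ?thesis
    using A
  proof (induction A rule: infinite_finite_induct)
    case (insert i A)
    then have "sum f A \<in> W" "l (sum f A) = (\<Sum>i\<in>A. l (f i))" "f i \<in> W"
      by auto
    then show ?case
      using insert.hyps l by (simp add: W_add linear_on_carrier_def)
  qed (simp_all add: l0 W_zero)
qed

lemma rep_functional: "Vector_Spaces.linear scale (*) (\<lambda>v. representation Basis v b)"
  by (simp add: functional_iff representation_add representation_scale independent_Basis span_Basis)

text \<open>The basis vectors and their coordinate functionals together span \<open>W\<close>; a
  functional has its value at b as coefficient at the coordinate functional of b.\<close>

lemma W_expand: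
  assumes w: "w \<in> W"
  shows "w = (\<Sum>b\<in>Basis. wscale (representation Basis (fst w) b) (b, 0)
    + wscale (snd w b) (0, \<lambda>v. representation Basis v b))"
proof -
  have fst_sum: "fst (sum f A) = (\<Sum>i\<in>A. fst (f i))" and snd_sum: "snd (sum f A) v = (\<Sum>i\<in>A. snd (f i) v)"
    for f :: "'b \<Rightarrow> 'b \<times> ('b \<Rightarrow> 'a)" and A v
    by (induction A rule: infinite_finite_induct) simp_all
  have rep: "(\<Sum>b\<in>Basis. scale (representation Basis v b) b) = v" for v
    by (rule sum_representation_eq[OF independent_Basis _ finite_Basis subset_refl]) (simp add: span_Basis)
  have f: "snd w (u + v) = snd w u + snd w v" "snd w (scale c u) = c * snd w u" for u v c
    using w by (simp_all add: mem_W_iff functional_iff)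
  have f0: "snd w 0 = 0"
    using w by (simp add: mem_W_iff functional_0)
  have f_sum: "snd w (sum g A) = (\<Sum>i\<in>A. snd w (g i))" for g :: "'b \<Rightarrow> 'b" and A
    by (induction A rule: infinite_finite_induct) (simp_all add: f f0)
  have expand: "snd w v = (\<Sum>b\<in>Basis. snd w b * representation Basis v b)" for v
  proof -
    have "snd w v = snd w (\<Sum>b\<in>Basis. scale (representation Basis v b) b)"
      by (simp only: rep)
    also have "\<dots> = (\<Sum>b\<in>Basis. snd w b * representation Basis v b)"
      unfolding f_sum f by (simp only: mult.commute)
    finally show ?thesis .
  qed
  show ?thesis
  proof (rule prod_eqI)
    show "fst w = fst (\<Sum>b\<in>Basis. wscale (representation Basis (fst w) b) (b, 0)
        + wscale (snd w b) (0, \<lambda>v. representation Basis v b))"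
      by (simp add: fst_sum wscale_eq rep)
    show "snd w = snd (\<Sum>b\<in>Basis. wscale (representation Basis (fst w) b) (b, 0)
        + wscale (snd w b) (0, \<lambda>v. representation Basis v b))"
    proof
      fix v
      have "snd (\<Sum>b\<in>Basis. wscale (representation Basis (fst w) b) (b, 0)
          + wscale (snd w b) (0, \<lambda>v. representation Basis v b)) v
        = (\<Sum>b\<in>Basis. snd w b * representation Basis v b)"
        by (simp add: snd_sum wscale_eq)
      then show "snd w v = snd (\<Sum>b\<in>Basis. wscale (representation Basis (fst w) b) (b, 0)
          + wscale (snd w b) (0, \<lambda>v. representation Basis v b)) v"
        unfolding expand[of v] by (rule sym)
    qed
  qed
qed

text \<open>The value \<open>snd p (z p)\<close> is bilinear in the operator and the vector.
  Expanding \<open>z p\<close> in fixed vectors of \<open>W\<close> gives products of coordinates of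
  \<open>z p\<close> with linear functions of p. All functionals \<open>l\<close> are covered at
  once so that the argument can be iterated for powers.\<close>

lemma poly_on_apply:
  assumes z: "\<And>p. p \<in> ambient \<Longrightarrow> z p \<in> W"
    and pol: "\<And>l. linear_on_carrier wscale (*) W l \<Longrightarrow> poly_on (\<lambda>p. l (z p))"
    and l: "linear_on_carrier wscale (*) W l"
  shows "poly_on (\<lambda>p. l (snd p (z p)))"
proof -
  let ?r = "\<lambda>b v. representation Basis v b"
  have basis: "(b, 0) \<in> W" "(0, ?r b) \<in> W" for b
    using rep_functional by (simp_all add: mem_W_iff functional_iff)
  have entry: "poly_on (\<lambda>p. l (snd p w))" if w: "w \<in> W" for w
  proof (rule poly_on_linear)
    show "linear_on_carrier escale (*) ambient (\<lambda>p. l (snd p w))"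
      using l w by (auto simp: linear_on_carrier_def ambient_def escale_eq symp_endos_iff)
  qed
  have "linear_on_carrier wscale (*) W (\<lambda>w. ?r b (fst w))" "linear_on_carrier wscale (*) W (\<lambda>w. snd w b)" for b
    using rep_functional[of b] by (simp_all add: linear_on_carrier_def wscale_eq functional_iff)
  then have "poly_on (\<lambda>p. \<Sum>b\<in>Basis. ?r b (fst (z p)) * l (snd p (b, 0)) + snd (z p) b * l (snd p (0, ?r b)))"
    by (intro poly_on_sum poly_on_add poly_on_mult entry basis) (rule pol; simp)+
  then show ?thesis
  proof (rule poly_on_cong)
    fix p assume p: "p \<in> ambient"
    then have x: "snd p \<in> symp_endos scale" by (auto simp: ambient_def)
    note xD = symp_endosD[OF x]
    let ?l = "\<lambda>w. l (snd p w)"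
    have lin: "linear_on_carrier wscale (*) W ?l"
      using l by (simp add: linear_on_carrier_def xD)
    have "?l (z p) = ?l (\<Sum>b\<in>Basis. wscale (?r b (fst (z p))) (b, 0) + wscale (snd (z p) b) (0, ?r b))"
      by (subst W_expand[OF z[OF p]]) (rule refl)
    also have "\<dots> = (\<Sum>b\<in>Basis. ?l (wscale (?r b (fst (z p))) (b, 0) + wscale (snd (z p) b) (0, ?r b)))"
      by (rule conjunct2[OF functional_sum[OF lin]]) (intro W_add W_scale basis)
    also have "\<dots> = (\<Sum>b\<in>Basis. ?r b (fst (z p)) * ?l (b, 0) + snd (z p) b * ?l (0, ?r b))"
      using lin W_scale basis by (simp add: linear_on_carrier_def)
    finally show "(\<Sum>b\<in>Basis. ?r b (fst (z p)) * ?l (b, 0) + snd (z p) b * ?l (0, ?r b)) = ?l (z p)"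
      by simp
  qed
qed

lemma poly_on_funpow:
  assumes z: "\<And>p. p \<in> ambient \<Longrightarrow> z p \<in> W"
    and pol: "\<And>l. linear_on_carrier wscale (*) W l \<Longrightarrow> poly_on (\<lambda>p. l (z p))"
    and l: "linear_on_carrier wscale (*) W l"
  shows "poly_on (\<lambda>p. l ((snd p ^^ j) (z p)))"
  using l
proof (induction j arbitrary: l)
  case 0
  then show ?case using pol by simp
next
  case (Suc j)
  have "(snd p ^^ j) (z p) \<in> W" if "p \<in> ambient" for p
    using symp_endos_funpow_mem[of "snd p" "z p" j] z[OF that] that by (simp add: ambient_def mem_Times_iff)
  then show ?case
    using poly_on_apply[of "\<lambda>p. (snd p ^^ j) (z p)"] Suc by simp
qed

text \<open>
  An alternating form on \<open>W\<close> plus an \<open>m\<close>-dimensional space. At an embedded point \<open>(v, x)\<close> it is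
  the antisymmetrization of the pairing of a functional with the map \<open>combine\<close> below, so its rank
  is twice the dimension of the image of \<open>combine\<close>, which is \<open>image_sum\<close>.
\<close>

definition gram :: "nat \<Rightarrow> nat \<Rightarrow> ('b \<times> ('b \<Rightarrow> 'a)) \<times> ('a, 'b) symp_end \<Rightarrow>
    ('b \<times> ('b \<Rightarrow> 'a)) \<times> (nat \<Rightarrow> 'a) \<Rightarrow> ('b \<times> ('b \<Rightarrow> 'a)) \<times> (nat \<Rightarrow> 'a) \<Rightarrow> 'a" where
  "gram j m p z z' = symp_form ((snd p ^^ j) (fst z)) (fst z')
    + (\<Sum>i<m. snd z i * symp_form ((snd p ^^ i) (fst p)) (fst z'))
    - (\<Sum>i<m. snd z' i * symp_form ((snd p ^^ i) (fst p)) (fst z))"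

lemma symp_form_linear: "u \<in> W \<Longrightarrow> linear_on_carrier wscale (*) W (\<lambda>w. symp_form w u)"
  by (auto simp: linear_on_carrier_def symp_form_def wscale_eq mem_W_iff functional_iff
      case_prod_beta algebra_simps)

lemma poly_on_gram:
  assumes "fst z \<in> W" "fst z' \<in> W"
  shows "poly_on (\<lambda>p. gram j m p z z')"
proof -
  have 1: "poly_on (\<lambda>p. symp_form ((snd p ^^ j) (fst z)) u)" if "u \<in> W" for u j
    by (rule poly_on_funpow[OF _ _ symp_form_linear[OF that]]) (use assms(1) poly_on_const in auto)
  have 2: "poly_on (\<lambda>p. symp_form ((snd p ^^ j) (fst p)) u)" if "u \<in> W" for u j
  proof (rule poly_on_funpow[OF _ _ symp_form_linear[OF that]])
    show "fst p \<in> W" if "p \<in> ambient" for p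
      using that by (auto simp: ambient_def)
    show "poly_on (\<lambda>p. l (fst p))" if "linear_on_carrier wscale (*) W l" for l
      using that by (intro poly_on_linear) (auto simp: linear_on_carrier_def ambient_def escale_eq)
  qed
  show ?thesis
    unfolding gram_def
    by (intro poly_on_add poly_on_diff poly_on_sum poly_on_mult poly_on_const 1 2 assms)
qed

text \<open>Since \<open>g\<close> preserves the symplectic form, the substitution by its inverse on
  \<open>W\<close>, with the coefficients left alone, turns one form into the other.\<close>

lemma gram_act:
  assumes g: "g \<in> symplectic_group scale" and p: "p \<in> ambient" and u: "u \<in> W" "u' \<in> W"
  shows "gram j m (exotic_act scale g p) (u, c) (u', c')
    = gram j m p (inv_into W g u, c) (inv_into W g u', c')"
proof -
  have x: "snd p \<in> symp_endos scale" "fst p \<in> W"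
    using p by (auto simp: ambient_def)
  note gD = symplectic_groupD[OF g]
  have form: "symp_form (g w) u = symp_form w (inv_into W g u)" if "w \<in> W" "u \<in> W" for w u
    using gD(5)[OF that(1) gD(2)[OF that(2)]] that(2) by (simp add: gD(3))
  have pow: "(conjugate g (snd p) ^^ i) w = g ((snd p ^^ i) (inv_into W g w))" if "w \<in> W" for i w
    by (rule conjugate_funpow[OF g x(1) that])
  have gw: "g (fst p) \<in> W"
    by (rule symp_endosD(3)[OF gD(1) x(2)])
  show ?thesis
    unfolding gram_def exotic_act_eq fst_conv snd_conv
    using u x by (simp add: pow gw form gD(2,4) symp_endos_funpow_mem[OF x(1)])
qed

definition image_sum :: "nat \<Rightarrow> nat \<Rightarrow> 'b \<Rightarrow> ('b \<Rightarrow> 'b) \<Rightarrow> 'b set" where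
  "image_sum j m v x = span (range (x ^^ j) \<union> {(x ^^ i) v | i. i < m})"

definition combine :: "nat \<Rightarrow> nat \<Rightarrow> 'b \<Rightarrow> ('b \<Rightarrow> 'b) \<Rightarrow> 'b \<Rightarrow> (nat \<Rightarrow> 'a) \<Rightarrow> 'b" where
  "combine j m v x u c = (x ^^ j) u + (\<Sum>i<m. scale (c i) ((x ^^ i) v))"

lemma image_sum_eq:
  assumes x: "lin x"
  shows "image_sum j m v x = {combine j m v x u c | u c. True}"
proof
  note px = lin_simps[OF lin_funpow[OF x]]
  have sub: "subspace {combine j m v x u c | u c. True}"
    unfolding subspace_def
  proof (intro conjI ballI allI)
    have "0 = combine j m v x 0 (\<lambda>_. 0)"
      by (simp add: combine_def px)
    then show "0 \<in> {combine j m v x u c | u c. True}" by blast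
  next
    fix a b assume "a \<in> {combine j m v x u c | u c. True}" "b \<in> {combine j m v x u c | u c. True}"
    then obtain u c u' c' where "a = combine j m v x u c" "b = combine j m v x u' c'"
      by blast
    then have "a + b = combine j m v x (u + u') (\<lambda>i. c i + c' i)"
      by (simp add: combine_def px scale_left_distrib sum.distrib algebra_simps)
    then show "a + b \<in> {combine j m v x u c | u c. True}" by blast
  next
    fix d a assume "a \<in> {combine j m v x u c | u c. True}"
    then obtain u c where "a = combine j m v x u c" by blast
    then have "scale d a = combine j m v x (scale d u) (\<lambda>i. d * c i)"
      by (simp add: combine_def px scale_right_distrib scale_sum_right)
    then show "scale d a \<in> {combine j m v x u c | u c. True}" by blast
  qed
  have "(x ^^ j) u \<in> {combine j m v x u c | u c. True}" for u
  proof -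
    have "(x ^^ j) u = combine j m v x u (\<lambda>_. 0)"
      by (simp add: combine_def)
    then show ?thesis by blast
  qed
  moreover have "(x ^^ i) v \<in> {combine j m v x u c | u c. True}" if "i < m" for i
  proof -
    have "(\<Sum>k<m. scale (if k = i then 1 else 0) ((x ^^ k) v)) = (\<Sum>k<m. if k = i then (x ^^ k) v else 0)"
      by (rule sum.cong) auto
    then have "(x ^^ i) v = combine j m v x 0 (\<lambda>k. if k = i then 1 else 0)"
      using that by (simp add: combine_def px)
    then show ?thesis by blast
  qed
  ultimately show "image_sum j m v x \<subseteq> {combine j m v x u c | u c. True}"
    unfolding image_sum_def by (intro span_minimal sub) auto
  have "combine j m v x u c \<in> image_sum j m v x" for u c
    unfolding combine_def image_sum_def
    by (intro span_add span_sum span_scale span_base) auto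
  then show "{combine j m v x u c | u c. True} \<subseteq> image_sum j m v x" by blast
qed

text \<open>V and its dual are isotropic, stable under the embedded operator, and the vector (v, 0)
  lies in V. Only pairings of a functional with a vector survive, and the transpose shifts
  \<open>x ^^ j\<close> from the functional to the vector.\<close>

lemma gram_embed:
  assumes x: "lin x" and u: "u \<in> W" "u' \<in> W"
  shows "gram j m (exotic_embed scale (v, x)) (u, c) (u', c')
    = snd u' (combine j m v x (fst u) c) - snd u (combine j m v x (fst u') c')"
proof -
  have v: "(v, 0) \<in> W"
    by (simp add: mem_W_iff functional_iff)
  have lin: "f (a + b) = f a + f b" "f (scale d a) = d * f a" "f 0 = 0"
    if "Vector_Spaces.linear scale (*) f" for f a b and d :: 'a
    using that functional_0[OF that] by (simp_all add: functional_iff)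
  have f_sum: "f (sum g A) = (\<Sum>i\<in>A. f (g i))" if "Vector_Spaces.linear scale (*) f"
    for f :: "'b \<Rightarrow> 'a" and g :: "nat \<Rightarrow> 'b" and A
    by (induction A rule: infinite_finite_induct) (simp_all add: lin[OF that])
  have uf: "Vector_Spaces.linear scale (*) (snd u)" "Vector_Spaces.linear scale (*) (snd u')"
    using u by (simp_all add: mem_W_iff)
  have comb: "f (combine j m v x a c) = f ((x ^^ j) a) + (\<Sum>i<m. c i * f ((x ^^ i) v))"
    if "Vector_Spaces.linear scale (*) f" for f a c
    by (simp add: combine_def lin[OF that] f_sum[OF that])
  show ?thesis
    unfolding gram_def exotic_embed_eq fst_conv snd_conv comb[OF uf(1)] comb[OF uf(2)]
    by (simp add: embed_end_funpow[OF x] u v symp_form_def case_prod_beta)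
qed

text \<open>Each of the two pairings factors through the coordinates of \<open>combine\<close> in a
  basis of \<open>image_sum\<close>, so the form factors through twice that dimension.\<close>

lemma det_gram_eq_0:
  assumes x: "lin x" and z: "\<And>a. fst (z a) \<in> W" "\<And>a. fst (z' a) \<in> W"
    and r: "2 * dim (image_sum j m v x) < r"
  shows "det (mat r r (\<lambda>(a, b). gram j m (exotic_embed scale (v, x)) (z a) (z' b))) = 0"
proof -
  let ?U = "image_sum j m v x"
  obtain B where B: "B \<subseteq> ?U" "independent B" "?U \<subseteq> span B" "card B = dim ?U"
    using basis_exists[of ?U] by blast
  define d where "d = dim ?U"
  have finB: "finite B"
    using finiteI_independent[OF B(2)] .
  obtain e where e: "bij_betw e {..<d} B"
    using ex_bij_betw_nat_finite[OF finB] B(4) by (auto simp: d_def atLeast0LessThan)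
  define h where "h y = combine j m v x (fst (fst y)) (snd y)" for y :: "('b \<times> ('b \<Rightarrow> 'a)) \<times> (nat \<Rightarrow> 'a)"
  have h_mem: "h y \<in> span B" for y
    using B(3) by (auto simp: h_def image_sum_eq[OF x])
  have f_expand: "f (h y) = (\<Sum>k<d. representation B (h y) (e k) * f (e k))"
    if f: "Vector_Spaces.linear scale (*) f" for f :: "'b \<Rightarrow> 'a" and y
  proof -
    have f_sum: "f (sum g A) = (\<Sum>i\<in>A. f (g i))" for g :: "'b \<Rightarrow> 'b" and A
      using functional_0[OF f] f
      by (induction A rule: infinite_finite_induct) (simp_all add: functional_iff)
    have "h y = (\<Sum>b\<in>B. scale (representation B (h y) b) b)"
      by (rule sum_representation_eq[OF B(2) h_mem finB subset_refl, symmetric])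
    then have "f (h y) = f (\<Sum>b\<in>B. scale (representation B (h y) b) b)"
      by (rule arg_cong)
    also have "\<dots> = (\<Sum>b\<in>B. representation B (h y) b * f b)"
      using f by (simp add: f_sum functional_iff)
    finally have "f (h y) = (\<Sum>b\<in>B. representation B (h y) b * f b)" .
    then show ?thesis
      by (simp add: sum.reindex_bij_betw[OF e, of "\<lambda>b. representation B (h y) b * f b"])
  qed
  \<comment> \<open>The two factorizations are concatenated; the second block carries the minus sign
    of the form.\<close>
  define P where "P a k = (if k < d then representation B (h (z a)) (e k) else - snd (fst (z a)) (e (k - d)))" for a k
  define Q where "Q k b = (if k < d then snd (fst (z' b)) (e k) else representation B (h (z' b)) (e (k - d)))" for k b
  have "gram j m (exotic_embed scale (v, x)) (z a) (z' b) = (\<Sum>k<d + d. P a k * Q k b)" for a b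
  proof -
    have "gram j m (exotic_embed scale (v, x)) (z a) (z' b)
        = snd (fst (z' b)) (h (z a)) - snd (fst (z a)) (h (z' b))"
      using gram_embed[OF x z(1)[of a] z(2)[of b], of j m v "snd (z a)" "snd (z' b)"]
      by (simp add: h_def)
    also have "\<dots> = (\<Sum>k<d. representation B (h (z a)) (e k) * snd (fst (z' b)) (e k))
        - (\<Sum>k<d. representation B (h (z' b)) (e k) * snd (fst (z a)) (e k))"
      using z[of a] z[of b] by (simp only: f_expand mem_W_iff)
    also have "\<dots> = (\<Sum>k<d + d. P a k * Q k b)"
      unfolding sum_lessThan_double by (simp add: P_def Q_def sum_negf mult.commute)
    finally show ?thesis .
  qed
  then show ?thesis
    using det_eq_0_if_factors[of "d + d" r P Q] r by (simp add: d_def)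
qed

text \<open>Preimages under \<open>combine\<close> of a basis of \<open>image_sum\<close>, paired
  with functionals dual to that basis, make the Gram matrix the identity.\<close>

lemma det_gram_eq_1:
  assumes x: "lin x"
  obtains z z' where "\<And>a. fst (z a) \<in> W" "\<And>a. fst (z' a) \<in> W"
    "det (mat (2 * dim (image_sum j m v x)) (2 * dim (image_sum j m v x))
      (\<lambda>(a, b). gram j m (exotic_embed scale (v, x)) (z a) (z' b))) = 1"
proof -
  let ?U = "image_sum j m v x"
  obtain B where B: "B \<subseteq> ?U" "independent B" "?U \<subseteq> span B" "card B = dim ?U"
    using basis_exists[of ?U] by blast
  define d where "d = dim ?U"
  have finB: "finite B"
    using finiteI_independent[OF B(2)] .
  obtain e where e: "bij_betw e {..<d} B"
    using ex_bij_betw_nat_finite[OF finB] B(4) by (auto simp: d_def atLeast0LessThan)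
  have "vector_space ((*) :: 'a \<Rightarrow> 'a \<Rightarrow> 'a)"
    by (simp add: vector_space_def algebra_simps)
  note pair = vector_space_pair.intro[OF vector_space_axioms this]
  have "\<exists>f. Vector_Spaces.linear scale (*) f \<and> (\<forall>b\<in>B. f b = (if b = e k then 1 else (0::'a)))" for k
    by (rule vector_space_pair.linear_independent_extend[OF pair B(2)])
  then have "\<forall>k. \<exists>f. Vector_Spaces.linear scale (*) f \<and> (\<forall>b\<in>B. f b = (if b = e k then 1 else (0::'a)))"
    by (rule allI)
  from choice[OF this] obtain f where f: "\<And>k. Vector_Spaces.linear scale (*) (f k)"
    and f_B: "\<And>k b. b \<in> B \<Longrightarrow> f k b = (if b = e k then 1 else (0::'a))"
    by blast
  have f_e: "f k (e l) = (if l = k then 1 else 0)" if "k < d" "l < d" for k l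
    using f_B[of "e l" k] e that by (auto simp: bij_betw_def inj_on_eq_iff)
  have "\<exists>y. combine j m v x (fst y) (snd y) = e k" if "k < d" for k
  proof -
    have "e k \<in> ?U"
      using B(1) e that by (auto simp: bij_betw_def)
    then obtain u c where "e k = combine j m v x u c"
      unfolding image_sum_eq[OF x] by blast
    then show ?thesis
      by (intro exI[of _ "(u, c)"]) simp
  qed
  then have "\<forall>k. \<exists>y. k < d \<longrightarrow> combine j m v x (fst y) (snd y) = e k"
    by blast
  from choice[OF this] obtain y where y: "\<forall>k. k < d \<longrightarrow> combine j m v x (fst (y k)) (snd (y k)) = e k" ..
  define u where "u k = fst (y k)" for k
  define c where "c k = snd (y k)" for k
  have uc: "combine j m v x (u k) (c k) = e k" if "k < d" for k
    using y that by (simp add: u_def c_def)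
  \<comment> \<open>The first half of \<open>z\<close> carries the preimages and the second the
    functionals; in \<open>z'\<close> the halves are swapped. The signs in the second half of
    \<open>z'\<close> compensate the minus sign of the form.\<close>
  define z where "z a = (if a < d then ((u a, 0), c a) else ((0, f (a - d)), \<lambda>_. 0))" for a
  define z' where "z' b = (if b < d then ((0, f b), \<lambda>_. 0)
    else ((- u (b - d), 0), \<lambda>i. - c (b - d) i))" for b
  have mem: "fst (z a) \<in> W" "fst (z' a) \<in> W" for a
    using f by (simp_all add: z_def z'_def mem_W_iff functional_iff)
  have comb0: "combine j m v x 0 (\<lambda>_. 0) = 0"
    by (simp add: combine_def lin_0[OF lin_funpow[OF x]])
  have comb_neg: "combine j m v x (- u k) (\<lambda>i. - c k i) = - combine j m v x (u k) (c k)" for k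
    by (simp add: combine_def lin_minus[OF lin_funpow[OF x]] sum_negf)
  have f_minus: "f k (- y) = - f k y" for k y
    using module_hom.neg[OF Vector_Spaces.linear.axioms(3)[OF f[of k]], of y] .
  have gram: "gram j m (exotic_embed scale (v, x)) (z a) (z' b) = (if a = b then 1 else 0)"
    if "a < 2 * d" "b < 2 * d" for a b
  proof -
    have "gram j m (exotic_embed scale (v, x)) (z a) (z' b)
        = snd (fst (z' b)) (combine j m v x (fst (fst (z a))) (snd (z a)))
        - snd (fst (z a)) (combine j m v x (fst (fst (z' b))) (snd (z' b)))"
      using gram_embed[OF x mem(1)[of a] mem(2)[of b], of j m v "snd (z a)" "snd (z' b)"] by simp
    also have "\<dots> = (if a = b then 1 else 0)"
      using that functional_0[OF f]
      by (auto simp: z_def z'_def uc comb0 comb_neg f_minus f_e)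
    finally show ?thesis .
  qed
  have "mat (2 * d) (2 * d) (\<lambda>(a, b). gram j m (exotic_embed scale (v, x)) (z a) (z' b)) = 1\<^sub>m (2 * d)"
    by (rule eq_matI) (simp_all add: gram)
  then have "det (mat (2 * d) (2 * d) (\<lambda>(a, b). gram j m (exotic_embed scale (v, x)) (z a) (z' b))) = 1"
    by simp
  then show ?thesis
    using that[of z z'] mem unfolding d_def by blast
qed

text \<open>If the dimension d at the point exceeded D, a minor of order 2 d with test vectors
  chosen for this point would be 1 there, yet vanish on the whole orbit, where the rank is at most 2
  D. As a polynomial function it would vanish on the closure as well.\<close>

lemma dim_image_sum_closed:
  assumes bound: "\<And>v' x'. (v', x') \<in> enhanced_orbit scale \<mu>\<nu> \<Longrightarrow> dim (image_sum j m v' x') \<le> D"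
    and x: "lin x"
    and closure: "exotic_embed scale (v, x) \<in> exotic_zariski scale closure_of exotic_orbit scale \<mu>\<nu>"
  shows "dim (image_sum j m v x) \<le> D"
proof (rule ccontr)
  assume "\<not> ?thesis"
  then have D: "2 * D < 2 * dim (image_sum j m v x)" (is "_ < ?r") by simp
  obtain z z' where z: "\<And>a. fst (z a) \<in> W" "\<And>a. fst (z' a) \<in> W"
    and one: "det (mat ?r ?r (\<lambda>(a, b). gram j m (exotic_embed scale (v, x)) (z a) (z' b))) = 1"
    by (rule det_gram_eq_1[OF x]) (rule that)
  have "poly_on (\<lambda>p. det (mat ?r ?r (\<lambda>(a, b). gram j m p (z a) (z' b))))"
    by (intro poly_on_det poly_on_gram z)
  then obtain f where f: "f \<in> polynomial_funs escale ambient"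
    and f_eq: "\<And>p. p \<in> ambient \<Longrightarrow> f p = det (mat ?r ?r (\<lambda>(a, b). gram j m p (z a) (z' b)))"
    unfolding poly_on_def by blast
  have "f q = 0" if "q \<in> exotic_orbit scale \<mu>\<nu>" for q
  proof -
    obtain g p where g: "g \<in> symplectic_group scale" and p: "p \<in> enhanced_orbit scale \<mu>\<nu>"
      and q: "q = exotic_act scale g (exotic_embed scale p)"
      using \<open>q \<in> _\<close> unfolding exotic_orbit_def by blast
    obtain v' x' where vx: "p = (v', x')" by (cases p)
    have x': "lin x'"
      using enhanced_orbit_nilpotent[OF p[unfolded vx]] by (simp add: nilpotents_def)
    have emb: "exotic_embed scale p \<in> ambient"
      using enhanced_orbit_embed_mem_cone[OF p] exotic_cone_subset_ambient by blast
    \<comment> \<open>The group element is transferred to the test vectors; the vanishing at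
      embedded points holds for any test vectors with first component in \<open>W\<close>.\<close>
    let ?y = "\<lambda>a. (inv_into W g (fst (z a)), snd (z a))" and ?y' = "\<lambda>a. (inv_into W g (fst (z' a)), snd (z' a))"
    have "gram j m q (z a) (z' b) = gram j m (exotic_embed scale p) (?y a) (?y' b)" for a b
      using gram_act[OF g emb z(1)[of a] z(2)[of b], of j m "snd (z a)" "snd (z' b)"] by (simp add: q)
    then have "det (mat ?r ?r (\<lambda>(a, b). gram j m q (z a) (z' b)))
        = det (mat ?r ?r (\<lambda>(a, b). gram j m (exotic_embed scale (v', x')) (?y a) (?y' b)))"
      by (simp only: vx)
    also have "\<dots> = 0"
    proof (rule det_gram_eq_0[OF x'])
      show "2 * dim (image_sum j m v' x') < ?r"
        using bound[OF p[unfolded vx]] D by simp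
    qed (simp_all add: z symplectic_groupD(2)[OF g])
    finally show ?thesis
      using f_eq[of q] exotic_act_mem_ambient[OF g emb] q by simp
  qed
  then have "f (exotic_embed scale (v, x)) = 0"
    using closure f unfolding in_closure_iff[OF exotic_orbit_subset_cone] by blast
  moreover have "exotic_embed scale (v, x) \<in> ambient"
    using closure exotic_cone_subset_ambient unfolding in_closure_iff[OF exotic_orbit_subset_cone] by blast
  ultimately show False
    using f_eq one by simp
qed

section \<open>Ranks on an orbit and the closure order\<close>

text \<open>Only the first k rows meet x^j V, each in its length minus j vectors. For a \<ge> \<mu>
  k the vector x^a v brings nothing new: its components in the first k rows have exponent at least
  \<open>\<mu> k + \<nu> i\<close>, hence at least j, and those in the later rows are 0. So at most
  \<mu> k powers of v count, or none if m = 0.\<close>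

lemma dim_image_sum_upper:
  assumes bip: "padded_bipartition (card Basis) \<mu> \<nu>" and orb: "(v, x) \<in> enhanced_orbit scale (\<mu>, \<nu>)"
    and k: "\<And>i. i < k \<Longrightarrow> j \<le> \<mu> i + \<nu> i" "\<And>i. k \<le> i \<Longrightarrow> \<mu> i + \<nu> i \<le> j"
    and e: "m = 0 \<and> e = 0 \<or> e = \<mu> k \<and> (\<forall>i<k. j \<le> \<mu> k + \<nu> i)"
  shows "dim (image_sum j m v x) + k * j \<le> (\<Sum>i<k. \<mu> i + \<nu> i) + e"
proof -
  let ?n = "card Basis"
  obtain Z where lin: "lin x" and zero: "\<And>i. (x ^^ (\<mu> i + \<nu> i)) (Z i) = 0"
    and gen: "generated x (range Z) = UNIV" and v: "v = (\<Sum>i<?n. (x ^^ \<nu> i) (Z i))"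
    by (rule enhanced_orbitE[OF bip orb]) (rule that)
  note px = lin_simps[OF lin_funpow[OF lin]]
  have anti: "antimono \<mu>" and pad: "\<And>i. ?n \<le> i \<Longrightarrow> \<mu> i + \<nu> i = 0"
    using bip by (auto simp: padded_bipartition_def)
  define F where "F = (\<lambda>(i, a). (x ^^ a) (Z i)) ` Sigma {..<k} (\<lambda>i. {j..<\<mu> i + \<nu> i}) \<union> (\<lambda>a. (x ^^ a) v) ` {..<e}"
  have high: "(x ^^ a) (Z i) \<in> span F" if "j \<le> a" for i a
  proof (cases "i < k \<and> a < \<mu> i + \<nu> i")
    case True
    then have "(x ^^ a) (Z i) \<in> F"
      unfolding F_def using that by (intro UnI1 image_eqI[of _ _ "(i, a)"]) auto
    then show ?thesis by (rule span_base)
  next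
    case False
    then have "\<mu> i + \<nu> i \<le> a"
      using k(2)[of i] that by (cases "i < k") auto
    then have "(x ^^ a) (Z i) = 0"
      by (rule funpow_eq_0_mono[OF lin zero])
    then show ?thesis by (simp add: span_zero)
  qed
  have "span ((\<lambda>(i, a). (x ^^ a) (Z i)) ` Sigma {..<?n} (\<lambda>i. {..<\<mu> i + \<nu> i})) \<subseteq> {u. (x ^^ j) u \<in> span F}"
  proof (intro span_minimal subspace_lin_vimage[OF lin_funpow[OF lin]] subspace_span image_subsetI, clarsimp)
    fix i a
    have "(x ^^ j) ((x ^^ a) (Z i)) = (x ^^ (j + a)) (Z i)"
      by (simp add: funpow_plus)
    then show "(x ^^ j) ((x ^^ a) (Z i)) \<in> span F"
      using high[of "j + a" i] by simp
  qed
  then have range: "(x ^^ j) u \<in> span F" for u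
    using rows_span_UNIV[OF lin zero gen pad] by blast
  have vs: "(x ^^ a) v \<in> span F" if "a < m" for a
  proof (cases "a < e")
    case True
    then show ?thesis
      unfolding F_def by (intro span_base UnI2 imageI) simp
  next
    case False
    then have e': "\<mu> k \<le> a" "\<And>i. i < k \<Longrightarrow> j \<le> \<mu> k + \<nu> i"
      using e that by auto
    have "(x ^^ (a + \<nu> i)) (Z i) \<in> span F" for i
    proof (cases "i < k")
      case True
      then show ?thesis using e' by (intro high) (metis add_le_mono1 le_trans)
    next
      case False
      then have "\<mu> i + \<nu> i \<le> a + \<nu> i"
        using antimonoD[OF anti, of k i] e'(1) by simp
      then have "(x ^^ (a + \<nu> i)) (Z i) = 0"
        by (rule funpow_eq_0_mono[OF lin zero])
      then show ?thesis by (simp add: span_zero)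
    qed
    then show ?thesis
      unfolding v px by (intro span_sum) (simp add: funpow_plus)
  qed
  have "image_sum j m v x \<subseteq> span F"
    unfolding image_sum_def using range vs by (intro span_minimal subspace_span) auto
  moreover have "finite F" by (simp add: F_def)
  ultimately have "dim (image_sum j m v x) \<le> card F"
    by (rule dim_le_card)
  also have "card F \<le> (\<Sum>i<k. \<mu> i + \<nu> i - j) + e"
  proof -
    have "card F \<le> card (Sigma {..<k} (\<lambda>i. {j..<\<mu> i + \<nu> i})) + card {..<e}"
      unfolding F_def by (intro order_trans[OF card_Un_le] add_mono card_image_le) simp_all
    then show ?thesis by simp
  qed
  finally have "dim (image_sum j m v x) + k * j \<le> (\<Sum>i<k. \<mu> i + \<nu> i - j) + k * j + e"
    by simp
  also have "(\<Sum>i<k. \<mu> i + \<nu> i - j) + k * j = (\<Sum>i<k. \<mu> i + \<nu> i)"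
  proof -
    have "(\<Sum>i<k. \<mu> i + \<nu> i - j) + k * j = (\<Sum>i<k. (\<mu> i + \<nu> i - j) + j)"
      by (simp add: sum.distrib)
    also have "\<dots> = (\<Sum>i<k. \<mu> i + \<nu> i)"
      by (rule sum.cong) (use k(1) in auto)
    finally show ?thesis .
  qed
  finally show ?thesis .
qed

text \<open>A basis of \<open>image_sum\<close> is completed to a spanning set by sufficiently many
  row vectors, and the cardinality of that set is compared with the dimension. In contrast to the
  upper bound, j is arbitrary here.\<close>

lemma dim_image_sum_lower:
  assumes bip: "padded_bipartition (card Basis) \<mu> \<nu>" and orb: "(v, x) \<in> enhanced_orbit scale (\<mu>, \<nu>)"
    and e: "e = 0 \<or> e = \<mu> k \<and> m = card Basis"
  shows "(\<Sum>i<k. \<mu> i + \<nu> i) + e \<le> dim (image_sum j m v x) + k * j"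
proof -
  let ?n = "card Basis"
  obtain Z where lin: "lin x" and zero: "\<And>i. (x ^^ (\<mu> i + \<nu> i)) (Z i) = 0"
    and gen: "generated x (range Z) = UNIV" and v: "v = (\<Sum>i<?n. (x ^^ \<nu> i) (Z i))"
    by (rule enhanced_orbitE[OF bip orb]) (rule that)
  note px = lin_simps[OF lin_funpow[OF lin]]
  have pad: "\<And>i. ?n \<le> i \<Longrightarrow> \<mu> i + \<nu> i = 0" and size: "(\<Sum>i<?n. \<mu> i + \<nu> i) = ?n"
    using bip by (auto simp: padded_bipartition_def)
  \<comment> \<open>How many vectors of each row to add: the first k rows need only the exponents
    below j, row k can spare its last e vectors when powers of \<open>v\<close> supply them, and
    later rows are taken whole. The range up to \<open>max k n\<close> allows k to exceed the
    dimension n.\<close>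
  define len where "len i = (if i < k then j else if i = k then \<mu> k + \<nu> k - e else \<mu> i + \<nu> i)" for i
  define R where "R = (\<lambda>(i, a). (x ^^ a) (Z i)) ` Sigma {..<max k ?n} (\<lambda>i. {..<len i})"
  let ?U = "image_sum j m v x"
  obtain B where B: "B \<subseteq> ?U" "independent B" "?U \<subseteq> span B" "card B = dim ?U"
    using basis_exists[of ?U] by blast
  have finB: "finite B"
    using finiteI_independent[OF B(2)] .
  let ?T = "span (B \<union> R)"
  have U_sub: "?U \<subseteq> ?T"
    using B(3) span_mono[of B "B \<union> R"] by blast
  have low: "(x ^^ a) (Z i) \<in> ?T" if "a < len i" "i < ?n" for i a
    unfolding R_def by (intro span_base UnI2 image_eqI[of _ _ "(i, a)"]) (use that in auto)
  have other: "(x ^^ a) (Z i) \<in> ?T" if "i \<noteq> k" for i a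
  proof -
    have "\<mu> i + \<nu> i \<le> a \<or> a < \<mu> i + \<nu> i \<and> j \<le> a \<or> a < \<mu> i + \<nu> i \<and> a < len i"
      using that by (simp add: len_def) linarith
    then consider "\<mu> i + \<nu> i \<le> a" | "a < \<mu> i + \<nu> i" "j \<le> a" | "a < \<mu> i + \<nu> i" "a < len i"
      by blast
    then show ?thesis
    proof cases
      case 1
      then have "(x ^^ a) (Z i) = 0"
        by (rule funpow_eq_0_mono[OF lin zero])
      then show ?thesis by (simp add: span_zero)
    next
      case 2
      then have "(x ^^ a) (Z i) = (x ^^ j) ((x ^^ (a - j)) (Z i))"
        by (simp flip: funpow_plus)
      also have "\<dots> \<in> ?U"
        unfolding image_sum_def by (intro span_base) simp
      finally show ?thesis using U_sub by blast
    next
      case 3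
      then have "i < ?n" using pad[of i] by (cases "i < ?n") auto
      then show ?thesis using low 3 by simp
    qed
  qed
  have row_k: "(x ^^ a) (Z k) \<in> ?T" for a
  proof -
    consider "\<mu> k + \<nu> k \<le> a" | "a < \<mu> k + \<nu> k" "a < len k" | "a < \<mu> k + \<nu> k" "len k \<le> a"
      by linarith
    then show ?thesis
    proof cases
      case 1
      then have "(x ^^ a) (Z k) = 0"
        by (rule funpow_eq_0_mono[OF lin zero])
      then show ?thesis by (simp add: span_zero)
    next
      case 2
      then have "k < ?n" using pad[of k] by (cases "k < ?n") auto
      then show ?thesis using low 2 by simp
    next
      case 3
      then have kn: "k < ?n" using pad[of k] by (cases "k < ?n") auto
      have "e \<noteq> 0"
        using 3 by (auto simp: len_def)
      then have em: "e = \<mu> k" "m = ?n"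
        using e by auto
      then have a: "\<nu> k \<le> a" "a - \<nu> k < \<mu> k"
        using 3 by (auto simp: len_def)
      have "\<mu> k + \<nu> k \<le> ?n"
        using member_le_sum[of k "{..<?n}" "\<lambda>i. \<mu> i + \<nu> i"] kn size by simp
      then have "(x ^^ (a - \<nu> k)) v \<in> ?U"
        unfolding image_sum_def em using a by (intro span_base UnI2 CollectI exI[of _ "a - \<nu> k"]) simp
      then have v_mem: "(x ^^ (a - \<nu> k)) v \<in> ?T"
        using U_sub by blast
      \<comment> \<open>The exponent is shifted by \<open>\<nu> k\<close> so that the summand from
        row k is the wanted vector; the summands from all other rows lie in the span by
        \<open>other\<close>.\<close>
      have "(x ^^ (a - \<nu> k)) v = (\<Sum>i<?n. (x ^^ (a - \<nu> k + \<nu> i)) (Z i))"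
        unfolding v px by (simp add: funpow_plus)
      also have "\<dots> = (x ^^ a) (Z k) + (\<Sum>i\<in>{..<?n} - {k}. (x ^^ (a - \<nu> k + \<nu> i)) (Z i))"
        using kn a(1) by (subst sum.remove[of _ k]) simp_all
      finally have "(x ^^ a) (Z k) = (x ^^ (a - \<nu> k)) v - (\<Sum>i\<in>{..<?n} - {k}. (x ^^ (a - \<nu> k + \<nu> i)) (Z i))"
        by simp
      also have "\<dots> \<in> ?T"
        by (intro span_diff v_mem span_sum other) simp
      finally show ?thesis .
    qed
  qed
  have "generated x (range Z) \<subseteq> ?T"
    unfolding generated_def
  proof (rule span_minimal)
    show "{(x ^^ a) z |a z. z \<in> range Z} \<subseteq> ?T"
    proof clarify
      fix a i show "(x ^^ a) (Z i) \<in> ?T"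
        using other[of i a] row_k[of a] by (cases "i = k") simp_all
    qed
  qed simp
  then have "UNIV \<subseteq> ?T"
    using gen by simp
  moreover have "finite (B \<union> R)"
    using finB by (simp add: R_def)
  ultimately have "?n \<le> card (B \<union> R)"
    using dim_le_card[of UNIV "B \<union> R"] by simp
  also have "\<dots> \<le> dim ?U + card R"
    using card_Un_le[of B R] B(4) by simp
  also have "card R \<le> (\<Sum>i<max k ?n. len i)"
    unfolding R_def by (rule order_trans[OF card_image_le]) simp_all
  finally have le: "?n \<le> dim ?U + (\<Sum>i<max k ?n. len i)"
    by simp
  show ?thesis
  proof (cases "k < ?n")
    case True
    have split: "(\<Sum>i<?n. f i) = (\<Sum>i<k. f i) + f k + (\<Sum>i\<in>{k<..<?n}. f i)" for f :: "nat \<Rightarrow> nat"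
    proof -
      have "{..<?n} = {..<k} \<union> insert k {k<..<?n}" "{..<k} \<inter> insert k {k<..<?n} = {}"
        using True by auto
      then have "(\<Sum>i<?n. f i) = (\<Sum>i<k. f i) + (\<Sum>i\<in>insert k {k<..<?n}. f i)"
        using sum.union_disjoint[of "{..<k}" "insert k {k<..<?n}" f] by simp
      then show ?thesis by simp
    qed
    have "(\<Sum>i<?n. len i) = k * j + (\<mu> k + \<nu> k - e) + (\<Sum>i\<in>{k<..<?n}. \<mu> i + \<nu> i)"
      unfolding split[of len] by (simp add: len_def)
    moreover have "?n = (\<Sum>i<k. \<mu> i + \<nu> i) + (\<mu> k + \<nu> k) + (\<Sum>i\<in>{k<..<?n}. \<mu> i + \<nu> i)"
      using split[of "\<lambda>i. \<mu> i + \<nu> i"] size by simp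
    moreover have "e \<le> \<mu> k + \<nu> k"
      using e by auto
    moreover have "max k ?n = ?n"
      using True by simp
    ultimately show ?thesis
      using le by simp
  next
    case False
    then have "e = 0"
      using e pad[of k] by auto
    moreover have "(\<Sum>i<k. \<mu> i + \<nu> i) = ?n"
    proof -
      have "(\<Sum>i<?n. \<mu> i + \<nu> i) = (\<Sum>i<k. \<mu> i + \<nu> i)"
        by (rule sum.mono_neutral_left) (use False pad in auto)
      then show ?thesis using size by simp
    qed
    moreover have "(\<Sum>i<max k ?n. len i) = k * j"
      using False by (simp add: max_def len_def)
    ultimately show ?thesis
      using le by simp
  qed
qed

text \<open>The given basis is arranged in rows of the prescribed lengths and \<open>x\<close> is
  the shift along them. This supplies the point at which the closure hypothesis is tested.\<close>

lemma enhanced_orbit_nonempty: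
  assumes bip: "padded_bipartition (card Basis) \<mu> \<nu>"
  obtains v x where "(v, x) \<in> enhanced_orbit scale (\<mu>, \<nu>)"
proof -
  let ?n = "card Basis"
  define I where "I = Sigma {..<?n} (\<lambda>i. {..<\<mu> i + \<nu> i})"
  have pad: "\<And>i. ?n \<le> i \<Longrightarrow> \<mu> i + \<nu> i = 0" and size: "(\<Sum>i<?n. \<mu> i + \<nu> i) = ?n"
    using bip by (auto simp: padded_bipartition_def)
  have I: "finite I" "card I = ?n"
    using size by (simp_all add: I_def)
  obtain \<phi> where \<phi>: "bij_betw \<phi> I Basis"
    using finite_same_card_bij[OF I(1) finite_Basis I(2)] by blast
  then have span: "span (\<phi> ` I) = UNIV"
    by (simp add: bij_betw_def span_Basis)
  obtain x where lin: "lin x" and x: "\<And>ia. ia \<in> I \<Longrightarrow>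
      x (\<phi> ia) = (if Suc (snd ia) < \<mu> (fst ia) + \<nu> (fst ia) then \<phi> (fst ia, Suc (snd ia)) else 0)"
    using linear_extension[OF I span, of "\<lambda>ia. if Suc (snd ia) < \<mu> (fst ia) + \<nu> (fst ia)
      then \<phi> (fst ia, Suc (snd ia)) else 0"] by blast
  define Z where "Z i = (if 0 < \<mu> i + \<nu> i then \<phi> (i, 0) else 0)" for i
  have mem: "(i, a) \<in> I" if "a < \<mu> i + \<nu> i" for i a
    using that pad[of i] by (cases "i < ?n") (auto simp: I_def)
  have pow: "(x ^^ a) (Z i) = \<phi> (i, a)" if "a < \<mu> i + \<nu> i" for i a
    using that
  proof (induction a)
    case (Suc a)
    then show ?case using x[OF mem[of a i]] by simp
  qed (simp add: Z_def)
  have zero: "(x ^^ (\<mu> i + \<nu> i)) (Z i) = 0" for i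
  proof (cases "\<mu> i + \<nu> i")
    case (Suc a)
    then have "(x ^^ Suc a) (Z i) = x (\<phi> (i, a))"
      using pow[of a i] by simp
    also have "\<dots> = 0"
      using x[OF mem[of a i]] Suc by simp
    finally show ?thesis by (simp only: Suc)
  qed (simp add: Z_def)
  have "\<phi> ` I \<subseteq> generated x (range Z)"
  proof clarify
    fix i a assume "(i, a) \<in> I"
    then have "\<phi> (i, a) = (x ^^ a) (Z i)"
      using pow by (simp add: I_def)
    then show "\<phi> (i, a) \<in> generated x (range Z)"
      by (simp add: generated_funpow lin generated_base)
  qed
  then have "span (\<phi> ` I) \<subseteq> generated x (range Z)"
    by (rule span_minimal[OF _ subspace_generated])
  then have "generated x (range Z) = UNIV"
    using span by auto
  then show ?thesis
    using that enhanced_orbitI[OF bip lin zero _ refl] by blast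
qed

text \<open>One embedded point of the smaller orbit suffices. Its lower bound holds for every j,
  whereas the upper bound on the larger orbit needs a j that separates the row lengths of
  \<open>\<mu> + \<nu>\<close> at k, so j is chosen according to the larger bipartition.\<close>

lemma bipartition_le_if_closure:
  assumes bip: "padded_bipartition (card Basis) \<rho> \<sigma>" "padded_bipartition (card Basis) \<mu> \<nu>"
    and closure: "exotic_orbit scale (\<rho>, \<sigma>) \<subseteq> exotic_zariski scale closure_of exotic_orbit scale (\<mu>, \<nu>)"
  shows "bipartition_le (\<rho>, \<sigma>) (\<mu>, \<nu>)"
proof -
  have anti: "antimono \<mu>" "antimono \<nu>"
    using bip(2) by (auto simp: padded_bipartition_def)
  obtain v x where orb: "(v, x) \<in> enhanced_orbit scale (\<rho>, \<sigma>)"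
    by (rule enhanced_orbit_nonempty[OF bip(1)])
  then have lin: "lin x"
    using enhanced_orbit_nilpotent by (simp add: nilpotents_def)
  have mem: "exotic_embed scale (v, x) \<in> exotic_zariski scale closure_of exotic_orbit scale (\<mu>, \<nu>)"
    using enhanced_orbit_embed_mem_orbit[OF orb] closure by blast
  have compare: "(\<Sum>i<k. \<rho> i + \<sigma> i) + e' \<le> (\<Sum>i<k. \<mu> i + \<nu> i) + e"
    if k: "\<And>i. i < k \<Longrightarrow> j \<le> \<mu> i + \<nu> i" "\<And>i. k \<le> i \<Longrightarrow> \<mu> i + \<nu> i \<le> j"
      and e: "m = 0 \<and> e = 0 \<or> e = \<mu> k \<and> (\<forall>i<k. j \<le> \<mu> k + \<nu> i)"
      and e': "e' = 0 \<or> e' = \<rho> k \<and> m = card Basis" for j k m e e'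
  proof -
    let ?D = "(\<Sum>i<k. \<mu> i + \<nu> i) + e - k * j"
    have upper: "dim (image_sum j m v' x') + k * j \<le> (\<Sum>i<k. \<mu> i + \<nu> i) + e"
      if "(v', x') \<in> enhanced_orbit scale (\<mu>, \<nu>)" for v' x'
      by (rule dim_image_sum_upper[OF bip(2) that k e])
    \<comment> \<open>This makes the subtraction in \<open>?D\<close> exact on natural
      numbers.\<close>
    have "k * j \<le> (\<Sum>i<k. \<mu> i + \<nu> i)"
      using sum_mono[of "{..<k}" "\<lambda>_. j" "\<lambda>i. \<mu> i + \<nu> i"] k(1) by simp
    moreover have "dim (image_sum j m v x) \<le> ?D"
      by (rule dim_image_sum_closed[OF _ lin mem]) (use upper in fastforce)
    ultimately show ?thesis
      using dim_image_sum_lower[OF bip(1) orb e', of j] by linarith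
  qed
  show ?thesis
    unfolding bipartition_le_def prod.case
  proof (intro allI conjI)
    fix k
    \<comment> \<open>Without powers of \<open>v\<close>, the length of row k itself separates the
      earlier rows from the later ones.\<close>
    have "(\<Sum>i<k. \<rho> i + \<sigma> i) + 0 \<le> (\<Sum>i<k. \<mu> i + \<nu> i) + 0"
      by (rule compare[of k "\<mu> k + \<nu> k" 0])
        (auto intro!: add_mono antimonoD[OF anti(1)] antimonoD[OF anti(2)])
    then show "(\<Sum>i<k. \<rho> i + \<sigma> i) \<le> (\<Sum>i<k. \<mu> i + \<nu> i)"
      by simp
    \<comment> \<open>For k > 0 the value \<mu> k + \<nu> (k - 1) lies between the lengths of rows k
      and k - 1. It is also at most \<mu> k + \<nu> i for all i < k, which is what bounds the
      contribution of the powers of \<open>v\<close>. For k = 0 only the upper bound on row lengths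
      matters.\<close>
    define j where "j = (case k of 0 \<Rightarrow> \<mu> 0 + \<nu> 0 | Suc l \<Rightarrow> \<mu> k + \<nu> l)"
    have below: "j \<le> \<mu> k + \<nu> i" if "i < k" for i
      using that antimonoD[OF anti(2), of i "k - 1"] by (cases k) (auto simp: j_def)
    show "(\<Sum>i<k. \<rho> i + \<sigma> i) + \<rho> k \<le> (\<Sum>i<k. \<mu> i + \<nu> i) + \<mu> k"
    proof (rule compare[of k j "card Basis"])
      show "j \<le> \<mu> i + \<nu> i" if "i < k" for i
        using below[OF that] antimonoD[OF anti(1), of i k] that by simp
      show "\<mu> i + \<nu> i \<le> j" if "k \<le> i" for i
      proof (cases k)
        case 0
        then show ?thesis
          using antimonoD[OF anti(1), of 0 i] antimonoD[OF anti(2), of 0 i] by (simp add: j_def)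
      next
        case (Suc l)
        then show ?thesis
          using antimonoD[OF anti(1) that] antimonoD[OF anti(2), of l i] that by (simp add: j_def)
      qed
    qed (use below in auto)
  qed
qed

end

section \<open>Passage to algebraically closed fields and conclusion\<close>

lemma infinite_UNIV_alg_closed: "infinite (UNIV :: 'a::alg_closed_field set)"
proof
  assume fin: "finite (UNIV :: 'a set)"
  \<comment> \<open>Over a finite field the product of all X - a vanishes at every point, so adding
    1 leaves a polynomial of positive degree without roots.\<close>
  define p where "p = (\<Prod>a\<in>UNIV. [:- a, 1 :: 'a:]) + 1"
  have "poly p z = 1" for z
  proof -
    have "(\<Prod>a\<in>UNIV. poly [:- a, 1:] z) = 0"
      by (rule prod_zero[OF fin]) (rule bexI[of _ z]; simp)
    then show ?thesis
      by (simp add: p_def poly_prod)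
  qed
  moreover have "degree p = card (UNIV :: 'a set)"
  proof -
    have deg: "degree (\<Prod>a\<in>UNIV. [:- a, 1 :: 'a:]) = card (UNIV :: 'a set)"
      by (subst degree_prod_eq_sum_degree) simp_all
    moreover have "0 < card (UNIV :: 'a set)"
      using fin by (simp add: card_gt_0_iff)
    ultimately show ?thesis
      unfolding p_def by (subst degree_add_eq_left) simp_all
  qed
  then have "0 < degree p"
    using fin by (simp add: card_gt_0_iff)
  ultimately show False
    using alg_closed_imp_poly_has_root[of p] by simp
qed

theorem theorem6p3:
  fixes s :: "'a::alg_closed_field \<Rightarrow> 'v::ab_group_add \<Rightarrow> 'v"
    and B :: "'v set"
    and n :: nat
    and \<rho> \<sigma> \<mu> \<nu> :: "nat \<Rightarrow> nat"
  assumes "CHAR('a) \<noteq> 2"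
    and "finite_dimensional_vector_space s B"
    and "vector_space.dim s (UNIV :: 'v set) = n"
    and "(\<rho>, \<sigma>) \<in> bipartitions n"
    and "(\<mu>, \<nu>) \<in> bipartitions n"
  shows "exotic_orbit s (\<rho>, \<sigma>) \<subseteq> exotic_zariski s closure_of exotic_orbit s (\<mu>, \<nu>)
    \<longleftrightarrow> bipartition_le (\<rho>, \<sigma>) (\<mu>, \<nu>)"
proof -
  interpret fin_dim_space s B
    using assms(2) by (simp add: fin_dim_space_def)
  have bip: "padded_bipartition (card B) \<rho> \<sigma>" "padded_bipartition (card B) \<mu> \<nu>"
    using assms(3-5) by (simp_all add: bipartitions_iff)
  show ?thesis
    using bipartition_le_if_closure[OF bip] exotic_orbit_subset_closure[OF infinite_UNIV_alg_closed bip]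
    by blast
qed

end
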